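(* Let $R$ be an ordinary standard differential ring of finite differential type, with locally nilpotent derivation, that has either differential type zero or finite differential dimension. Then $R$ is a J-ring.
   Context: All rings are commutative with identity. A differential ring is a ring with finitely many pairwise commuting derivations; it is ordinary if it has exactly one distinguished derivation. A derivation $\partial$ of $R$ is locally nilpotent if for every $a\in R$ there is $n$ with $\partial^n(a)=0$. An ideal is differential if it is stable under the derivations; $\operatorname{Spec}^{\Delta}R$ is the set of differential prime ideals of $R$, assumed nonempty. $R\{z_1,\dots,z_n\}$ is the ring of differential polynomials in $n$ differential indeterminates over $R$. $R$ is standard if for every differential prime $\mathfrak p$ of $R$ the residue field $R_{\mathfrak p}/\mathfrak pR_{\mathfrak p}$ has characteristic zero. Gap measure: for $X\subseteq\operatorname{Spec}^{\Delta}R$ there is a unique function $\mu$ with values in $\mathbb Z\cup\{\infty\}$ on pairs $(\mathfrak p,\mathfrak p')$ of elements of $X$ with $\mathfrak p\supseteq\mathfrak p'$ such that: (1) $\mu(\mathfrak p,\mathfrak p')\ge 0$; (2) $\mu(\mathfrak p,\mathfrak p')=0$ iff $\mathfrak p=\mathfrak p'$ or there is no infinite strictly descending chain $\mathfrak p=\mathfrak p_0\supsetneq\mathfrak p_1\supsetneq\cdots\supseteq\mathfrak p'$ in $X$; (3) for an integer $d>0$, $\mu(\mathfrak p,\mathfrak p')\ge d$ iff $\mathfrak p\ne\mathfrak p'$ and there is an infinite strictly descending sequence $\mathfrak p=\mathfrak p_0\supsetneq\mathfrak p_1\supsetneq\cdots\supseteq\mathfrak p'$ in $X$ (all terms containing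 $\mathfrak p'$) with $\mu(\mathfrak p_{i-1},\mathfrak p_i)\ge d-1$ for all $i\ge 1$. The differential type $\operatorname{type}^{\Delta}R$ is the supremum of all $\mu(\mathfrak p,\mathfrak p')$ with $\mathfrak p\supseteq\mathfrak p'$ in $X=\operatorname{Spec}^{\Delta}R$. The differential dimension $\dim^{\Delta}R$ is the supremum of the integers $k\ge 0$ such that there is a chain $\mathfrak p_0\supsetneq\cdots\supsetneq\mathfrak p_k$ in $\operatorname{Spec}^{\Delta}R$ with $\mu(\mathfrak p_{i-1},\mathfrak p_i)=\operatorname{type}^{\Delta}R$ for $i=1,\dots,k$. J-ring: a differential ring $R$ with $m$ derivations and finite differential type $t$ is a J-ring if for every $n>0$ one has $\operatorname{type}^{\Delta}R\{z_1,\dots,z_n\}=\max(t,m)$ and: (i) $\dim^{\Delta}R\{z_1,\dots,z_n\}=n$ if $t<m$; (ii) $\dim^{\Delta}R<\infty$ and $\dim^{\Delta}R\{z_1,\dots,z_n\}=n+\dim^{\Delta}R$ if $t=m$; (iii) $\dim^{\Delta}R<\infty$ and $\dim^{\Delta}R\{z_1,\dots,z_n\}=\dim^{\Delta}R$ if $t>m$. (Here $m=1$.) *)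

theory Defs
  imports
    "HOL-Algebra.Algebra"
    "HOL-Algebra.Algebraic_Closure_Type"
    "HOL-Library.Poly_Mapping"
    "HOL-Library.Extended_Nat"
begin

section \<open>Ordinary differential rings\<close>

locale ordinary_differential_ring = cring R for R (structure) +
  fixes d :: "'a \<Rightarrow> 'a"
  assumes deriv_closed: "a \<in> carrier R \<Longrightarrow> d a \<in> carrier R"
    and deriv_add: "\<lbrakk>a \<in> carrier R; b \<in> carrier R\<rbrakk> \<Longrightarrow> d (a \<oplus> b) = d a \<oplus> d b"
    and deriv_mult:
      "\<lbrakk>a \<in> carrier R; b \<in> carrier R\<rbrakk> \<Longrightarrow> d (a \<otimes> b) = d a \<otimes> b \<oplus> a \<otimes> d b"

definition locally_nilpotent :: "('a, 'b) ring_scheme \<Rightarrow> ('a \<Rightarrow> 'a) \<Rightarrow> bool" where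
  "locally_nilpotent R d \<longleftrightarrow> (\<forall>a\<in>carrier R. \<exists>n::nat. (d ^^ n) a = \<zero>\<^bsub>R\<^esub>)"

definition diff_spec :: "('a, 'b) ring_scheme \<Rightarrow> ('a \<Rightarrow> 'a) \<Rightarrow> 'a set set" where
  "diff_spec R d = {P. primeideal P R \<and> d ` P \<subseteq> P}"


section \<open>Localization at a prime, residue fields and standard rings\<close>

definition loc_rel ::
    "('a, 'b) ring_scheme \<Rightarrow> 'a set \<Rightarrow> (('a \<times> 'a) \<times> ('a \<times> 'a)) set" where
  "loc_rel R P = {((a, s), (b, t)) | a s b t.
     a \<in> carrier R \<and> b \<in> carrier R \<and> s \<in> carrier R - P \<and> t \<in> carrier R - P \<and>
     (\<exists>u\<in>carrier R - P. u \<otimes>\<^bsub>R\<^esub> (a \<otimes>\<^bsub>R\<^esub> t) = u \<otimes>\<^bsub>R\<^esub> (b \<otimes>\<^bsub>R\<^esub> s))}"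

definition loc_frac ::
    "('a, 'b) ring_scheme \<Rightarrow> 'a set \<Rightarrow> 'a \<Rightarrow> 'a \<Rightarrow> ('a \<times> 'a) set" where
  "loc_frac R P a s = loc_rel R P `` {(a, s)}"

definition localization :: "('a, 'b) ring_scheme \<Rightarrow> 'a set \<Rightarrow> ('a \<times> 'a) set ring" where
  "localization R P =
    \<lparr>carrier = (carrier R \<times> (carrier R - P)) // loc_rel R P,
     monoid.mult = (\<lambda>U V. \<Union>{loc_frac R P (a \<otimes>\<^bsub>R\<^esub> b) (s \<otimes>\<^bsub>R\<^esub> t) | a s b t.
       (a, s) \<in> U \<and> (b, t) \<in> V}),
     one = loc_frac R P \<one>\<^bsub>R\<^esub> \<one>\<^bsub>R\<^esub>,
     ring.zero = loc_frac R P \<zero>\<^bsub>R\<^esub> \<one>\<^bsub>R\<^esub>,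
     add = (\<lambda>U V. \<Union>{loc_frac R P (a \<otimes>\<^bsub>R\<^esub> t \<oplus>\<^bsub>R\<^esub> b \<otimes>\<^bsub>R\<^esub> s) (s \<otimes>\<^bsub>R\<^esub> t) | a s b t.
       (a, s) \<in> U \<and> (b, t) \<in> V})\<rparr>"

definition loc_max_ideal :: "('a, 'b) ring_scheme \<Rightarrow> 'a set \<Rightarrow> ('a \<times> 'a) set set" where
  "loc_max_ideal R P = {loc_frac R P a s | a s. a \<in> P \<and> s \<in> carrier R - P}"

definition residue_field :: "('a, 'b) ring_scheme \<Rightarrow> 'a set \<Rightarrow> ('a \<times> 'a) set set ring" where
  "residue_field R P = localization R P Quot loc_max_ideal R P"

definition has_char_zero :: "('a, 'b) ring_scheme \<Rightarrow> bool" where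
  "has_char_zero K \<longleftrightarrow> (\<forall>n::nat. 0 < n \<longrightarrow> [n] \<cdot>\<^bsub>K\<^esub> \<one>\<^bsub>K\<^esub> \<noteq> \<zero>\<^bsub>K\<^esub>)"

definition standard_ring :: "('a, 'b) ring_scheme \<Rightarrow> ('a \<Rightarrow> 'a) \<Rightarrow> bool" where
  "standard_ring R d \<longleftrightarrow> (\<forall>P\<in>diff_spec R d. has_char_zero (residue_field R P))"

context primeideal
begin

lemma loc_one: "\<one> \<in> carrier R - I"
  using I_notcarr one_imp_carrier by blast

lemma loc_mult: "s \<in> carrier R - I \<Longrightarrow> t \<in> carrier R - I \<Longrightarrow> s \<otimes> t \<in> carrier R - I"
  using I_prime by blast

lemma loc_rel_iff:
  "((a, s), (b, t)) \<in> loc_rel R I \<longleftrightarrow>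
     a \<in> carrier R \<and> b \<in> carrier R \<and> s \<in> carrier R - I \<and> t \<in> carrier R - I \<and>
     (\<exists>u\<in>carrier R - I. u \<otimes> (a \<otimes> t) = u \<otimes> (b \<otimes> s))"
  by (simp add: loc_rel_def)

lemma loc_equiv: "equiv (carrier R \<times> (carrier R - I)) (loc_rel R I)"
proof (rule equivI)
  show "loc_rel R I \<subseteq> (carrier R \<times> (carrier R - I)) \<times> (carrier R \<times> (carrier R - I))"
    by (auto simp: loc_rel_def)
  show "refl_on (carrier R \<times> (carrier R - I)) (loc_rel R I)"
    using loc_one by (auto simp: refl_on_def loc_rel_def)
  show "sym (loc_rel R I)"
  proof (rule symI)
    fix x y assume "(x, y) \<in> loc_rel R I"
    then show "(y, x) \<in> loc_rel R I"
      by (cases x; cases y) (simp only: loc_rel_iff, metis)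
  qed
  show "trans (loc_rel R I)"
  proof (rule transI)
    fix x y z assume "(x, y) \<in> loc_rel R I" "(y, z) \<in> loc_rel R I"
    moreover obtain a s b t c r where xyz: "x = (a, s)" "y = (b, t)" "z = (c, r)"
      by (cases x; cases y; cases z) blast
    ultimately obtain u v where
      car: "a \<in> carrier R" "b \<in> carrier R" "c \<in> carrier R"
        "s \<in> carrier R - I" "t \<in> carrier R - I" "r \<in> carrier R - I"
        "u \<in> carrier R - I" "v \<in> carrier R - I"
      and eq: "u \<otimes> (a \<otimes> t) = u \<otimes> (b \<otimes> s)" "v \<otimes> (b \<otimes> r) = v \<otimes> (c \<otimes> t)"
      unfolding loc_rel_iff xyz by metis
    have c: "s \<in> carrier R" "t \<in> carrier R" "r \<in> carrier R" "u \<in> carrier R" "v \<in> carrier R"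
      using car by auto
    have "(u \<otimes> v \<otimes> t) \<otimes> (a \<otimes> r) = (v \<otimes> r) \<otimes> (u \<otimes> (a \<otimes> t))"
      using c car(1-3) by (simp add: m_ac)
    also have "\<dots> = (u \<otimes> s) \<otimes> (v \<otimes> (b \<otimes> r))"
      unfolding eq(1) using c car(1-3) by (simp add: m_ac)
    also have "\<dots> = (u \<otimes> v \<otimes> t) \<otimes> (c \<otimes> s)"
      unfolding eq(2) using c car(1-3) by (simp add: m_ac)
    finally have "(u \<otimes> v \<otimes> t) \<otimes> (a \<otimes> r) = (u \<otimes> v \<otimes> t) \<otimes> (c \<otimes> s)" .
    moreover have "u \<otimes> v \<otimes> t \<in> carrier R - I"
      using car loc_mult by blast
    ultimately show "(x, z) \<in> loc_rel R I"
      unfolding loc_rel_iff xyz using car by blast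
  qed
qed

lemma loc_frac_eq_iff:
  assumes "a \<in> carrier R" "b \<in> carrier R" "s \<in> carrier R - I" "t \<in> carrier R - I"
  shows "loc_frac R I a s = loc_frac R I b t \<longleftrightarrow>
    (\<exists>u\<in>carrier R - I. u \<otimes> (a \<otimes> t) = u \<otimes> (b \<otimes> s))"
proof -
  have "loc_frac R I a s = loc_frac R I b t \<longleftrightarrow> ((a, s), (b, t)) \<in> loc_rel R I"
    unfolding loc_frac_def by (rule eq_equiv_class_iff[OF loc_equiv]) (use assms in auto)
  then show ?thesis using assms by (simp add: loc_rel_def)
qed

lemma loc_carrier:
  "carrier (localization R I) = {loc_frac R I a s | a s. a \<in> carrier R \<and> s \<in> carrier R - I}"
  by (auto simp: localization_def quotient_def loc_frac_def)

lemma loc_frac_members: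
  "(b, t) \<in> loc_frac R I a s \<longleftrightarrow> ((a, s), (b, t)) \<in> loc_rel R I"
  by (simp add: loc_frac_def)

lemma loc_mult_frac:
  assumes "a \<in> carrier R" "b \<in> carrier R" "s \<in> carrier R - I" "t \<in> carrier R - I"
  shows "loc_frac R I a s \<otimes>\<^bsub>localization R I\<^esub> loc_frac R I b t
    = loc_frac R I (a \<otimes> b) (s \<otimes> t)"
proof -
  have *: "loc_frac R I (a' \<otimes> b') (s' \<otimes> t') = loc_frac R I (a \<otimes> b) (s \<otimes> t)"
    if m: "(a', s') \<in> loc_frac R I a s" "(b', t') \<in> loc_frac R I b t" for a' s' b' t'
  proof -
    obtain u v where car: "a' \<in> carrier R" "b' \<in> carrier R" "s' \<in> carrier R - I"
        "t' \<in> carrier R - I" "u \<in> carrier R - I" "v \<in> carrier R - I"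
      and eq: "u \<otimes> (a \<otimes> s') = u \<otimes> (a' \<otimes> s)" "v \<otimes> (b \<otimes> t') = v \<otimes> (b' \<otimes> t)"
      using m unfolding loc_frac_members loc_rel_iff by metis
    have c: "s \<in> carrier R" "t \<in> carrier R" "s' \<in> carrier R" "t' \<in> carrier R"
        "u \<in> carrier R" "v \<in> carrier R"
      using car assms by auto
    have "(u \<otimes> v) \<otimes> ((a' \<otimes> b') \<otimes> (s \<otimes> t)) = (u \<otimes> (a' \<otimes> s)) \<otimes> (v \<otimes> (b' \<otimes> t))"
      using c car(1,2) by (simp add: m_ac)
    also have "\<dots> = (u \<otimes> v) \<otimes> ((a \<otimes> b) \<otimes> (s' \<otimes> t'))"
      unfolding eq[symmetric] using c assms(1,2) by (simp add: m_ac)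
    finally show ?thesis
      using car assms loc_mult by (subst loc_frac_eq_iff) (auto intro!: bexI[of _ "u \<otimes> v"])
  qed
  have "(a, s) \<in> loc_frac R I a s" "(b, t) \<in> loc_frac R I b t"
    using assms loc_one unfolding loc_frac_members loc_rel_iff by blast+
  then have "{loc_frac R I (a' \<otimes> b') (s' \<otimes> t') | a' s' b' t'.
      (a', s') \<in> loc_frac R I a s \<and> (b', t') \<in> loc_frac R I b t}
      = {loc_frac R I (a \<otimes> b) (s \<otimes> t)}"
    using * by blast
  then show ?thesis
    unfolding localization_def by simp
qed

lemma loc_add_frac:
  assumes "a \<in> carrier R" "b \<in> carrier R" "s \<in> carrier R - I" "t \<in> carrier R - I"
  shows "loc_frac R I a s \<oplus>\<^bsub>localization R I\<^esub> loc_frac R I b t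
    = loc_frac R I (a \<otimes> t \<oplus> b \<otimes> s) (s \<otimes> t)"
proof -
  have *: "loc_frac R I (a' \<otimes> t' \<oplus> b' \<otimes> s') (s' \<otimes> t') = loc_frac R I (a \<otimes> t \<oplus> b \<otimes> s) (s \<otimes> t)"
    if m: "(a', s') \<in> loc_frac R I a s" "(b', t') \<in> loc_frac R I b t" for a' s' b' t'
  proof -
    obtain u v where car: "a' \<in> carrier R" "b' \<in> carrier R" "s' \<in> carrier R - I"
        "t' \<in> carrier R - I" "u \<in> carrier R - I" "v \<in> carrier R - I"
      and eq: "u \<otimes> (a \<otimes> s') = u \<otimes> (a' \<otimes> s)" "v \<otimes> (b \<otimes> t') = v \<otimes> (b' \<otimes> t)"
      using m unfolding loc_frac_members loc_rel_iff by metis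
    have c: "s \<in> carrier R" "t \<in> carrier R" "s' \<in> carrier R" "t' \<in> carrier R"
        "u \<in> carrier R" "v \<in> carrier R"
      using car assms by auto
    have "(u \<otimes> v) \<otimes> ((a' \<otimes> t' \<oplus> b' \<otimes> s') \<otimes> (s \<otimes> t))
        = (v \<otimes> t \<otimes> t') \<otimes> (u \<otimes> (a' \<otimes> s)) \<oplus> (u \<otimes> s \<otimes> s') \<otimes> (v \<otimes> (b' \<otimes> t))"
      using c car(1,2) by (simp add: m_ac l_distr r_distr)
    also have "\<dots> = (u \<otimes> v) \<otimes> ((a \<otimes> t \<oplus> b \<otimes> s) \<otimes> (s' \<otimes> t'))"
      unfolding eq[symmetric] using c assms(1,2) by (simp add: m_ac l_distr r_distr)
    finally show ?thesis
      using car assms loc_mult by (subst loc_frac_eq_iff) (auto intro!: bexI[of _ "u \<otimes> v"])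
  qed
  have "(a, s) \<in> loc_frac R I a s" "(b, t) \<in> loc_frac R I b t"
    using assms loc_one unfolding loc_frac_members loc_rel_iff by blast+
  then have "{loc_frac R I (a' \<otimes> t' \<oplus> b' \<otimes> s') (s' \<otimes> t') | a' s' b' t'.
      (a', s') \<in> loc_frac R I a s \<and> (b', t') \<in> loc_frac R I b t}
      = {loc_frac R I (a \<otimes> t \<oplus> b \<otimes> s) (s \<otimes> t)}"
    using * by blast
  then show ?thesis
    unfolding localization_def by simp
qed

lemma loc_cring: "cring (localization R I)"
proof (rule cringI)
  let ?L = "localization R I"
  have fr: "loc_frac R I a s \<in> carrier ?L" if "a \<in> carrier R" "s \<in> carrier R - I" for a s
    using that unfolding loc_carrier by blast
  have E: "\<exists>a s. x = loc_frac R I a s \<and> a \<in> carrier R \<and> s \<in> carrier R - I"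
    if "x \<in> carrier ?L" for x
    using that unfolding loc_carrier by blast
  have eqI: "loc_frac R I a s = loc_frac R I b t"
    if "a \<in> carrier R" "b \<in> carrier R" "s \<in> carrier R - I" "t \<in> carrier R - I"
      "a \<otimes> t = b \<otimes> s" for a b s t
    using that loc_one by (subst loc_frac_eq_iff) auto
  have zero: "\<zero>\<^bsub>?L\<^esub> = loc_frac R I \<zero> \<one>" and one: "\<one>\<^bsub>?L\<^esub> = loc_frac R I \<one> \<one>"
    by (simp_all add: localization_def)
  note [simp] = loc_mult_frac loc_add_frac zero one fr loc_one loc_mult[simplified]
  show "abelian_group ?L"
  proof (rule abelian_groupI)
    fix x y assume "x \<in> carrier ?L" "y \<in> carrier ?L"
    then obtain a s b t where x: "x = loc_frac R I a s" "a \<in> carrier R" "s \<in> carrier R - I"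
      and y: "y = loc_frac R I b t" "b \<in> carrier R" "t \<in> carrier R - I" by (meson E)
    show "x \<oplus>\<^bsub>?L\<^esub> y \<in> carrier ?L" using x y loc_one by simp
    show "x \<oplus>\<^bsub>?L\<^esub> y = y \<oplus>\<^bsub>?L\<^esub> x" using x y by (simp add: m_comm a_comm)
  next
    fix x y z assume "x \<in> carrier ?L" "y \<in> carrier ?L" "z \<in> carrier ?L"
    then obtain a s b t c u where x: "x = loc_frac R I a s" "a \<in> carrier R" "s \<in> carrier R - I"
      and y: "y = loc_frac R I b t" "b \<in> carrier R" "t \<in> carrier R - I"
      and z: "z = loc_frac R I c u" "c \<in> carrier R" "u \<in> carrier R - I" by (meson E)
    show "x \<oplus>\<^bsub>?L\<^esub> y \<oplus>\<^bsub>?L\<^esub> z = x \<oplus>\<^bsub>?L\<^esub> (y \<oplus>\<^bsub>?L\<^esub> z)"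
      using x y z by (simp add: m_ac a_ac l_distr r_distr)
  next
    fix x assume "x \<in> carrier ?L"
    then obtain a s where x: "x = loc_frac R I a s" "a \<in> carrier R" "s \<in> carrier R - I"
      by (meson E)
    show "\<zero>\<^bsub>?L\<^esub> \<oplus>\<^bsub>?L\<^esub> x = x" using x loc_one by simp
    have "loc_frac R I (\<ominus> a) s \<oplus>\<^bsub>?L\<^esub> x = \<zero>\<^bsub>?L\<^esub>"
      using x loc_one by (simp add: l_minus l_neg) (intro eqI, auto simp: l_minus l_neg)
    then show "\<exists>y\<in>carrier ?L. y \<oplus>\<^bsub>?L\<^esub> x = \<zero>\<^bsub>?L\<^esub>"
      using x by (intro bexI[of _ "loc_frac R I (\<ominus> a) s"]) auto
  qed (use loc_one in simp)
  show "Group.comm_monoid ?L"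
  proof (rule comm_monoidI)
    fix x y assume "x \<in> carrier ?L" "y \<in> carrier ?L"
    then obtain a s b t where x: "x = loc_frac R I a s" "a \<in> carrier R" "s \<in> carrier R - I"
      and y: "y = loc_frac R I b t" "b \<in> carrier R" "t \<in> carrier R - I" by (meson E)
    show "x \<otimes>\<^bsub>?L\<^esub> y \<in> carrier ?L" using x y by simp
    show "x \<otimes>\<^bsub>?L\<^esub> y = y \<otimes>\<^bsub>?L\<^esub> x" using x y by (simp add: m_comm)
  next
    fix x y z assume "x \<in> carrier ?L" "y \<in> carrier ?L" "z \<in> carrier ?L"
    then obtain a s b t c u where x: "x = loc_frac R I a s" "a \<in> carrier R" "s \<in> carrier R - I"
      and y: "y = loc_frac R I b t" "b \<in> carrier R" "t \<in> carrier R - I"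
      and z: "z = loc_frac R I c u" "c \<in> carrier R" "u \<in> carrier R - I" by (meson E)
    show "x \<otimes>\<^bsub>?L\<^esub> y \<otimes>\<^bsub>?L\<^esub> z = x \<otimes>\<^bsub>?L\<^esub> (y \<otimes>\<^bsub>?L\<^esub> z)"
      using x y z by (simp add: m_ac)
  next
    fix x assume "x \<in> carrier ?L"
    then obtain a s where x: "x = loc_frac R I a s" "a \<in> carrier R" "s \<in> carrier R - I"
      by (meson E)
    show "\<one>\<^bsub>?L\<^esub> \<otimes>\<^bsub>?L\<^esub> x = x" using x loc_one by simp
  qed (use loc_one in simp)
  fix x y z assume "x \<in> carrier ?L" "y \<in> carrier ?L" "z \<in> carrier ?L"
  then obtain a s b t c u where x: "x = loc_frac R I a s" "a \<in> carrier R" "s \<in> carrier R - I"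
    and y: "y = loc_frac R I b t" "b \<in> carrier R" "t \<in> carrier R - I"
    and z: "z = loc_frac R I c u" "c \<in> carrier R" "u \<in> carrier R - I" by (meson E)
  show "(x \<oplus>\<^bsub>?L\<^esub> y) \<otimes>\<^bsub>?L\<^esub> z = x \<otimes>\<^bsub>?L\<^esub> z \<oplus>\<^bsub>?L\<^esub> y \<otimes>\<^bsub>?L\<^esub> z"
    using x y z by simp (intro eqI, auto simp: m_ac l_distr r_distr)
qed

lemma loc_mem_max_ideal:
  assumes "a \<in> carrier R" "s \<in> carrier R - I"
  shows "loc_frac R I a s \<in> loc_max_ideal R I \<longleftrightarrow> a \<in> I"
proof
  assume "loc_frac R I a s \<in> loc_max_ideal R I"
  then obtain b t where b: "b \<in> I" "t \<in> carrier R - I" "loc_frac R I a s = loc_frac R I b t"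
    unfolding loc_max_ideal_def by blast
  then have bc: "b \<in> carrier R" by (simp add: Icarr)
  then obtain u where u: "u \<in> carrier R - I" "u \<otimes> (a \<otimes> t) = u \<otimes> (b \<otimes> s)"
    using loc_frac_eq_iff[of a b s t] assms b by blast
  have "u \<otimes> (b \<otimes> s) \<in> I" using u(1) assms b(1) by (simp add: I_l_closed I_r_closed)
  then have "u \<otimes> (a \<otimes> t) \<in> I" by (simp add: u(2))
  then show "a \<in> I" using I_prime u(1) assms b(2) by (metis DiffE m_closed)
next
  assume "a \<in> I"
  then show "loc_frac R I a s \<in> loc_max_ideal R I"
    using assms unfolding loc_max_ideal_def by blast
qed

lemma loc_max_ideal: "ideal (loc_max_ideal R I) (localization R I)"
proof -
  let ?L = "localization R I" and ?M = "loc_max_ideal R I"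
  interpret L: cring ?L by (rule loc_cring)
  have E: "\<exists>a s. x = loc_frac R I a s \<and> a \<in> I \<and> a \<in> carrier R \<and> s \<in> carrier R - I"
    if "x \<in> ?M" for x
    using that Icarr unfolding loc_max_ideal_def by blast
  have E': "\<exists>a s. x = loc_frac R I a s \<and> a \<in> carrier R \<and> s \<in> carrier R - I"
    if "x \<in> carrier ?L" for x
    using that unfolding loc_carrier by blast
  have sub: "?M \<subseteq> carrier ?L" using Icarr unfolding loc_max_ideal_def loc_carrier by blast
  have mult: "y \<otimes>\<^bsub>?L\<^esub> x \<in> ?M" if xy: "x \<in> ?M" "y \<in> carrier ?L" for x y
  proof -
    obtain a s b t where x: "x = loc_frac R I a s" "a \<in> I" "a \<in> carrier R" "s \<in> carrier R - I"
      and y: "y = loc_frac R I b t" "b \<in> carrier R" "t \<in> carrier R - I"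
      using E[OF xy(1)] E'[OF xy(2)] by blast
    have "b \<otimes> a \<in> carrier R" "t \<otimes> s \<in> carrier R - I" "b \<otimes> a \<in> I"
      using x y loc_mult by (auto intro: I_l_closed)
    then show ?thesis using x y by (simp add: loc_mult_frac loc_mem_max_ideal)
  qed
  show ?thesis
  proof (rule idealI[OF L.ring_axioms])
    show "subgroup ?M (add_monoid ?L)"
    proof (rule L.add.subgroupI)
      show "?M \<subseteq> carrier ?L" by fact
      have "loc_frac R I \<zero> \<one> \<in> ?M" using loc_mem_max_ideal loc_one by simp
      then show "?M \<noteq> {}" by blast
    next
      fix x assume x: "x \<in> ?M"
      then have "(\<ominus>\<^bsub>?L\<^esub> \<one>\<^bsub>?L\<^esub>) \<otimes>\<^bsub>?L\<^esub> x \<in> ?M" by (intro mult) auto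
      then show "\<ominus>\<^bsub>?L\<^esub> x \<in> ?M" using x sub by (simp add: L.l_minus subset_iff)
    next
      fix x y assume xy: "x \<in> ?M" "y \<in> ?M"
      obtain a s b t where x: "x = loc_frac R I a s" "a \<in> I" "a \<in> carrier R" "s \<in> carrier R - I"
        and y: "y = loc_frac R I b t" "b \<in> I" "b \<in> carrier R" "t \<in> carrier R - I"
        using E[OF xy(1)] E[OF xy(2)] by blast
      have "a \<otimes> t \<oplus> b \<otimes> s \<in> carrier R" "s \<otimes> t \<in> carrier R - I" "a \<otimes> t \<oplus> b \<otimes> s \<in> I"
        using x y loc_mult by (auto intro: I_r_closed)
      then show "x \<oplus>\<^bsub>?L\<^esub> y \<in> ?M" using x y by (simp add: loc_add_frac loc_mem_max_ideal)
    qed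
  next
    fix a x assume "a \<in> ?M" "x \<in> carrier ?L"
    then show "x \<otimes>\<^bsub>?L\<^esub> a \<in> ?M" "a \<otimes>\<^bsub>?L\<^esub> x \<in> ?M"
      using mult[of a x] sub L.m_comm[of a x] by auto
  qed
qed

lemma residue_field_char_zero_iff:
  "has_char_zero (residue_field R I) \<longleftrightarrow> (\<forall>n::nat. 0 < n \<longrightarrow> [n] \<cdot> \<one> \<notin> I)"
proof -
  let ?L = "localization R I" and ?M = "loc_max_ideal R I"
  interpret L: cring ?L by (rule loc_cring)
  interpret M: ideal ?M ?L by (rule loc_max_ideal)
  interpret K: ring "?L Quot ?M" by (rule M.quotient_is_ring)
  have 1: "[n] \<cdot>\<^bsub>?L\<^esub> \<one>\<^bsub>?L\<^esub> = loc_frac R I ([n] \<cdot> \<one>) \<one>" for n :: nat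
  proof (induction n)
    case 0
    have "\<zero>\<^bsub>?L\<^esub> = loc_frac R I \<zero> \<one>" by (simp add: localization_def)
    then show ?case by simp
  next
    case (Suc n)
    have o: "\<one>\<^bsub>?L\<^esub> = loc_frac R I \<one> \<one>" by (simp add: localization_def)
    show ?case using loc_one Suc by (simp add: o loc_add_frac)
  qed
  have 2: "[n] \<cdot>\<^bsub>?L Quot ?M\<^esub> \<one>\<^bsub>?L Quot ?M\<^esub> = ?M +>\<^bsub>?L\<^esub> ([n] \<cdot>\<^bsub>?L\<^esub> \<one>\<^bsub>?L\<^esub>)" for n :: nat
  proof (induction n)
    case 0
    have "\<zero>\<^bsub>?L Quot ?M\<^esub> = ?M" by (simp add: FactRing_def)
    then show ?case using L.a_rcos_zero[OF M.ideal_axioms] by simp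
  next
    case (Suc n)
    have "?M +>\<^bsub>?L\<^esub> ([n] \<cdot>\<^bsub>?L\<^esub> \<one>\<^bsub>?L\<^esub> \<oplus>\<^bsub>?L\<^esub> \<one>\<^bsub>?L\<^esub>) =
      (?M +>\<^bsub>?L\<^esub> [n] \<cdot>\<^bsub>?L\<^esub> \<one>\<^bsub>?L\<^esub>) \<oplus>\<^bsub>?L Quot ?M\<^esub> (?M +>\<^bsub>?L\<^esub> \<one>\<^bsub>?L\<^esub>)"
      by (rule ring_hom_add[OF M.rcos_ring_hom]) auto
    moreover have "\<one>\<^bsub>?L Quot ?M\<^esub> = ?M +>\<^bsub>?L\<^esub> \<one>\<^bsub>?L\<^esub>" by (simp add: FactRing_def)
    ultimately show ?case using Suc by simp
  qed
  have "[n] \<cdot>\<^bsub>residue_field R I\<^esub> \<one>\<^bsub>residue_field R I\<^esub> = \<zero>\<^bsub>residue_field R I\<^esub>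
      \<longleftrightarrow> [n] \<cdot> \<one> \<in> I" for n :: nat
  proof -
    have "?M +>\<^bsub>?L\<^esub> x = ?M \<longleftrightarrow> x \<in> ?M" if "x \<in> carrier ?L" for x
      using that M.rcos_const_imp_mem L.a_rcos_zero[OF M.ideal_axioms] by blast
    moreover have "\<zero>\<^bsub>?L Quot ?M\<^esub> = ?M" by (simp add: FactRing_def)
    moreover have "[n] \<cdot>\<^bsub>?L\<^esub> \<one>\<^bsub>?L\<^esub> \<in> carrier ?L" by simp
    ultimately show ?thesis
      unfolding residue_field_def 2
      using loc_mem_max_ideal[of "[n] \<cdot> \<one>" \<one>] loc_one 1[of n] by simp
  qed
  then show ?thesis unfolding has_char_zero_def by blast
qed

end


section \<open>The gap measure, differential type and differential dimension\<close>

definition descending :: "'a set set \<Rightarrow> 'a set \<Rightarrow> 'a set \<Rightarrow> (nat \<Rightarrow> 'a set) \<Rightarrow> bool" where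
  "descending S p p' c \<longleftrightarrow>
     c 0 = p \<and> (\<forall>i. c i \<in> S \<and> c (Suc i) \<subset> c i \<and> p' \<subseteq> c i)"

text \<open>Only the values at pairs \<open>p \<supseteq> p'\<close> in \<open>S\<close> matter. Taking values in \<^typ>\<open>enat\<close>
  amounts to values in the integers extended by infinity together with nonnegativity.\<close>

definition is_gap_measure :: "'a set set \<Rightarrow> ('a set \<Rightarrow> 'a set \<Rightarrow> enat) \<Rightarrow> bool" where
  "is_gap_measure S \<mu> \<longleftrightarrow> (\<forall>p\<in>S. \<forall>p'\<in>S. p' \<subseteq> p \<longrightarrow>
     (\<mu> p p' = 0 \<longleftrightarrow> p = p' \<or> \<not> (\<exists>c. descending S p p' c)) \<and>
     (\<forall>k::nat. 0 < k \<longrightarrow>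
       (enat k \<le> \<mu> p p' \<longleftrightarrow>
         p \<noteq> p' \<and> (\<exists>c. descending S p p' c \<and> (\<forall>i. enat (k - 1) \<le> \<mu> (c i) (c (Suc i)))))))"

text \<open>The value 0 outside the domain is a convention that makes the description definite.\<close>

definition gap_measure :: "'a set set \<Rightarrow> 'a set \<Rightarrow> 'a set \<Rightarrow> enat" where
  "gap_measure S = (THE \<mu>. is_gap_measure S \<mu> \<and>
     (\<forall>p p'. \<not> (p \<in> S \<and> p' \<in> S \<and> p' \<subseteq> p) \<longrightarrow> \<mu> p p' = 0))"

text \<open>The next two functions only serve to prove that the description is definite.\<close>

fun gap_ge :: "'a set set \<Rightarrow> nat \<Rightarrow> 'a set \<Rightarrow> 'a set \<Rightarrow> bool" where
  "gap_ge S 0 p p' \<longleftrightarrow> True"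
| "gap_ge S (Suc k) p p' \<longleftrightarrow>
     p \<noteq> p' \<and> (\<exists>c. descending S p p' c \<and> (\<forall>i. gap_ge S k (c i) (c (Suc i))))"

lemma gap_ge_Suc_imp: "gap_ge S (Suc k) p p' \<Longrightarrow> gap_ge S k p p'"
proof (induction k arbitrary: p p')
  case 0
  then show ?case by simp
next
  case (Suc k)
  then show ?case by (metis gap_ge.simps(2))
qed

lemma gap_ge_mono: "k \<le> l \<Longrightarrow> gap_ge S l p p' \<Longrightarrow> gap_ge S k p p'"
  by (induction rule: inc_induct) (auto dest: gap_ge_Suc_imp simp del: gap_ge.simps)

definition gap_fun :: "'a set set \<Rightarrow> 'a set \<Rightarrow> 'a set \<Rightarrow> enat" where
  "gap_fun S p p' = (if p \<in> S \<and> p' \<in> S \<and> p' \<subseteq> p then SUP k\<in>{k. gap_ge S k p p'}. enat k else 0)"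

lemma gap_fun_outside: "\<not> (p \<in> S \<and> p' \<in> S \<and> p' \<subseteq> p) \<Longrightarrow> gap_fun S p p' = 0"
  unfolding gap_fun_def by (rule if_not_P)

lemma gap_fun_ge_iff:
  assumes "p \<in> S" "p' \<in> S" "p' \<subseteq> p"
  shows "enat k \<le> gap_fun S p p' \<longleftrightarrow> gap_ge S k p p'"
proof
  assume "gap_ge S k p p'"
  then show "enat k \<le> gap_fun S p p'"
    using assms by (auto simp: gap_fun_def intro: SUP_upper)
next
  assume le: "enat k \<le> gap_fun S p p'"
  show "gap_ge S k p p'"
  proof (rule ccontr)
    assume n: "\<not> gap_ge S k p p'"
    then obtain j where j: "k = Suc j" by (cases k) auto
    have "l \<le> j" if "gap_ge S l p p'" for l
      using n that gap_ge_mono[of k l S p p'] j by (meson not_less_eq_eq)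
    then have "gap_fun S p p' \<le> enat j"
      using assms by (auto simp: gap_fun_def intro!: SUP_least)
    then show False using le j by (meson enat_ord_simps(1) not_less_eq_eq order.trans order_refl)
  qed
qed

lemma is_gap_measure_ge_iff:
  assumes "is_gap_measure S \<mu>" "p \<in> S" "p' \<in> S" "p' \<subseteq> p"
  shows "enat k \<le> \<mu> p p' \<longleftrightarrow> gap_ge S k p p'"
  using assms(2-)
proof (induction k arbitrary: p p')
  case 0
  then show ?case by (simp add: zero_enat_def[symmetric])
next
  case (Suc k)
  have IH: "enat k \<le> \<mu> (c i) (c (Suc i)) \<longleftrightarrow> gap_ge S k (c i) (c (Suc i))"
    if "descending S p p' c" for c i
    using that Suc.IH unfolding descending_def by blast
  have "enat (Suc k) \<le> \<mu> p p' \<longleftrightarrow>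
      p \<noteq> p' \<and> (\<exists>c. descending S p p' c \<and> (\<forall>i. enat k \<le> \<mu> (c i) (c (Suc i))))"
    using assms(1) Suc.prems unfolding is_gap_measure_def
    by (metis diff_Suc_1 zero_less_Suc)
  then show ?case using IH by auto
qed

lemma is_gap_measure_gap_fun: "is_gap_measure S (gap_fun S)"
  unfolding is_gap_measure_def
proof (intro ballI impI conjI allI)
  fix p p' assume p: "p \<in> S" "p' \<in> S" "p' \<subseteq> p"
  have "gap_fun S p p' = 0 \<longleftrightarrow> \<not> enat (Suc 0) \<le> gap_fun S p p'"
    by (metis One_nat_def iless_eSuc0 not_less one_eSuc one_enat_def)
  then show "gap_fun S p p' = 0 \<longleftrightarrow> p = p' \<or> \<not> (\<exists>c. descending S p p' c)"
    by (simp add: gap_fun_ge_iff[OF p])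
  fix k :: nat assume "0 < k"
  then obtain j where j: "k = Suc j" by (cases k) auto
  have "enat j \<le> gap_fun S (c i) (c (Suc i)) \<longleftrightarrow> gap_ge S j (c i) (c (Suc i))"
    if "descending S p p' c" for c i
    by (rule gap_fun_ge_iff) (use that in \<open>auto simp: descending_def\<close>)
  then show "enat k \<le> gap_fun S p p' \<longleftrightarrow>
      p \<noteq> p' \<and> (\<exists>c. descending S p p' c \<and> (\<forall>i. enat (k - 1) \<le> gap_fun S (c i) (c (Suc i))))"
    by (auto simp: gap_fun_ge_iff[OF p] j)
qed

lemma is_gap_measure_unique:
  assumes "is_gap_measure S \<mu>" "is_gap_measure S \<nu>" "p \<in> S" "p' \<in> S" "p' \<subseteq> p"
  shows "\<mu> p p' = \<nu> p p'"
proof -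
  have *: "enat k \<le> \<mu> p p' \<longleftrightarrow> enat k \<le> \<nu> p p'" for k
    using assms by (simp add: is_gap_measure_ge_iff)
  show ?thesis
  proof (cases "\<mu> p p'")
    case (enat a)
    note a = this
    show ?thesis
    proof (cases "\<nu> p p'")
      case (enat b)
      then show ?thesis using a *[of a] *[of b] by simp
    next
      case infinity
      then show ?thesis using a *[of "Suc a"] by simp
    qed
  next
    case infinity
    show ?thesis
    proof (cases "\<nu> p p'")
      case (enat b)
      then show ?thesis using \<open>\<mu> p p' = \<infinity>\<close> *[of "Suc b"] by simp
    next
      case infinity
      then show ?thesis using \<open>\<mu> p p' = \<infinity>\<close> by simp
    qed
  qed
qed

lemma gap_measure_eq_gap_fun: "gap_measure S = gap_fun S"
  unfolding gap_measure_def
proof (rule the_equality)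
  show "is_gap_measure S (gap_fun S) \<and>
      (\<forall>p p'. \<not> (p \<in> S \<and> p' \<in> S \<and> p' \<subseteq> p) \<longrightarrow> gap_fun S p p' = 0)"
    by (intro conjI allI impI is_gap_measure_gap_fun gap_fun_outside)
next
  fix \<mu>
  assume \<mu>: "is_gap_measure S \<mu> \<and> (\<forall>p p'. \<not> (p \<in> S \<and> p' \<in> S \<and> p' \<subseteq> p) \<longrightarrow> \<mu> p p' = 0)"
  show "\<mu> = gap_fun S"
  proof (intro ext)
    fix p p'
    show "\<mu> p p' = gap_fun S p p'"
    proof (cases "p \<in> S \<and> p' \<in> S \<and> p' \<subseteq> p")
      case True
      then show ?thesis
        using is_gap_measure_unique[OF _ is_gap_measure_gap_fun, of S \<mu> p p'] \<mu> by simp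
    next
      case False
      then have "\<mu> p p' = 0" using \<mu> by (elim conjE allE impE) assumption+
      with gap_fun_outside[OF False] show ?thesis by simp
    qed
  qed
qed

lemma is_gap_measure_gap_measure: "is_gap_measure S (gap_measure S)"
  by (simp add: gap_measure_eq_gap_fun is_gap_measure_gap_fun)

definition diff_type :: "('a, 'b) ring_scheme \<Rightarrow> ('a \<Rightarrow> 'a) \<Rightarrow> enat" where
  "diff_type R d = Sup {gap_measure (diff_spec R d) p p' | p p'.
     p \<in> diff_spec R d \<and> p' \<in> diff_spec R d \<and> p' \<subseteq> p}"

definition diff_dim :: "('a, 'b) ring_scheme \<Rightarrow> ('a \<Rightarrow> 'a) \<Rightarrow> enat" where
  "diff_dim R d = Sup {enat k | k. \<exists>c :: nat \<Rightarrow> 'a set.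
     (\<forall>i\<le>k. c i \<in> diff_spec R d) \<and>
     (\<forall>i<k. c (Suc i) \<subset> c i \<and>
        gap_measure (diff_spec R d) (c i) (c (Suc i)) = diff_type R d)}"


section \<open>Rings of differential polynomials\<close>

text \<open>The pair \<open>(i, j)\<close> stands for the \<open>j\<close>-th derivative of the \<open>i\<close>-th differential
  indeterminate, both counted from 0. Monomials are exponent functions of finite support.\<close>

type_synonym 'a dpoly = "((nat \<times> nat) \<Rightarrow>\<^sub>0 nat) \<Rightarrow>\<^sub>0 'a"

definition dpoly_vars :: "'a::zero dpoly \<Rightarrow> (nat \<times> nat) set" where
  "dpoly_vars p = (\<Union>m\<in>Poly_Mapping.keys p. Poly_Mapping.keys m)"

definition dpoly_ring :: "nat \<Rightarrow> 'a::comm_ring_1 dpoly ring" where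
  "dpoly_ring n = ring_of_type_algebra
     \<lparr>carrier := {p. dpoly_vars p \<subseteq> {..<n} \<times> UNIV}\<rparr>"

text \<open>On a single term, \<open>d(c m) = d(c) m + \<Sum>\<^sub>v e\<^sub>v c (m / v) v'\<close>, where \<open>e\<^sub>v\<close> is the exponent
  of \<open>v\<close> in \<open>m\<close> and \<open>v'\<close> is the derivative of \<open>v\<close>.\<close>

definition dterm_deriv :: "('a::comm_ring_1 \<Rightarrow> 'a) \<Rightarrow> ((nat \<times> nat) \<Rightarrow>\<^sub>0 nat) \<Rightarrow> 'a \<Rightarrow> 'a dpoly" where
  "dterm_deriv d m c = Poly_Mapping.single m (d c) +
     (\<Sum>v\<in>Poly_Mapping.keys m. Poly_Mapping.single
        (m - Poly_Mapping.single v 1 + Poly_Mapping.single (fst v, Suc (snd v)) 1)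
        (of_nat (Poly_Mapping.lookup m v) * c))"

definition dpoly_deriv :: "('a::comm_ring_1 \<Rightarrow> 'a) \<Rightarrow> 'a dpoly \<Rightarrow> 'a dpoly" where
  "dpoly_deriv d p = (\<Sum>m\<in>Poly_Mapping.keys p. dterm_deriv d m (Poly_Mapping.lookup p m))"


lemma dterm_deriv_add:
  assumes "\<And>a b. d (a + b) = d a + d b"
  shows "dterm_deriv d m (a + b) = dterm_deriv d m a + dterm_deriv d m b"
  by (simp add: dterm_deriv_def assms single_add distrib_left sum.distrib algebra_simps)

lemma dterm_deriv_zero:
  assumes "\<And>a b. d (a + b) = d a + d b"
  shows "dterm_deriv d m 0 = 0"
proof -
  have "d 0 = 0" using assms[of 0 0] by simp
  then show ?thesis by (simp add: dterm_deriv_def)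
qed

lemma dpoly_deriv_superset:
  assumes "\<And>a b. d (a + b) = d a + d b" "finite A" "Poly_Mapping.keys p \<subseteq> A"
  shows "dpoly_deriv d p = (\<Sum>m\<in>A. dterm_deriv d m (Poly_Mapping.lookup p m))"
  unfolding dpoly_deriv_def
  by (rule sum.mono_neutral_left)
    (use assms in \<open>auto simp: in_keys_iff dterm_deriv_zero[OF assms(1)]\<close>)

lemma dpoly_deriv_single:
  assumes "\<And>a b. d (a + b) = d a + d b"
  shows "dpoly_deriv d (Poly_Mapping.single m c) = dterm_deriv d m c"
  by (subst dpoly_deriv_superset[where A = "{m}", OF assms]) auto

lemma dpoly_deriv_add:
  assumes "\<And>a b. d (a + b) = d a + d b"
  shows "dpoly_deriv d (p + q) = dpoly_deriv d p + dpoly_deriv d q"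
proof -
  let ?A = "Poly_Mapping.keys p \<union> Poly_Mapping.keys q"
  have "Poly_Mapping.keys (p + q) \<subseteq> ?A" by (rule Poly_Mapping.keys_add)
  then show ?thesis
    by (simp add: dpoly_deriv_superset[where A = ?A, OF assms] lookup_add
        dterm_deriv_add[OF assms] sum.distrib)
qed

lemma dpoly_deriv_const:
  assumes "\<And>a b. d (a + b) = d a + d b"
  shows "dpoly_deriv d (Poly_Mapping.single 0 c) = Poly_Mapping.single 0 (d c)"
  by (simp add: dpoly_deriv_single[OF assms] dterm_deriv_def)

lemma dpoly_deriv_var:
  assumes "\<And>a b. d (a + b) = d a + d b" "\<And>a b. d (a * b) = d a * b + a * d b"
  shows "dpoly_deriv d (Poly_Mapping.single (Poly_Mapping.single (i, j) 1) 1)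
    = Poly_Mapping.single (Poly_Mapping.single (i, Suc j) 1) 1"
proof -
  have "d 1 = 0" using assms(2)[of 1 1] by simp
  then show ?thesis
    by (simp add: dpoly_deriv_single[OF assms(1)] dterm_deriv_def)
qed

lemma dterm_deriv_superset:
  assumes "finite A" "Poly_Mapping.keys m \<subseteq> A"
  shows "dterm_deriv d m c = Poly_Mapping.single m (d c) +
     (\<Sum>v\<in>A. Poly_Mapping.single
        (m - Poly_Mapping.single v 1 + Poly_Mapping.single (fst v, Suc (snd v)) 1)
        (of_nat (Poly_Mapping.lookup m v) * c))"
  unfolding dterm_deriv_def
  by (rule arg_cong[where f = "(+) _"], rule sum.mono_neutral_left)
    (use assms in \<open>auto simp: in_keys_iff\<close>)

lemma monom_shift:
  fixes m n :: "'v \<Rightarrow>\<^sub>0 nat"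
  assumes "Poly_Mapping.lookup m v \<noteq> 0"
  shows "m + n - Poly_Mapping.single v 1 + w = m - Poly_Mapping.single v 1 + w + n"
  using assms by (intro poly_mapping_eqI)
    (auto simp: lookup_add lookup_minus lookup_single when_def)

lemma dterm_deriv_mult:
  assumes "\<And>a b. d (a + b) = d a + d b" "\<And>a b. d (a * b) = d a * b + a * d b"
  shows "dterm_deriv d (m + n) (a * b) =
    dterm_deriv d m a * Poly_Mapping.single n b + Poly_Mapping.single m a * dterm_deriv d n b"
proof -
  let ?A = "Poly_Mapping.keys m \<union> Poly_Mapping.keys n"
  let ?e = "\<lambda>v. Poly_Mapping.single v (1::nat)"
  let ?s = "\<lambda>v. Poly_Mapping.single (fst v, Suc (snd v)) (1::nat)"
  let ?l = Poly_Mapping.lookup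
  have "finite ?A" by simp
  have t: "Poly_Mapping.single (m + n - ?e v + ?s v) (of_nat (?l (m + n) v) * (a * b)) =
      Poly_Mapping.single (m - ?e v + ?s v) (of_nat (?l m v) * a) * Poly_Mapping.single n b +
      Poly_Mapping.single m a * Poly_Mapping.single (n - ?e v + ?s v) (of_nat (?l n v) * b)" for v
  proof -
    have 1: "Poly_Mapping.single (m + n - ?e v + ?s v) (of_nat (?l m v) * (a * b)) =
      Poly_Mapping.single (m - ?e v + ?s v) (of_nat (?l m v) * a) * Poly_Mapping.single n b"
    proof (cases "?l m v = 0")
      case False
      then show ?thesis
        by (simp only: monom_shift[OF False] mult_single) (simp add: mult.assoc)
    qed simp
    have 2: "Poly_Mapping.single (m + n - ?e v + ?s v) (of_nat (?l n v) * (a * b)) =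
      Poly_Mapping.single m a * Poly_Mapping.single (n - ?e v + ?s v) (of_nat (?l n v) * b)"
    proof (cases "?l n v = 0")
      case False
      then have "m + n - ?e v + ?s v = m + (n - ?e v + ?s v)"
        using monom_shift[OF False, of m "?s v"] by (simp add: add.commute)
      then show ?thesis by (simp only: mult_single) (simp add: mult.left_commute)
    qed simp
    show ?thesis
      unfolding 1[symmetric] 2[symmetric] single_add[symmetric]
      by (simp add: lookup_add distrib_right)
  qed
  have "dterm_deriv d (m + n) (a * b) = Poly_Mapping.single (m + n) (d (a * b)) +
      (\<Sum>v\<in>?A. Poly_Mapping.single (m + n - ?e v + ?s v) (of_nat (?l (m + n) v) * (a * b)))"
    by (rule dterm_deriv_superset) (auto intro!: Poly_Mapping.keys_add)
  also have "\<dots> = (Poly_Mapping.single m (d a) * Poly_Mapping.single n b +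
      Poly_Mapping.single m a * Poly_Mapping.single n (d b)) +
     ((\<Sum>v\<in>?A. Poly_Mapping.single (m - ?e v + ?s v) (of_nat (?l m v) * a)) *
        Poly_Mapping.single n b +
      Poly_Mapping.single m a *
        (\<Sum>v\<in>?A. Poly_Mapping.single (n - ?e v + ?s v) (of_nat (?l n v) * b)))"
    unfolding t sum.distrib sum_distrib_left sum_distrib_right
    by (simp add: mult_single assms(2) single_add)
  also have "\<dots> = dterm_deriv d m a * Poly_Mapping.single n b +
      Poly_Mapping.single m a * dterm_deriv d n b"
    unfolding dterm_deriv_superset[OF \<open>finite ?A\<close> Un_upper1]
      dterm_deriv_superset[OF \<open>finite ?A\<close> Un_upper2]
    by (simp only: distrib_left distrib_right add_ac)
  finally show ?thesis .
qed

lemma dpoly_sum_terms: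
  "p = (\<Sum>m\<in>Poly_Mapping.keys p. Poly_Mapping.single m (Poly_Mapping.lookup p m))"
  by (rule poly_mapping_eqI)
    (auto simp: lookup_sum lookup_single when_def in_keys_iff sum.delta' cong: if_cong)

lemma dpoly_deriv_sum:
  assumes "\<And>a b. d (a + b) = d a + d b"
  shows "dpoly_deriv d (\<Sum>i\<in>A. f i) = (\<Sum>i\<in>A. dpoly_deriv d (f i))"
  by (induction A rule: infinite_finite_induct)
    (simp_all add: dpoly_deriv_add[OF assms], simp_all add: dpoly_deriv_def)

lemma dpoly_deriv_mult:
  assumes "\<And>a b. d (a + b) = d a + d b" "\<And>a b. d (a * b) = d a * b + a * d b"
  shows "dpoly_deriv d (p * q) = dpoly_deriv d p * q + p * dpoly_deriv d q"
proof -
  let ?T = "\<lambda>p m. Poly_Mapping.single m (Poly_Mapping.lookup p m)"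
  let ?k = Poly_Mapping.keys
  have "p * q = (\<Sum>m\<in>?k p. \<Sum>n\<in>?k q. ?T p m * ?T q n)"
    by (subst (1) dpoly_sum_terms[of p], subst (1) dpoly_sum_terms[of q]) (rule sum_product)
  then have "dpoly_deriv d (p * q) = (\<Sum>m\<in>?k p. \<Sum>n\<in>?k q. dpoly_deriv d (?T p m * ?T q n))"
    by (simp add: dpoly_deriv_sum[OF assms(1)])
  also have "\<dots> = (\<Sum>m\<in>?k p. \<Sum>n\<in>?k q. dterm_deriv d m (Poly_Mapping.lookup p m) * ?T q n) +
      (\<Sum>m\<in>?k p. \<Sum>n\<in>?k q. ?T p m * dterm_deriv d n (Poly_Mapping.lookup q n))"
    by (simp add: mult_single dpoly_deriv_single[OF assms(1)] dterm_deriv_mult[OF assms]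
        sum.distrib)
  also have "\<dots> = dpoly_deriv d p * q + p * dpoly_deriv d q"
    unfolding sum_product[symmetric] dpoly_sum_terms[symmetric] by (simp add: dpoly_deriv_def)
  finally show ?thesis .
qed

lemma dpoly_vars_add: "dpoly_vars (p + q) \<subseteq> dpoly_vars p \<union> dpoly_vars q"
  using Poly_Mapping.keys_add[of p q] unfolding dpoly_vars_def by blast

lemma dpoly_vars_sum: "dpoly_vars (\<Sum>i\<in>A. f i) \<subseteq> (\<Union>i\<in>A. dpoly_vars (f i))"
proof (induction A rule: infinite_finite_induct)
  case (insert x F)
  then show ?case using dpoly_vars_add[of "f x" "sum f F"] by auto
qed (simp_all add: dpoly_vars_def)

lemma dpoly_vars_single: "dpoly_vars (Poly_Mapping.single m c) \<subseteq> Poly_Mapping.keys m"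
  by (simp add: dpoly_vars_def)

lemma dpoly_vars_mult: "dpoly_vars (p * q) \<subseteq> dpoly_vars p \<union> dpoly_vars q"
proof
  fix v assume "v \<in> dpoly_vars (p * q)"
  then obtain m where m: "m \<in> Poly_Mapping.keys (p * q)" "v \<in> Poly_Mapping.keys m"
    by (auto simp: dpoly_vars_def)
  then obtain a b where "m = a + b" "a \<in> Poly_Mapping.keys p" "b \<in> Poly_Mapping.keys q"
    using Poly_Mapping.keys_mult[of p q] by blast
  then show "v \<in> dpoly_vars p \<union> dpoly_vars q"
    using m(2) Poly_Mapping.keys_add[of a b] by (auto simp: dpoly_vars_def)
qed

lemma dpoly_vars_deriv:
  assumes "dpoly_vars p \<subseteq> {..<n} \<times> UNIV"
  shows "dpoly_vars (dpoly_deriv d p) \<subseteq> {..<n} \<times> UNIV"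
proof -
  have "dpoly_vars (dterm_deriv d m c) \<subseteq> {..<n} \<times> UNIV"
    if m: "Poly_Mapping.keys m \<subseteq> {..<n} \<times> UNIV" for m c
  proof -
    have "Poly_Mapping.keys (m - Poly_Mapping.single v 1
        + Poly_Mapping.single (fst v, Suc (snd v)) 1) \<subseteq> {..<n} \<times> UNIV"
      if "v \<in> Poly_Mapping.keys m" for v
    proof
      fix u assume "u \<in> Poly_Mapping.keys (m - Poly_Mapping.single v 1
        + Poly_Mapping.single (fst v, Suc (snd v)) 1)"
      then have "u \<in> Poly_Mapping.keys m \<or> u = (fst v, Suc (snd v))"
        by (auto simp: in_keys_iff lookup_add lookup_minus lookup_single when_def
            split: if_splits)
      then show "u \<in> {..<n} \<times> UNIV"
        using m that by (auto simp: mem_Times_iff)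
    qed
    then show ?thesis
      unfolding dterm_deriv_def using m
      by (intro order.trans[OF dpoly_vars_add] order.trans[OF dpoly_vars_sum] Un_least UN_least
          order.trans[OF dpoly_vars_single]) auto
  qed
  moreover have "Poly_Mapping.keys m \<subseteq> {..<n} \<times> UNIV" if "m \<in> Poly_Mapping.keys p" for m
    using assms that unfolding dpoly_vars_def by blast
  ultimately show ?thesis
    unfolding dpoly_deriv_def by (intro order.trans[OF dpoly_vars_sum] UN_least) auto
qed

lemma dpoly_ring_simps [simp]:
  "carrier (dpoly_ring n) = {p. dpoly_vars p \<subseteq> {..<n} \<times> UNIV}"
  "p \<otimes>\<^bsub>dpoly_ring n\<^esub> q = p * q"
  "p \<oplus>\<^bsub>dpoly_ring n\<^esub> q = p + q"
  "\<one>\<^bsub>dpoly_ring n\<^esub> = 1"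
  "\<zero>\<^bsub>dpoly_ring n\<^esub> = 0"
  by (simp_all add: dpoly_ring_def ring_of_type_algebra_def)

lemma cring_dpoly_ring: "cring (dpoly_ring n :: 'a::comm_ring_1 dpoly ring)"
proof (rule cringI)
  have add: "dpoly_vars (p + q) \<subseteq> V" if "dpoly_vars p \<subseteq> V" "dpoly_vars q \<subseteq> V"
    for p q :: "'a dpoly" and V
    using dpoly_vars_add[of p q] that by blast
  have mult: "dpoly_vars (p * q) \<subseteq> V" if "dpoly_vars p \<subseteq> V" "dpoly_vars q \<subseteq> V"
    for p q :: "'a dpoly" and V
    using dpoly_vars_mult[of p q] that by blast
  have zero: "dpoly_vars (0 :: 'a dpoly) \<subseteq> V" and one: "dpoly_vars (1 :: 'a dpoly) \<subseteq> V" for V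
    by (simp_all add: dpoly_vars_def)
  show "abelian_group (dpoly_ring n :: 'a dpoly ring)"
  proof (rule abelian_groupI)
    fix p :: "'a dpoly" assume "p \<in> carrier (dpoly_ring n)"
    then have "- p \<in> carrier (dpoly_ring n)" by (simp add: dpoly_vars_def)
    then show "\<exists>q\<in>carrier (dpoly_ring n). q \<oplus>\<^bsub>dpoly_ring n\<^esub> p = \<zero>\<^bsub>dpoly_ring n\<^esub>"
      by (intro bexI[of _ "- p"]) auto
  qed (simp_all add: add zero add_ac)
  show "Group.comm_monoid (dpoly_ring n :: 'a dpoly ring)"
    by (rule comm_monoidI) (simp_all add: mult one mult_ac)
qed (simp add: distrib_right)

lemma ordinary_differential_ring_dpoly_ring:
  assumes "ordinary_differential_ring (ring_of_type_algebra :: 'a::comm_ring_1 ring) d"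
  shows "ordinary_differential_ring (dpoly_ring n) (dpoly_deriv d)"
proof -
  interpret ordinary_differential_ring "ring_of_type_algebra :: 'a ring" d by fact
  have d: "d (a + b) = d a + d b" "d (a * b) = d a * b + a * d b" for a b
    using deriv_add[of a b] deriv_mult[of a b] by (simp_all add: ring_of_type_algebra_def)
  show ?thesis
    by (intro ordinary_differential_ring.intro cring_dpoly_ring
        ordinary_differential_ring_axioms.intro)
      (simp_all add: dpoly_vars_deriv dpoly_deriv_add[OF d(1)] dpoly_deriv_mult[OF d])
qed


section \<open>Ordinary J-rings\<close>

text \<open>Only one derivation occurs, so the number \<open>m\<close> of derivations is 1 throughout.\<close>

definition ordinary_J_ring :: "('a::comm_ring_1 \<Rightarrow> 'a) \<Rightarrow> bool" where
  "ordinary_J_ring d \<longleftrightarrow> (let R = ring_of_type_algebra; t = diff_type R d in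
     ordinary_differential_ring R d \<and> t < \<infinity> \<and>
     (\<forall>n::nat. 0 < n \<longrightarrow>
       diff_type (dpoly_ring n) (dpoly_deriv d) = max t 1 \<and>
       (t < 1 \<longrightarrow> diff_dim (dpoly_ring n) (dpoly_deriv d) = enat n) \<and>
       (t = 1 \<longrightarrow> diff_dim R d < \<infinity> \<and>
          diff_dim (dpoly_ring n) (dpoly_deriv d) = enat n + diff_dim R d) \<and>
       (t > 1 \<longrightarrow> diff_dim R d < \<infinity> \<and>
          diff_dim (dpoly_ring n) (dpoly_deriv d) = diff_dim R d)))"

end

theory Submission
  imports Defs "HOL-Library.Infinite_Set" "HOL-Library.Product_Lexorder"
begin

text \<open>
  Let \<open>z\<close> stand for the indeterminates \<open>z\<^sub>0, \<dots>, z\<^sub>n\<^sub>-\<^sub>1\<close>. A differential prime \<open>P\<close> of \<open>R{z}\<close> contracts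
  to a differential prime \<open>p\<close> of \<open>R\<close>. The proof attaches one number to \<open>P\<close>: its differential
  transcendence degree \<open>\<delta>(P) \<le> n\<close>, the largest size of a set of indeterminates all of whose
  derivatives are algebraically independent modulo \<open>P\<close> over \<open>R/p\<close>. Two facts about \<open>\<delta>\<close> carry
  the proof. Both are counting arguments resting on \<open>too_many_fractions_dependent\<close>: modulo a prime,
  more than \<open>m\<close> fractions with a common denominator over \<open>D[x\<^sub>1, \<dots>, x\<^sub>m]\<close> are algebraically
  dependent over \<open>D\<close>.

  \<^item> If \<open>P' \<subseteq> P\<close>, then \<open>\<delta>(P) \<le> \<delta>(P')\<close> (\<open>diff_indep_generization\<close>). Suppose that a set \<open>I\<close> of
    indeterminates is independent modulo \<open>P\<close> and dependent modulo \<open>P'\<close>. A relation in \<open>P'\<close> of least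
    order and degree in some \<open>z\<^sub>i\<close> has its separant outside \<open>P'\<close>; differentiating it repeatedly
    makes all higher derivatives of \<open>z\<^sub>i\<close> fractions in its lower derivatives and the other
    indeterminates. Since the derivation is locally nilpotent, the coefficients of the relation lie in
    a finitely generated ring stable under the derivation. Hence for large \<open>s\<close> the derivatives of
    order at most \<open>s\<close> of the \<open>z\<^sub>i\<close> with \<open>i\<close> in \<open>I\<close> are fractions over \<open>\<int>\<close> in fewer generators
    than there are derivatives. They satisfy a relation over \<open>\<int>\<close> modulo \<open>P'\<close>, hence modulo \<open>P\<close>,
    and in residue characteristic zero this contradicts independence. Working over \<open>\<int>\<close> is what
    makes it possible to compare primes with different contractions: there may be infinitely long
    chains of primes of \<open>R\<close> between them, but only finitely many elements of \<open>R\<close> occur.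

  \<^item> If \<open>P\<^sub>0 \<supset> P\<^sub>1 \<supset> \<dots>\<close> is infinite, with constant contraction and with all terms containing \<open>P'\<close>,
    then \<open>\<delta>(P\<^sub>0) < \<delta>(P')\<close> (\<open>diff_trdeg_infinite_chain\<close>). Otherwise some \<open>I\<close> is a maximal independent
    set both for \<open>P\<^sub>0\<close> and for the intersection \<open>Q\<close> of the chain, and separants of relations in \<open>Q\<close>
    make all of \<open>R{z}\<close> consist of fractions in finitely many generators over \<open>D = R{z\<^sub>i | i \<in> I}\<close>
    modulo \<open>Q\<close>. But elements \<open>y\<^sub>j\<close> of \<open>P\<^sub>j\<close> outside \<open>P\<^sub>j\<^sub>+\<^sub>1\<close> are independent over \<open>D\<close> modulo \<open>Q\<close>,
    in any number.

  It follows that a pair of primes of \<open>R{z}\<close> of gap measure at least \<open>k + 1\<close> contracts to such a pair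
  in \<open>R\<close>, unless \<open>k = 0\<close> and \<open>\<delta>\<close> increases (\<open>gap_contract\<close>), and \<open>\<delta>\<close> increases at most \<open>n\<close> times
  along a chain. Conversely \<open>p \<mapsto> p + [z]\<close> embeds the spectrum of \<open>R\<close> into that of \<open>R{z}\<close>, and
  freeing the indeterminates one by one yields \<open>n\<close> further pairs of positive gap measure below
  \<open>p + [z]\<close>. The formulas for the type and the dimension are then pure order theory; they are
  derived in the locale \<open>spectral_fibration\<close>.
\<close>

section \<open>Algebraic dependence of too many fractions\<close>

inductive_set subring_gen :: "'b::comm_ring_1 set \<Rightarrow> 'b set" for G where
  gen: "g \<in> G \<Longrightarrow> g \<in> subring_gen G"
| one: "1 \<in> subring_gen G"
| diff: "x \<in> subring_gen G \<Longrightarrow> y \<in> subring_gen G \<Longrightarrow> x - y \<in> subring_gen G"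
| mult: "x \<in> subring_gen G \<Longrightarrow> y \<in> subring_gen G \<Longrightarrow> x * y \<in> subring_gen G"

text \<open>Elements are added and multiplied in the ambient type, so that a subring is just a set.\<close>

definition is_subring :: "'b::comm_ring_1 set \<Rightarrow> bool" where
  "is_subring W \<longleftrightarrow> 1 \<in> W \<and> (\<forall>x\<in>W. \<forall>y\<in>W. x - y \<in> W \<and> x * y \<in> W)"

lemma is_subring_subring_gen: "is_subring (subring_gen G)"
  by (auto simp: is_subring_def intro: subring_gen.intros)

lemma subring_gen_least:
  assumes "is_subring W" "G \<subseteq> W"
  shows "subring_gen G \<subseteq> W"
proof
  fix x assume "x \<in> subring_gen G"
  then show "x \<in> W" by induction (use assms in \<open>auto simp: is_subring_def\<close>)
qed

lemma subring_gen_mono: "G \<subseteq> H \<Longrightarrow> subring_gen G \<subseteq> subring_gen H"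
  by (rule subring_gen_least[OF is_subring_subring_gen]) (auto intro: subring_gen.gen)

context
  fixes W :: "'b::comm_ring_1 set"
  assumes W: "is_subring W"
begin

lemma in_subring_one: "1 \<in> W" and in_subring_diff: "x \<in> W \<Longrightarrow> y \<in> W \<Longrightarrow> x - y \<in> W"
  and in_subring_mult: "x \<in> W \<Longrightarrow> y \<in> W \<Longrightarrow> x * y \<in> W"
  using W by (auto simp: is_subring_def)

lemma in_subring_zero: "0 \<in> W"
  using in_subring_diff[OF in_subring_one in_subring_one] by simp

lemma in_subring_uminus: "x \<in> W \<Longrightarrow> - x \<in> W"
  using in_subring_diff[OF in_subring_zero] by simp

lemma in_subring_add: "x \<in> W \<Longrightarrow> y \<in> W \<Longrightarrow> x + y \<in> W"
  using in_subring_diff[OF _ in_subring_uminus] by simp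

lemma in_subring_sum: "(\<And>i. i \<in> A \<Longrightarrow> f i \<in> W) \<Longrightarrow> (\<Sum>i\<in>A. f i) \<in> W"
  by (induction A rule: infinite_finite_induct) (auto simp: in_subring_zero in_subring_add)

lemma in_subring_prod: "(\<And>i. i \<in> A \<Longrightarrow> f i \<in> W) \<Longrightarrow> (\<Prod>i\<in>A. f i) \<in> W"
  by (induction A rule: infinite_finite_induct) (auto simp: in_subring_one in_subring_mult)

lemma in_subring_power: "x \<in> W \<Longrightarrow> x ^ k \<in> W"
  by (induction k) (auto simp: in_subring_one in_subring_mult)

lemma in_subring_of_nat: "of_nat k \<in> W"
  by (induction k) (auto simp: in_subring_zero in_subring_one in_subring_add)

end

lemma is_subring_range_of_int: "is_subring (range (of_int :: int \<Rightarrow> 'b::comm_ring_1))"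
proof -
  have "(1 :: 'b) = of_int 1" "(of_int a - of_int b :: 'b) = of_int (a - b)"
    "(of_int a * of_int b :: 'b) = of_int (a * b)" for a b by simp_all
  then show ?thesis unfolding is_subring_def by (metis rangeE rangeI)
qed

inductive_set lin_span :: "'b::comm_ring_1 set \<Rightarrow> 'b set \<Rightarrow> 'b set" for D E where
  zero: "0 \<in> lin_span D E"
| step: "a \<in> D \<Longrightarrow> e \<in> E \<Longrightarrow> w \<in> lin_span D E \<Longrightarrow> a * e + w \<in> lin_span D E"

lemma lin_span_mono: "E \<subseteq> E' \<Longrightarrow> lin_span D E \<subseteq> lin_span D E'"
proof
  fix w assume "w \<in> lin_span D E" "E \<subseteq> E'"
  then show "w \<in> lin_span D E'" by induction (auto intro: lin_span.intros)
qed

context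
  fixes D :: "'b::comm_ring_1 set"
  assumes D: "is_subring D"
begin

lemma lin_span_add: "v \<in> lin_span D E \<Longrightarrow> w \<in> lin_span D E \<Longrightarrow> v + w \<in> lin_span D E"
  by (induction rule: lin_span.induct) (auto simp: add.assoc intro: lin_span.step)

lemma lin_span_scale:
  assumes "a \<in> D" "w \<in> lin_span D E"
  shows "a * w \<in> lin_span D E"
  using assms(2)
proof induction
  case (step b e w)
  have "a * (b * e + w) = (a * b) * e + a * w" by (simp add: algebra_simps)
  then show ?case using step assms(1) in_subring_mult[OF D] by (simp add: lin_span.step)
qed (simp add: lin_span.zero)

lemma lin_span_base: "e \<in> E \<Longrightarrow> e \<in> lin_span D E"
  using lin_span.step[OF in_subring_one[OF D] _ lin_span.zero, of e E] by simp

lemma lin_span_diff: "v \<in> lin_span D E \<Longrightarrow> w \<in> lin_span D E \<Longrightarrow> v - w \<in> lin_span D E"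
  using lin_span_add[of v E "- 1 * w"] lin_span_scale[of "- 1" w E] in_subring_uminus[OF D in_subring_one[OF D]]
  by simp

lemma lin_span_mult:
  assumes "v \<in> lin_span D E" "w \<in> lin_span D E'" "\<And>e e'. e \<in> E \<Longrightarrow> e' \<in> E' \<Longrightarrow> e * e' \<in> E''"
  shows "v * w \<in> lin_span D E''"
  using assms(1)
proof induction
  case zero
  then show ?case by (simp add: lin_span.zero)
next
  case (step a e v)
  have "e * w \<in> lin_span D E''"
    using assms(2)
  proof induction
    case (step b e' w)
    have "e * (b * e' + w) = b * (e * e') + e * w" by (simp add: algebra_simps)
    then show ?case using step assms(3) \<open>e \<in> E\<close> by (simp add: lin_span.step)
  qed (simp add: lin_span.zero)
  then have "a * (e * w) + v * w \<in> lin_span D E''"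
    using step lin_span_scale lin_span_add by blast
  then show ?case by (simp add: algebra_simps)
qed

lemma lin_span_insertE:
  assumes "v \<in> lin_span D (insert e E)"
  obtains a w where "a \<in> D" "w \<in> lin_span D E" "v = a * e + w"
proof -
  have "\<exists>a w. a \<in> D \<and> w \<in> lin_span D E \<and> v = a * e + w"
    using assms
  proof induction
    case zero
    then show ?case using in_subring_zero[OF D] lin_span.zero by (metis add.right_neutral mult_zero_left)
  next
    case (step b f v)
    then obtain a w where aw: "a \<in> D" "w \<in> lin_span D E" "v = a * e + w" by blast
    show ?case
    proof (cases "f = e")
      case True
      have "b * f + v = (b + a) * e + w" using True aw by (simp add: algebra_simps)
      then show ?thesis using aw step in_subring_add[OF D] by blast
    next
      case False
      have "b * f + v = a * e + (b * f + w)" using aw by (simp add: algebra_simps)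
      then show ?thesis using aw step False by (blast intro: lin_span.step)
    qed
  qed
  then show ?thesis using that by blast
qed

end

text \<open>Bounding every exponent separately, instead of the total degree, makes the number of monomials a
  power, and the comparison of growth rates below becomes elementary.\<close>

definition box_monomials :: "nat \<Rightarrow> (nat \<Rightarrow> 'b::comm_ring_1) \<Rightarrow> nat \<Rightarrow> 'b set" where
  "box_monomials m x b = {\<Prod>i<m. x i ^ \<beta> i | \<beta>. \<forall>i<m. \<beta> i \<le> b}"

lemma card_box_monomials: "finite (box_monomials m x b) \<and> card (box_monomials m x b) \<le> Suc b ^ m"
proof -
  let ?B = "{..<m} \<rightarrow>\<^sub>E {..b}"
  have "box_monomials m x b \<subseteq> (\<lambda>\<beta>. \<Prod>i<m. x i ^ \<beta> i) ` ?B"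
  proof
    fix y assume "y \<in> box_monomials m x b"
    then obtain \<beta> where "y = (\<Prod>i<m. x i ^ \<beta> i)" "\<forall>i<m. \<beta> i \<le> b"
      by (auto simp: box_monomials_def)
    then show "y \<in> (\<lambda>\<beta>. \<Prod>i<m. x i ^ \<beta> i) ` ?B"
      by (intro image_eqI[of _ _ "restrict \<beta> {..<m}"]) auto
  qed
  moreover have "finite ?B" "card ?B = Suc b ^ m" by (simp_all add: finite_PiE card_PiE)
  ultimately show ?thesis
    using card_image_le[of ?B "\<lambda>\<beta>. \<Prod>i<m. x i ^ \<beta> i"]
      card_mono[of "(\<lambda>\<beta>. \<Prod>i<m. x i ^ \<beta> i) ` ?B" "box_monomials m x b"]
    by (auto intro: finite_subset)
qed

lemma box_monomials_mono: "b \<le> b' \<Longrightarrow> box_monomials m x b \<subseteq> box_monomials m x b'"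
  unfolding box_monomials_def by (blast intro: le_trans)

lemma box_monomials_mult:
  assumes "e \<in> box_monomials m x b" "e' \<in> box_monomials m x b'"
  shows "e * e' \<in> box_monomials m x (b + b')"
proof -
  obtain \<beta> \<beta>' where *: "e = (\<Prod>i<m. x i ^ \<beta> i)" "\<forall>i<m. \<beta> i \<le> b"
      "e' = (\<Prod>i<m. x i ^ \<beta>' i)" "\<forall>i<m. \<beta>' i \<le> b'"
    using assms by (auto simp: box_monomials_def)
  then have "e * e' = (\<Prod>i<m. x i ^ (\<beta> i + \<beta>' i))" by (simp add: power_add prod.distrib)
  then show ?thesis unfolding box_monomials_def using * by (auto intro!: exI[of _ "\<lambda>i. \<beta> i + \<beta>' i"] add_mono)
qed

lemma one_in_box: "1 \<in> box_monomials m x b"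
  unfolding box_monomials_def by (auto intro!: exI[of _ "\<lambda>_. 0"])

context
  fixes D :: "'b::comm_ring_1 set" and m :: nat and x :: "nat \<Rightarrow> 'b"
  assumes D: "is_subring D"
begin

lemma lin_span_box_mult:
  "v \<in> lin_span D (box_monomials m x b) \<Longrightarrow> w \<in> lin_span D (box_monomials m x b') \<Longrightarrow>
    v * w \<in> lin_span D (box_monomials m x (b + b'))"
  by (rule lin_span_mult[OF D]) (auto intro: box_monomials_mult)

lemma lin_span_box_mono:
  "v \<in> lin_span D (box_monomials m x b) \<Longrightarrow> b \<le> b' \<Longrightarrow> v \<in> lin_span D (box_monomials m x b')"
  using lin_span_mono[OF box_monomials_mono] by blast

lemma one_in_lin_span_box: "1 \<in> lin_span D (box_monomials m x b)"
  by (rule lin_span_base[OF D one_in_box])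

lemma lin_span_box_power:
  "v \<in> lin_span D (box_monomials m x b) \<Longrightarrow> v ^ k \<in> lin_span D (box_monomials m x (k * b))"
  by (induction k) (auto intro: lin_span_box_mult one_in_lin_span_box)

lemma lin_span_box_prod:
  "(\<And>j. j < N \<Longrightarrow> f j \<in> lin_span D (box_monomials m x b)) \<Longrightarrow>
    (\<Prod>j<N. f j) \<in> lin_span D (box_monomials m x (N * b))"
proof (induction N)
  case (Suc N)
  then have "(\<Prod>j<N. f j) * f N \<in> lin_span D (box_monomials m x (N * b + b))"
    by (intro lin_span_box_mult) auto
  then show ?case by (simp add: add.commute)
qed (simp add: one_in_lin_span_box)

lemma subring_gen_in_lin_span_box:
  assumes "w \<in> subring_gen (D \<union> x ` {..<m})"
  obtains b where "w \<in> lin_span D (box_monomials m x b)"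
proof -
  have "\<exists>b. w \<in> lin_span D (box_monomials m x b)"
    using assms
  proof induction
    case (gen g)
    show ?case
    proof (cases "g \<in> D")
      case True
      then show ?thesis using lin_span_scale[OF D True one_in_lin_span_box] by auto
    next
      case False
      then obtain i where i: "i < m" "g = x i" using gen by auto
      have "(\<Prod>j<m. x j ^ (if j = i then 1 else 0)) = g"
        using i by (simp add: if_distrib[of "\<lambda>k. _ ^ k"] prod.delta cong: if_cong)
      then have "g \<in> box_monomials m x 1"
        unfolding box_monomials_def by (auto intro!: exI[of _ "\<lambda>j. if j = i then 1 else 0"])
      then show ?thesis using lin_span_base[OF D] by blast
    qed
  next
    case one
    then show ?case using one_in_lin_span_box by blast
  next
    case (diff v w)
    then obtain b b' where "v \<in> lin_span D (box_monomials m x b)" "w \<in> lin_span D (box_monomials m x b')"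
      by blast
    then have "v - w \<in> lin_span D (box_monomials m x (max b b'))"
      by (intro lin_span_diff[OF D]) (auto intro: lin_span_box_mono)
    then show ?case by blast
  next
    case (mult v w)
    then show ?case using lin_span_box_mult by blast
  qed
  then show ?thesis using that by blast
qed

end

text \<open>Prime ideals of a subring \<open>B\<close>, in the form in which they are used for rings of differential
  polynomials in finitely many of all the indeterminates. Nothing is said about elements outside \<open>B\<close>,
  and quotient rings are replaced by congruences modulo \<open>P\<close>.\<close>

locale prime_in_subring =
  fixes B P :: "'b::comm_ring_1 set"
  assumes subring_B: "is_subring B"
    and P_sub: "P \<subseteq> B" and P_zero: "0 \<in> P"
    and P_add: "x \<in> P \<Longrightarrow> y \<in> P \<Longrightarrow> x + y \<in> P"
    and P_mult: "x \<in> B \<Longrightarrow> y \<in> P \<Longrightarrow> x * y \<in> P"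
    and P_one: "1 \<notin> P"
    and P_prime: "x \<in> B \<Longrightarrow> y \<in> B \<Longrightarrow> x * y \<in> P \<Longrightarrow> x \<in> P \<or> y \<in> P"
begin

lemmas B_one = in_subring_one[OF subring_B] and B_zero = in_subring_zero[OF subring_B]
  and B_mult = in_subring_mult[OF subring_B] and B_diff = in_subring_diff[OF subring_B]
  and B_add = in_subring_add[OF subring_B] and B_uminus = in_subring_uminus[OF subring_B]
  and B_sum = in_subring_sum[OF subring_B] and B_prod = in_subring_prod[OF subring_B]
  and B_power = in_subring_power[OF subring_B]

lemma P_uminus: "x \<in> P \<Longrightarrow> - x \<in> P"
  using P_mult[OF B_uminus[OF B_one], of x] by simp

lemma P_diff: "x \<in> P \<Longrightarrow> y \<in> P \<Longrightarrow> x - y \<in> P"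
  using P_add[OF _ P_uminus, of x y] by simp

lemma P_sum: "(\<And>i. i \<in> A \<Longrightarrow> f i \<in> P) \<Longrightarrow> (\<Sum>i\<in>A. f i) \<in> P"
  by (induction A rule: infinite_finite_induct) (auto simp: P_zero P_add)

lemma P_power: "x \<in> B \<Longrightarrow> x ^ k \<in> P \<Longrightarrow> x \<in> P"
  using P_one P_prime B_power by (induction k) auto

lemma P_prod: "finite A \<Longrightarrow> (\<And>i. i \<in> A \<Longrightarrow> f i \<in> B - P) \<Longrightarrow> (\<Prod>i\<in>A. f i) \<in> B - P"
proof (induction A rule: finite_induct)
  case (insert i A)
  then show ?case using P_prime[of "f i" "\<Prod>i\<in>A. f i"] B_mult by auto
qed (simp add: B_one P_one)

lemma P_cong_diff: "x - y \<in> P \<Longrightarrow> x \<in> P \<longleftrightarrow> y \<in> P"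
  using P_add[of "x - y" y] P_diff[of x "x - y"] by auto

lemma P_cong_mult:
  assumes "x - x' \<in> P" "y - y' \<in> P" "x' \<in> B" "y \<in> B"
  shows "x * y - x' * y' \<in> P"
proof -
  have "x * y - x' * y' = y * (x - x') + x' * (y - y')" by (simp add: algebra_simps)
  then show ?thesis using assms P_mult P_add by simp
qed

lemma P_cong_power:
  assumes "x - x' \<in> P" "x \<in> B" "x' \<in> B"
  shows "x ^ k - x' ^ k \<in> P"
proof (induction k)
  case (Suc k)
  then show ?case using P_cong_mult[OF assms(1) Suc] assms B_power by simp
qed (simp add: P_zero)

lemma P_cong_prod:
  assumes "\<And>i. i \<in> A \<Longrightarrow> f i - g i \<in> P \<and> f i \<in> B \<and> g i \<in> B"
  shows "(\<Prod>i\<in>A. f i) - (\<Prod>i\<in>A. g i) \<in> P"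
  using assms
proof (induction A rule: infinite_finite_induct)
  case (insert i A)
  then show ?case by (simp add: P_cong_mult B_prod)
qed (simp_all add: P_zero)

text \<open>Gaussian elimination without division over the domain \<open>D/(D \<inter> P)\<close>: one spanning element is
  eliminated at a time, cross-multiplying by a coefficient that does not lie in \<open>P\<close>.\<close>

lemma linear_dependence:
  assumes D: "is_subring D" "D \<subseteq> B" and E: "finite E" "E \<subseteq> B" "finite I" "card E < card I"
    and v: "\<And>i. i \<in> I \<Longrightarrow> v i \<in> lin_span D E"
  shows "\<exists>c. (\<forall>i\<in>I. c i \<in> D) \<and> (\<exists>i\<in>I. c i \<notin> P) \<and> (\<Sum>i\<in>I. c i * v i) \<in> P"
  using E v
proof (induction E arbitrary: I v rule: finite_induct)
  case empty
  have "v i = 0" if "i \<in> I" for i using empty(4)[OF that] by cases auto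
  moreover obtain i where "i \<in> I" using empty by (metis card_0_eq card.empty ex_in_conv less_irrefl)
  ultimately show ?case using P_one in_subring_one[OF D(1)] P_zero
    by (intro exI[of _ "\<lambda>_. 1"]) auto
next
  case (insert e E)
  have "\<exists>a w. a \<in> D \<and> w \<in> lin_span D E \<and> v i = a * e + w" if "i \<in> I" for i
    using lin_span_insertE[OF D(1) insert.prems(4)[OF that]] by blast
  then obtain a w where aw: "\<And>i. i \<in> I \<Longrightarrow> a i \<in> D \<and> w i \<in> lin_span D E \<and> v i = a i * e + w i"
    by metis
  show ?case
  proof (cases "\<forall>i\<in>I. a i \<in> P")
    case True
    obtain c where c: "\<forall>i\<in>I. c i \<in> D" "\<exists>i\<in>I. c i \<notin> P" "(\<Sum>i\<in>I. c i * w i) \<in> P"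
      using insert.IH[of I w] insert.prems insert.hyps aw by (auto simp: card_insert_if)
    have "(\<Sum>i\<in>I. c i * v i) = (\<Sum>i\<in>I. (c i * e) * a i) + (\<Sum>i\<in>I. c i * w i)"
      unfolding sum.distrib[symmetric] by (rule sum.cong) (auto simp: aw algebra_simps)
    moreover have "(\<Sum>i\<in>I. (c i * e) * a i) \<in> P"
      using True c(1) D(2) insert.prems(1) by (intro P_sum P_mult B_mult) auto
    ultimately have "(\<Sum>i\<in>I. c i * v i) \<in> P" using c(3) P_add by simp
    then show ?thesis using c by blast
  next
    case False
    then obtain k where k: "k \<in> I" "a k \<notin> P" by blast
    let ?I = "I - {k}" and ?u = "\<lambda>i. a k * w i - a i * w k"
    have "card E < card ?I" using insert k by (simp add: card_insert_if)
    moreover have "?u i \<in> lin_span D E" if "i \<in> ?I" for i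
      using aw that k by (intro lin_span_diff[OF D(1)] lin_span_scale[OF D(1)]) auto
    ultimately obtain c where c: "\<forall>i\<in>?I. c i \<in> D" "\<exists>i\<in>?I. c i \<notin> P" "(\<Sum>i\<in>?I. c i * ?u i) \<in> P"
      using insert.IH[of ?I ?u] insert.prems by auto
    \<comment> \<open>undo the elimination: the coefficient of the pivot \<open>v k\<close> balances the others\<close>
    define c' where "c' i = (if i = k then - (\<Sum>j\<in>?I. c j * a j) else a k * c i)" for i
    have "(\<Sum>i\<in>I. c' i * v i) = c' k * v k + (\<Sum>i\<in>?I. c' i * v i)"
      using k insert.prems by (simp add: sum.remove)
    also have "(\<Sum>i\<in>?I. c' i * v i) = (\<Sum>i\<in>?I. a k * c i * v i)"
      by (rule sum.cong) (auto simp: c'_def)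
    also have "c' k * v k + \<dots> = (\<Sum>i\<in>?I. c i * ?u i)"
      unfolding c'_def using aw k
      by (simp add: sum_distrib_right sum_distrib_left sum_subtractf[symmetric] sum_negf[symmetric]
          sum.distrib[symmetric]) (rule sum.cong, auto simp: algebra_simps aw)
    finally have "(\<Sum>i\<in>I. c' i * v i) \<in> P" using c(3) by simp
    moreover have "\<forall>i\<in>I. c' i \<in> D"
      unfolding c'_def using c(1) aw k by (auto intro!: in_subring_uminus[OF D(1)] in_subring_sum[OF D(1)] in_subring_mult[OF D(1)])
    moreover have "\<exists>i\<in>I. c' i \<notin> P"
    proof -
      obtain i where i: "i \<in> ?I" "c i \<notin> P" using c(2) by blast
      then have "a k * c i \<notin> P" using P_prime[of "a k" "c i"] k aw c(1) D(2) by auto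
      then show ?thesis using i unfolding c'_def by (intro bexI[of _ i]) auto
    qed
    ultimately show ?thesis by blast
  qed
qed

text \<open>The elements of \<open>B\<close> whose classes modulo \<open>P\<close> lie in \<open>W[1/s]\<close>.\<close>

definition fractions_over :: "'b set \<Rightarrow> 'b \<Rightarrow> 'b set" where
  "fractions_over W s = {y \<in> B. \<exists>e. \<exists>w\<in>W. s ^ e * y - w \<in> P}"

context
  fixes W s assumes W: "is_subring W" "W \<subseteq> B" "s \<in> W"
begin

lemma sub_fractions: "W \<subseteq> fractions_over W s"
proof
  fix w assume "w \<in> W"
  then show "w \<in> fractions_over W s" unfolding fractions_over_def
    using W P_zero by (auto intro!: exI[of _ 0] bexI[of _ w])
qed

lemma fractions_raise:
  assumes "s ^ e * y - w \<in> P" "e \<le> e'" "w \<in> W"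
  shows "s ^ e' * y - s ^ (e' - e) * w \<in> P"
proof -
  have "s ^ e' = s ^ (e' - e) * s ^ e" using assms(2) by (simp add: power_add[symmetric])
  then have "s ^ e' * y - s ^ (e' - e) * w = s ^ (e' - e) * (s ^ e * y - w)"
    by (simp add: algebra_simps)
  moreover have "s ^ (e' - e) \<in> B" using W B_power by blast
  ultimately show ?thesis using assms(1) P_mult by simp
qed

lemma is_subring_fractions: "is_subring (fractions_over W s)"
  unfolding is_subring_def
proof (intro conjI ballI)
  show "1 \<in> fractions_over W s" using sub_fractions in_subring_one[OF W(1)] by blast
  fix y y' assume "y \<in> fractions_over W s" "y' \<in> fractions_over W s"
  then obtain e w e' w' where *: "y \<in> B" "w \<in> W" "s ^ e * y - w \<in> P"
      "y' \<in> B" "w' \<in> W" "s ^ e' * y' - w' \<in> P"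
    by (auto simp: fractions_over_def)
  have sB: "s ^ k \<in> W" for k using W in_subring_power by blast
  have "s ^ (e + e') * y - s ^ e' * w \<in> P" "s ^ (e + e') * y' - s ^ e * w' \<in> P"
    using fractions_raise[OF *(3) _ *(2), of "e + e'"] fractions_raise[OF *(6) _ *(5), of "e + e'"]
    by simp_all
  then have "(s ^ (e + e') * y - s ^ e' * w) - (s ^ (e + e') * y' - s ^ e * w') \<in> P" by (rule P_diff)
  then have "s ^ (e + e') * (y - y') - (s ^ e' * w - s ^ e * w') \<in> P"
    by (simp add: algebra_simps)
  moreover have "s ^ e' * w - s ^ e * w' \<in> W" using sB * in_subring_diff[OF W(1)] in_subring_mult[OF W(1)] by blast
  ultimately show "y - y' \<in> fractions_over W s"
    unfolding fractions_over_def using * B_diff by blast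
  have "(s ^ e * y) * (s ^ e' * y') - w * w' \<in> P"
    using * W sB by (intro P_cong_mult) (auto intro: B_mult)
  then have "s ^ (e + e') * (y * y') - w * w' \<in> P"
    by (simp add: power_add mult_ac)
  then show "y * y' \<in> fractions_over W s"
    unfolding fractions_over_def using * B_mult in_subring_mult[OF W(1)] by blast
qed

text \<open>The step by which derivatives of a differential relation are solved for their highest derivative,
  whose coefficient is \<open>s\<close>.\<close>

lemma fractions_solve_linear:
  assumes "s * y + t \<in> P" "y \<in> B" "t \<in> fractions_over W s"
  shows "y \<in> fractions_over W s"
proof -
  obtain e w where w: "w \<in> W" "s ^ e * t - w \<in> P" using assms(3) by (auto simp: fractions_over_def)
  have "s ^ e \<in> B" using W B_power by blast
  then have "s ^ e * (s * y + t) - (s ^ e * t - w) \<in> P" using w assms P_mult P_diff by blast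
  then have "s ^ Suc e * y - (- w) \<in> P" by (simp add: algebra_simps)
  then show ?thesis unfolding fractions_over_def using assms(2) in_subring_uminus[OF W(1) w(1)] by blast
qed

end

text \<open>Algebraic dependence over the image of \<open>D\<close> modulo \<open>P\<close>: the sum runs over all exponents bounded
  by \<open>T\<close>, and nontriviality means that some coefficient does not vanish modulo \<open>P\<close>.\<close>

definition alg_dependent :: "'b set \<Rightarrow> nat \<Rightarrow> (nat \<Rightarrow> 'b) \<Rightarrow> bool" where
  "alg_dependent D N y \<longleftrightarrow> (\<exists>T c. (\<forall>\<alpha>\<in>{..<N} \<rightarrow>\<^sub>E {..T}. c \<alpha> \<in> D) \<and>
     (\<exists>\<alpha>\<in>{..<N} \<rightarrow>\<^sub>E {..T}. c \<alpha> \<notin> P) \<and>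
     (\<Sum>\<alpha>\<in>{..<N} \<rightarrow>\<^sub>E {..T}. c \<alpha> * (\<Prod>j<N. y j ^ \<alpha> j)) \<in> P)"

text \<open>The part of the theory of transcendence degree that is needed, obtained by counting. After
  multiplication by one power of \<open>s\<close>, the \<open>(T + 1)\<^sup>N\<close> monomials in \<open>y\<close> with exponents at most \<open>T\<close>
  lie in the span of the monomials in \<open>x\<close> with exponents at most \<open>Q T\<close>, where \<open>Q\<close> does not depend
  on \<open>T\<close>. There are at most \<open>(Q T + 1)\<^sup>m\<close> of these, which is less than \<open>(T + 1)\<^sup>N\<close> for large \<open>T\<close>
  as \<open>m < N\<close>; so the monomials in \<open>y\<close> are linearly dependent.\<close>

theorem too_many_fractions_dependent:
  fixes x :: "nat \<Rightarrow> 'b"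
  assumes D: "is_subring D" "D \<subseteq> B" and x: "x ` {..<m} \<subseteq> B"
    and s: "s \<in> subring_gen (D \<union> x ` {..<m})" "s \<notin> P"
    and y: "\<And>j. j < N \<Longrightarrow> y j \<in> fractions_over (subring_gen (D \<union> x ` {..<m})) s"
    and N: "m < N"
  shows "alg_dependent D N y"
proof -
  let ?W = "subring_gen (D \<union> x ` {..<m})" and ?M = "\<lambda>b. lin_span D (box_monomials m x b)"
  have W: "is_subring ?W" by (rule is_subring_subring_gen)
  have WB: "?W \<subseteq> B" by (rule subring_gen_least[OF subring_B]) (use D x in auto)
  have "\<exists>e w. y j \<in> B \<and> w \<in> ?W \<and> s ^ e * y j - w \<in> P" if "j < N" for j
    using y[OF that] by (auto simp: fractions_over_def)
  then obtain e0 w0 where 0: "\<And>j. j < N \<Longrightarrow> y j \<in> B \<and> w0 j \<in> ?W \<and> s ^ e0 j * y j - w0 j \<in> P"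
    by metis
  define e where "e = Max (e0 ` {..<N})"
  define w where "w j = s ^ (e - e0 j) * w0 j" for j
  have w: "y j \<in> B" "w j \<in> ?W" "s ^ e * y j - w j \<in> P" if "j < N" for j
  proof -
    show "y j \<in> B" using 0 that by blast
    show "w j \<in> ?W" unfolding w_def using 0[OF that] s in_subring_power[OF W] in_subring_mult[OF W] by blast
    show "s ^ e * y j - w j \<in> P" unfolding w_def
      by (rule fractions_raise[OF W WB s(1)]) (use 0[OF that] that in \<open>auto simp: e_def\<close>)
  qed
  have "\<exists>b. w j \<in> ?M b" if "j < N" for j
    using subring_gen_in_lin_span_box[OF D(1) w(2)[OF that]] by blast
  then obtain b0 where b0: "\<And>j. j < N \<Longrightarrow> w j \<in> ?M (b0 j)" by metis
  obtain b1 where b1: "s \<in> ?M b1" using subring_gen_in_lin_span_box[OF D(1) s(1)] by blast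
  define b where "b = max b1 (Max (b0 ` {..<N}))"
  have b: "w j \<in> ?M b" if "j < N" for j
    by (rule lin_span_box_mono[OF D(1) b0[OF that]]) (use that in \<open>auto simp: b_def le_max_iff_disj\<close>)
  have sb: "s \<in> ?M b" by (rule lin_span_box_mono[OF D(1) b1]) (simp add: b_def)
  define Q where "Q = N * (b + e * b)"
  \<comment> \<open>large enough for \<open>(Suc Q * Suc T) ^ m < Suc T ^ Suc m\<close>\<close>
  define T where "T = Suc Q ^ m"
  let ?I = "{..<N} \<rightarrow>\<^sub>E {..T}"
  let ?y = "\<lambda>\<alpha>. \<Prod>j<N. y j ^ \<alpha> j"
  define v where "v \<alpha> = (\<Prod>j<N. w j ^ \<alpha> j * s ^ (e * (T - \<alpha> j)))" for \<alpha>
  have v: "v \<alpha> \<in> ?M (Q * T)" if "\<alpha> \<in> ?I" for \<alpha>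
  proof -
    have "w j ^ \<alpha> j * s ^ (e * (T - \<alpha> j)) \<in> ?M ((b + e * b) * T)" if "j < N" for j
    proof -
      have \<alpha>: "\<alpha> j \<le> T" using \<open>\<alpha> \<in> ?I\<close> that by (auto simp: PiE_iff)
      have "w j ^ \<alpha> j * s ^ (e * (T - \<alpha> j)) \<in> ?M (\<alpha> j * b + (e * (T - \<alpha> j)) * b)"
        using b[OF that] sb by (intro lin_span_box_mult[OF D(1)] lin_span_box_power[OF D(1)])
      moreover have "\<alpha> j * b + (e * (T - \<alpha> j)) * b \<le> T * b + (e * T) * b"
        using \<alpha> by (intro add_mono mult_mono) auto
      moreover have "T * b + (e * T) * b = (b + e * b) * T" by (simp add: algebra_simps)
      ultimately show ?thesis by (metis lin_span_box_mono[OF D(1)])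
    qed
    then show ?thesis unfolding v_def Q_def mult.assoc by (intro lin_span_box_prod[OF D(1)]) simp
  qed
  have cong: "s ^ (e * (N * T)) * ?y \<alpha> - v \<alpha> \<in> P" if "\<alpha> \<in> ?I" for \<alpha>
  proof -
    have "s ^ (e * (N * T)) * ?y \<alpha> = (\<Prod>j<N. s ^ (e * T)) * ?y \<alpha>"
      by (simp add: power_mult[symmetric] mult_ac)
    also have "\<dots> = (\<Prod>j<N. (s ^ e * y j) ^ \<alpha> j * s ^ (e * (T - \<alpha> j)))"
      unfolding prod.distrib[symmetric]
    proof (rule prod.cong)
      fix j assume "j \<in> {..<N}"
      then have "\<alpha> j \<le> T" using \<open>\<alpha> \<in> ?I\<close> by (auto simp: PiE_iff)
      then have "s ^ (e * T) = s ^ (e * \<alpha> j) * s ^ (e * (T - \<alpha> j))"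
        by (simp add: power_add[symmetric] distrib_left[symmetric])
      then show "s ^ (e * T) * y j ^ \<alpha> j = (s ^ e * y j) ^ \<alpha> j * s ^ (e * (T - \<alpha> j))"
        by (simp add: power_mult_distrib power_mult mult_ac)
    qed simp
    finally have eq: "s ^ (e * (N * T)) * ?y \<alpha> = (\<Prod>j<N. (s ^ e * y j) ^ \<alpha> j * s ^ (e * (T - \<alpha> j)))" .
    have sB: "s \<in> B" using s(1) WB by blast
    show ?thesis unfolding eq v_def
    proof (rule P_cong_prod)
      fix j assume "j \<in> {..<N}"
      then have wj: "y j \<in> B" "w j \<in> B" "s ^ e * y j - w j \<in> P" using w WB by auto
      have "(s ^ e * y j) ^ \<alpha> j - w j ^ \<alpha> j \<in> P"
        using wj sB by (intro P_cong_power B_mult B_power) auto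
      then show "(s ^ e * y j) ^ \<alpha> j * s ^ (e * (T - \<alpha> j)) - w j ^ \<alpha> j * s ^ (e * (T - \<alpha> j)) \<in> P \<and>
          (s ^ e * y j) ^ \<alpha> j * s ^ (e * (T - \<alpha> j)) \<in> B \<and> w j ^ \<alpha> j * s ^ (e * (T - \<alpha> j)) \<in> B"
        using wj sB P_zero by (intro conjI P_cong_mult B_mult B_power) auto
    qed
  qed
  have card: "card (box_monomials m x (Q * T)) < card ?I"
  proof -
    have "Suc (Q * T) \<le> Suc Q * Suc T" by simp
    then have "Suc (Q * T) ^ m \<le> (Suc Q * Suc T) ^ m" by (rule power_mono) simp
    also have "\<dots> = T * Suc T ^ m" by (simp only: power_mult_distrib T_def)
    also have "\<dots> < Suc T ^ Suc m" by simp
    also have "\<dots> \<le> Suc T ^ N" using N by (intro power_increasing) auto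
    finally show ?thesis using card_box_monomials[of m x "Q * T"] by (simp add: card_PiE)
  qed
  have box_B: "box_monomials m x (Q * T) \<subseteq> B"
    using x by (auto simp: box_monomials_def intro!: B_prod B_power)
  obtain c where c: "\<forall>\<alpha>\<in>?I. c \<alpha> \<in> D" "\<exists>\<alpha>\<in>?I. c \<alpha> \<notin> P" "(\<Sum>\<alpha>\<in>?I. c \<alpha> * v \<alpha>) \<in> P"
    using linear_dependence[OF D conjunct1[OF card_box_monomials] box_B _ card, of v] v
    by (auto simp: finite_PiE)
  let ?S = "\<Sum>\<alpha>\<in>?I. c \<alpha> * ?y \<alpha>"
  have "s ^ (e * (N * T)) * ?S - (\<Sum>\<alpha>\<in>?I. c \<alpha> * v \<alpha>)
      = (\<Sum>\<alpha>\<in>?I. c \<alpha> * (s ^ (e * (N * T)) * ?y \<alpha> - v \<alpha>))"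
    by (simp add: sum_distrib_left sum_subtractf algebra_simps)
  also have "\<dots> \<in> P" using c(1) D(2) cong by (intro P_sum P_mult) auto
  finally have "s ^ (e * (N * T)) * ?S \<in> P" using c(3) P_cong_diff by blast
  moreover have sB: "s \<in> B" using s(1) WB by blast
  moreover have "?S \<in> B" using c(1) D(2) w(1) by (intro B_sum B_mult B_prod B_power) auto
  ultimately have "?S \<in> P" using P_prime[of "s ^ (e * (N * T))" ?S] P_power s(2) B_power by blast
  then show ?thesis unfolding alg_dependent_def using c by blast
qed

end

lemma sum_PiE_Suc:
  fixes g :: "(nat \<Rightarrow> nat) \<Rightarrow> 'b::comm_monoid_add"
  shows "(\<Sum>\<alpha>\<in>{..<Suc N} \<rightarrow>\<^sub>E {..T}. g \<alpha>) = (\<Sum>t\<le>T. \<Sum>\<alpha>\<in>{..<N} \<rightarrow>\<^sub>E {..T}. g (\<alpha>(N := t)))"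
proof -
  let ?f = "\<lambda>(t, \<alpha>). \<alpha>(N := t)"
  have "{..<Suc N} \<rightarrow>\<^sub>E {..T} = ?f ` ({..T} \<times> ({..<N} \<rightarrow>\<^sub>E {..T}))"
    using PiE_insert_eq[of N "{..<N}" "\<lambda>_. {..T}"] by (simp add: lessThan_Suc)
  moreover have "inj_on ?f ({..T} \<times> ({..<N} \<rightarrow>\<^sub>E {..T}))"
    using inj_combinator[of N "{..<N}" "\<lambda>_. {..T}"] by simp
  ultimately show ?thesis
    by (simp add: sum.reindex sum.cartesian_product split_def)
qed

context prime_in_subring
begin

text \<open>Write a relation modulo \<open>P\<close> as a polynomial in the last element \<open>y\<^sub>N\<close>, which lies in \<open>P'\<close> but not
  in \<open>P\<close>. The coefficients below the first nontrivial one vanish modulo \<open>P\<close>, a power of \<open>y\<^sub>N\<close> can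
  be cancelled, and reducing modulo \<open>P'\<close> kills the remaining multiples of \<open>y\<^sub>N\<close>. What is left is the
  first nontrivial coefficient, a relation modulo \<open>P'\<close> between the other elements.\<close>

lemma alg_dependent_lower:
  assumes P': "prime_in_subring B P'" "P \<subseteq> P'"
    and D: "D \<subseteq> B" "D \<inter> P' \<subseteq> P" and y: "\<And>j. j \<le> N \<Longrightarrow> y j \<in> B" "y N \<in> P'" "y N \<notin> P"
    and dep: "alg_dependent D (Suc N) y"
  shows "prime_in_subring.alg_dependent P' D N y"
proof -
  interpret P': prime_in_subring B P' by fact
  obtain T c where c: "\<forall>\<alpha>\<in>{..<Suc N} \<rightarrow>\<^sub>E {..T}. c \<alpha> \<in> D" "\<exists>\<alpha>\<in>{..<Suc N} \<rightarrow>\<^sub>E {..T}. c \<alpha> \<notin> P"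
      "(\<Sum>\<alpha>\<in>{..<Suc N} \<rightarrow>\<^sub>E {..T}. c \<alpha> * (\<Prod>j<Suc N. y j ^ \<alpha> j)) \<in> P"
    using dep unfolding alg_dependent_def by blast
  let ?I = "{..<N} \<rightarrow>\<^sub>E {..T}"
  define G where "G t = (\<Sum>\<alpha>\<in>?I. c (\<alpha>(N := t)) * (\<Prod>j<N. y j ^ \<alpha> j))" for t
  have upd: "\<alpha>(N := t) \<in> {..<Suc N} \<rightarrow>\<^sub>E {..T}" if "\<alpha> \<in> ?I" "t \<le> T" for \<alpha> t
    using that by (auto simp: PiE_iff extensional_def)
  have cD: "c (\<alpha>(N := t)) \<in> D" if "\<alpha> \<in> ?I" "t \<le> T" for \<alpha> t
    using upd[OF that] c(1) by blast
  have mon: "(\<Prod>j<N. y j ^ \<alpha> j) \<in> B" for \<alpha> using y by (intro B_prod B_power) auto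
  have GB: "G t \<in> B" if "t \<le> T" for t
    unfolding G_def using cD[OF _ that] D(1) mon by (intro B_sum B_mult) auto
  have yB: "y N \<in> B" using y by simp
  have "(\<Sum>\<alpha>\<in>{..<Suc N} \<rightarrow>\<^sub>E {..T}. c \<alpha> * (\<Prod>j<Suc N. y j ^ \<alpha> j)) = (\<Sum>t\<le>T. G t * y N ^ t)"
    unfolding sum_PiE_Suc G_def sum_distrib_right by (intro sum.cong) (auto simp: mult.assoc)
  then have rel: "(\<Sum>t\<le>T. G t * y N ^ t) \<in> P" using c(3) by simp
  obtain \<beta> where \<beta>: "\<beta> \<in> {..<Suc N} \<rightarrow>\<^sub>E {..T}" "c \<beta> \<notin> P" using c(2) by blast
  have "(restrict \<beta> {..<N})(N := \<beta> N) = \<beta>" using \<beta>(1)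
    by (auto simp: PiE_iff extensional_def fun_eq_iff)
  moreover have "\<beta> j \<le> T" if "j < Suc N" for j using \<beta>(1) that by (auto simp: PiE_iff)
  then have "restrict \<beta> {..<N} \<in> ?I" "\<beta> N \<le> T" by auto
  ultimately have ex: "\<exists>t. t \<le> T \<and> (\<exists>\<alpha>\<in>?I. c (\<alpha>(N := t)) \<notin> P)" using \<beta>(2) by metis
  \<comment> \<open>the first power of \<open>y N\<close> with a coefficient that is nontrivial modulo \<open>P\<close>\<close>
  define r where "r = (LEAST t. t \<le> T \<and> (\<exists>\<alpha>\<in>?I. c (\<alpha>(N := t)) \<notin> P))"
  have r: "r \<le> T" "\<exists>\<alpha>\<in>?I. c (\<alpha>(N := r)) \<notin> P"
    using LeastI_ex[OF ex] unfolding r_def by blast+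
  have small: "c (\<alpha>(N := t)) \<in> P" if "t < r" "\<alpha> \<in> ?I" for t \<alpha>
    using not_less_Least[of t "\<lambda>t. t \<le> T \<and> (\<exists>\<alpha>\<in>?I. c (\<alpha>(N := t)) \<notin> P)"] that r(1)
    unfolding r_def by fastforce
  have GP: "G t \<in> P" if "t < r" for t
    unfolding G_def using small[OF that] mon P_mult by (subst mult.commute) (intro P_sum, blast)
  define H where "H = (\<Sum>t\<in>{Suc r..T}. G t * y N ^ (t - Suc r))"
  have HB: "H \<in> B" unfolding H_def using GB yB by (intro B_sum B_mult B_power) auto
  have disj: "{..<r} \<inter> ({r} \<union> {Suc r..T}) = {}" by auto
  have "{..T} = {..<r} \<union> ({r} \<union> {Suc r..T})" using r(1) by auto
  then have "(\<Sum>t\<le>T. G t * y N ^ t)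
      = (\<Sum>t<r. G t * y N ^ t) + (\<Sum>t\<in>{r} \<union> {Suc r..T}. G t * y N ^ t)"
    by (metis (no_types, lifting) sum.union_disjoint finite_lessThan finite_Un finite.intros finite_atLeastAtMost
        disj)
  also have "(\<Sum>t\<in>{r} \<union> {Suc r..T}. G t * y N ^ t) = G r * y N ^ r + (\<Sum>t\<in>{Suc r..T}. G t * y N ^ t)"
    by simp
  also have "(\<Sum>t\<in>{Suc r..T}. G t * y N ^ t) = y N ^ Suc r * H"
    unfolding H_def sum_distrib_left
  proof (rule sum.cong)
    fix t assume "t \<in> {Suc r..T}"
    then have "y N ^ t = y N ^ Suc r * y N ^ (t - Suc r)" by (simp add: power_add[symmetric] del: power_Suc)
    then show "G t * y N ^ t = y N ^ Suc r * (G t * y N ^ (t - Suc r))" by (simp add: mult_ac)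
  qed simp
  finally have "(\<Sum>t\<le>T. G t * y N ^ t) - y N ^ r * (G r + y N * H) = (\<Sum>t<r. y N ^ t * G t)"
    by (simp add: algebra_simps)
  also have "\<dots> \<in> P" using GP yB by (intro P_sum P_mult B_power) auto
  finally have "y N ^ r * (G r + y N * H) \<in> P" using P_cong_diff rel by blast
  moreover have "y N ^ r \<notin> P" using P_power yB y(3) by blast
  ultimately have "G r + y N * H \<in> P"
    using P_prime[of "y N ^ r" "G r + y N * H"] B_power[OF yB] B_add[OF GB[OF r(1)] B_mult[OF yB HB]] by blast
  then have "G r + H * y N \<in> P'" using P'(2) by (auto simp: mult.commute)
  moreover have "H * y N \<in> P'" using P'.P_mult[OF HB y(2)] .
  ultimately have "G r \<in> P'" using P'.P_diff by fastforce
  moreover have "\<forall>\<alpha>\<in>?I. c (\<alpha>(N := r)) \<in> D" using cD r(1) by blast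
  moreover have "\<exists>\<alpha>\<in>?I. c (\<alpha>(N := r)) \<notin> P'" using r cD D(2) by blast
  ultimately show ?thesis unfolding P'.alg_dependent_def G_def
    by (intro exI[of _ T] exI[of _ "\<lambda>\<alpha>. c (\<alpha>(N := r))"] conjI)
qed

end

text \<open>A relation modulo one term of the chain descends to a relation between one element fewer modulo the
  preceding term, and finally to one between no elements. So transcendence degree bounds the length of
  chains of primes with the same contraction to \<open>D\<close>.\<close>

lemma descending_primes_independent:
  assumes prime: "\<And>j. prime_in_subring B (c j)" and desc: "\<And>j. c (Suc j) \<subseteq> c j"
    and D: "D \<subseteq> B" "\<And>j. D \<inter> c j \<subseteq> c (Suc j)"
    and y: "\<And>j. y j \<in> c j" "\<And>j. y j \<notin> c (Suc j)"
  shows "\<not> prime_in_subring.alg_dependent (c N) D N y"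
proof (induction N)
  case 0
  interpret prime_in_subring B "c 0" by (rule prime)
  show ?case by (auto simp: alg_dependent_def)
next
  case (Suc N)
  interpret prime_in_subring B "c (Suc N)" by (rule prime)
  have "y j \<in> B" for j using y(1) prime prime_in_subring.P_sub by blast
  then show ?case using alg_dependent_lower[OF prime desc D(1) D(2)] y Suc by blast
qed

section \<open>Differential polynomials and separants\<close>

definition cst :: "'a::comm_ring_1 \<Rightarrow> 'a dpoly" where
  "cst c = Poly_Mapping.single 0 c"

definition dvar :: "nat \<times> nat \<Rightarrow> 'a::comm_ring_1 dpoly" where
  "dvar v = Poly_Mapping.single (Poly_Mapping.single v 1) 1"

definition vars_in :: "(nat \<times> nat) set \<Rightarrow> 'a::comm_ring_1 dpoly set" where
  "vars_in V = {F. dpoly_vars F \<subseteq> V}"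

definition poly_over :: "'a::comm_ring_1 set \<Rightarrow> (nat \<times> nat) set \<Rightarrow> 'a dpoly set" where
  "poly_over A V = subring_gen (cst ` A \<union> dvar ` V)"

lemma cst_0 [simp]: "cst 0 = 0" and cst_1 [simp]: "cst 1 = 1"
  and cst_add: "cst (a + b) = cst a + cst b" and cst_mult: "cst (a * b) = cst a * cst b"
  and cst_diff: "cst (a - b) = cst a - cst b"
  by (simp_all add: cst_def single_add mult_single single_diff)

lemma cst_of_nat: "cst (of_nat k) = of_nat k"
  by (induction k) (simp_all add: cst_add)

lemma cst_of_int: "cst (of_int k :: 'a::comm_ring_1) = of_int k"
proof (cases k)
  case (neg n)
  have "cst (of_int k :: 'a) = cst (0 - of_nat (Suc n))" by (simp add: neg)
  also have "\<dots> = of_int k" unfolding cst_diff cst_of_nat by (simp add: neg)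
  finally show ?thesis .
qed (simp add: cst_of_nat)

lemma lookup_cst: "Poly_Mapping.lookup (cst c) m = (if m = 0 then c else 0)"
  by (simp add: cst_def lookup_single when_def)

lemma single_of_nat_mult:
  "Poly_Mapping.single m (of_nat k * c) = of_nat k * (Poly_Mapping.single m c :: 'a::comm_ring_1 dpoly)"
  using mult_single[of 0 "of_nat k :: 'a" m c] by (simp add: cst_of_nat[unfolded cst_def])

lemma dvar_power: "dvar v ^ k = Poly_Mapping.single (Poly_Mapping.single v k) 1"
  by (induction k) (simp_all add: dvar_def mult_single single_add[symmetric])

lemma single_sum_one:
  "Poly_Mapping.single (\<Sum>i\<in>A. f i) (1 :: 'a::comm_ring_1) = (\<Prod>i\<in>A. Poly_Mapping.single (f i) 1)"
proof (induction A rule: infinite_finite_induct)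
  case (insert i A)
  then show ?case
    using mult_single[of "f i" "1 :: 'a" "sum f A" 1] by simp
qed simp_all

lemma single_eq_cst_mult:
  "Poly_Mapping.single m (c :: 'a::comm_ring_1) = cst c * (\<Prod>v\<in>Poly_Mapping.keys m. dvar v ^ Poly_Mapping.lookup m v)"
proof -
  have "(\<Prod>v\<in>Poly_Mapping.keys m. dvar v ^ Poly_Mapping.lookup m v) = (Poly_Mapping.single m 1 :: 'a dpoly)"
    unfolding dvar_power single_sum_one[symmetric] dpoly_sum_terms[symmetric] ..
  then show ?thesis by (simp add: cst_def mult_single)
qed

lemma is_subring_vars_in: "is_subring (vars_in V)"
  unfolding is_subring_def vars_in_def
proof (intro conjI ballI CollectI)
  fix F G :: "'a dpoly" assume "F \<in> {F. dpoly_vars F \<subseteq> V}" "G \<in> {F. dpoly_vars F \<subseteq> V}"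
  moreover have "dpoly_vars (F - G) \<subseteq> dpoly_vars F \<union> dpoly_vars G"
    using dpoly_vars_add[of F "- G"] by (simp add: dpoly_vars_def)
  ultimately show "dpoly_vars (F - G) \<subseteq> V" "dpoly_vars (F * G) \<subseteq> V"
    using dpoly_vars_mult[of F G] by blast+
qed (simp add: dpoly_vars_def)

lemma vars_in_mono: "V \<subseteq> V' \<Longrightarrow> vars_in V \<subseteq> vars_in V'"
  by (auto simp: vars_in_def)

lemma cst_in_vars: "cst c \<in> vars_in V"
  by (simp add: vars_in_def dpoly_vars_def cst_def)

lemma dvar_in_vars: "v \<in> V \<Longrightarrow> dvar v \<in> vars_in V"
  by (simp add: vars_in_def dpoly_vars_def dvar_def)

lemma is_subring_poly_over: "is_subring (poly_over A V)"
  by (simp add: poly_over_def is_subring_subring_gen)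

lemma poly_over_subset_vars: "poly_over A V \<subseteq> vars_in V"
  unfolding poly_over_def
  by (rule subring_gen_least[OF is_subring_vars_in]) (auto intro: cst_in_vars dvar_in_vars)

lemma poly_over_mono: "A \<subseteq> A' \<Longrightarrow> V \<subseteq> V' \<Longrightarrow> poly_over A V \<subseteq> poly_over A' V'"
  unfolding poly_over_def by (rule subring_gen_mono) auto

lemma poly_over_least: "is_subring W \<Longrightarrow> cst ` A \<subseteq> W \<Longrightarrow> dvar ` V \<subseteq> W \<Longrightarrow> poly_over A V \<subseteq> W"
  unfolding poly_over_def by (rule subring_gen_least) auto

lemma cst_in_poly_over: "c \<in> A \<Longrightarrow> cst c \<in> poly_over A V"
  unfolding poly_over_def by (auto intro: subring_gen.gen)

lemma dvar_in_poly_over: "v \<in> V \<Longrightarrow> dvar v \<in> poly_over A V"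
  unfolding poly_over_def by (auto intro: subring_gen.gen)

lemma single_in_poly_over:
  "c \<in> A \<Longrightarrow> Poly_Mapping.keys m \<subseteq> V \<Longrightarrow> Poly_Mapping.single m c \<in> poly_over A V"
  unfolding single_eq_cst_mult
  by (intro in_subring_mult[OF is_subring_poly_over] in_subring_prod[OF is_subring_poly_over]
      in_subring_power[OF is_subring_poly_over] cst_in_poly_over dvar_in_poly_over) auto

lemma scaled_single_in_poly_over:
  "c \<in> A \<Longrightarrow> Poly_Mapping.keys m \<subseteq> V \<Longrightarrow>
    Poly_Mapping.single m (of_nat k * c) \<in> poly_over A V"
  unfolding single_of_nat_mult
  by (intro in_subring_mult[OF is_subring_poly_over] in_subring_of_nat[OF is_subring_poly_over] single_in_poly_over)

lemma in_poly_overI: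
  assumes "\<And>m. m \<in> Poly_Mapping.keys F \<Longrightarrow> Poly_Mapping.lookup F m \<in> A" "dpoly_vars F \<subseteq> V"
  shows "F \<in> poly_over A V"
  by (subst dpoly_sum_terms[of F])
    (use assms in \<open>auto intro!: in_subring_sum[OF is_subring_poly_over] single_in_poly_over simp: dpoly_vars_def\<close>)

lemma vars_in_eq_poly_over: "vars_in V = poly_over UNIV V"
  using poly_over_subset_vars in_poly_overI[of _ UNIV V] by (auto simp: vars_in_def)

lemma dpoly_vars_bounded_order:
  assumes "dpoly_vars F \<subseteq> J \<times> UNIV \<union> K"
  obtains b where "dpoly_vars F \<subseteq> J \<times> {..b} \<union> K"
proof
  let ?b = "Max (insert 0 (snd ` dpoly_vars F))"
  have "finite (dpoly_vars F)" by (simp add: dpoly_vars_def)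
  then have "snd v \<le> ?b" if "v \<in> dpoly_vars F" for v using that by (intro Max_ge) auto
  then show "dpoly_vars F \<subseteq> J \<times> {..?b} \<union> K" using assms by fastforce
qed

text \<open>The partial derivative with respect to \<open>v\<close>. It is called the separant when \<open>v\<close> is the highest
  derivative of its indeterminate that occurs in \<open>F\<close>.\<close>

definition separant :: "nat \<times> nat \<Rightarrow> 'a::comm_ring_1 dpoly \<Rightarrow> 'a dpoly" where
  "separant v F = (\<Sum>m\<in>Poly_Mapping.keys F. Poly_Mapping.single (m - Poly_Mapping.single v 1)
     (of_nat (Poly_Mapping.lookup m v) * Poly_Mapping.lookup F m))"

lemma lookup_separant:
  "Poly_Mapping.lookup (separant v F) m
    = of_nat (Suc (Poly_Mapping.lookup m v)) * Poly_Mapping.lookup F (m + Poly_Mapping.single v 1)"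
proof -
  let ?e = "Poly_Mapping.single v (1::nat)" and ?l = Poly_Mapping.lookup
  have "?l (separant v F) m
      = (\<Sum>k\<in>Poly_Mapping.keys F. if k = m + ?e then of_nat (?l k v) * ?l F k else 0)"
    unfolding separant_def lookup_sum
  proof (rule sum.cong)
    fix k
    have *: "k = m + ?e" if "k - ?e = m" "?l k v \<noteq> 0"
    proof (rule poly_mapping_eqI)
      fix u
      have "?l (k - ?e) u = ?l m u" using that(1) by simp
      then show "?l k u = ?l (m + ?e) u"
        using that(2) by (auto simp: lookup_add lookup_minus lookup_single when_def split: if_splits)
    qed
    show "?l (Poly_Mapping.single (k - ?e) (of_nat (?l k v) * ?l F k)) m
        = (if k = m + ?e then of_nat (?l k v) * ?l F k else 0)"
    proof (cases "k = m + ?e")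
      case True
      then have "k - ?e = m" by simp
      then show ?thesis using True by (simp add: lookup_single)
    next
      case False
      then have "?l k v = 0 \<or> k - ?e \<noteq> m" using * by blast
      then show ?thesis using False by (elim disjE) (simp_all add: lookup_single when_def)
    qed
  qed simp
  also have "\<dots> = of_nat (?l (m + ?e) v) * ?l F (m + ?e)"
    by (simp add: sum.delta in_keys_iff)
  finally show ?thesis by (simp add: lookup_add)
qed

lemma separant_in_poly_over:
  assumes "\<And>m. m \<in> Poly_Mapping.keys F \<Longrightarrow> Poly_Mapping.lookup F m \<in> A" "dpoly_vars F \<subseteq> V"
  shows "separant v F \<in> poly_over A V"
  unfolding separant_def
proof (intro in_subring_sum[OF is_subring_poly_over] scaled_single_in_poly_over)
  fix m assume m: "m \<in> Poly_Mapping.keys F"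
  then show "Poly_Mapping.lookup F m \<in> A" using assms by blast
  have "Poly_Mapping.keys (m - Poly_Mapping.single v 1) \<subseteq> Poly_Mapping.keys m"
    by (auto simp: in_keys_iff lookup_minus)
  then show "Poly_Mapping.keys (m - Poly_Mapping.single v 1) \<subseteq> V"
    using m assms(2) by (auto simp: dpoly_vars_def)
qed

definition shift :: "nat \<times> nat \<Rightarrow> nat \<times> nat" where "shift v = (fst v, Suc (snd v))"

locale derivation =
  fixes d :: "'a::comm_ring_1 \<Rightarrow> 'a"
  assumes d_add: "d (a + b) = d a + d b" and d_mult: "d (a * b) = d a * b + a * d b"
begin

abbreviation "\<Delta> \<equiv> dpoly_deriv d"

lemma d_zero: "d 0 = 0" using d_add[of 0 0] by simp
lemma d_one: "d 1 = 0" using d_mult[of 1 1] by simp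

lemma D_add: "\<Delta> (F + G) = \<Delta> F + \<Delta> G" by (rule dpoly_deriv_add[OF d_add])
lemma D_mult: "\<Delta> (F * G) = \<Delta> F * G + F * \<Delta> G" by (rule dpoly_deriv_mult[OF d_add d_mult])
lemma D_diff: "\<Delta> (F - G) = \<Delta> F - \<Delta> G" using D_add[of "F - G" G] by simp
lemma D_cst: "\<Delta> (cst c) = cst (d c)" unfolding cst_def by (rule dpoly_deriv_const[OF d_add])
lemma D_dvar: "\<Delta> (dvar v) = dvar (shift v)"
  using dpoly_deriv_var[OF d_add d_mult, of "fst v" "snd v"] by (simp add: dvar_def shift_def)

lemma D_poly_over:
  assumes "d ` A \<subseteq> A" "F \<in> poly_over A V"
  shows "\<Delta> F \<in> poly_over A (V \<union> shift ` V)"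
proof -
  let ?W = "poly_over A (V \<union> shift ` V)"
  note W = is_subring_poly_over[of A "V \<union> shift ` V"]
  have sub: "poly_over A V \<subseteq> ?W" by (rule poly_over_mono) auto
  show ?thesis
    using assms(2) unfolding poly_over_def[of A V]
  proof induction
    case (gen g)
    then show ?case using assms(1) by (auto simp: D_cst D_dvar intro!: cst_in_poly_over dvar_in_poly_over)
  next
    case one
    then show ?case using D_cst[of 1] d_one in_subring_zero[OF W] by simp
  next
    case (diff x y)
    then show ?case using in_subring_diff[OF W] by (simp add: D_diff)
  next
    case (mult x y)
    then have "x \<in> ?W" "y \<in> ?W" using sub unfolding poly_over_def[of A V] by blast+
    then show ?case using mult by (simp add: D_mult in_subring_add[OF W] in_subring_mult[OF W])
  qed
qed

text \<open>Only the term of the product rule that differentiates \<open>v\<close> itself can introduce \<open>shift v\<close> when no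
  other variable of \<open>F\<close> does, so the derivative of \<open>F\<close> is linear in \<open>shift v\<close> with the separant as
  its coefficient.\<close>

lemma D_leading_term:
  assumes A: "d ` A \<subseteq> A" "\<And>m. m \<in> Poly_Mapping.keys F \<Longrightarrow> Poly_Mapping.lookup F m \<in> A"
    and V: "dpoly_vars F \<subseteq> insert v V"
  shows "\<Delta> F - separant v F * dvar (shift v) \<in> poly_over A (insert v (V \<union> shift ` V))"
proof -
  let ?W = "poly_over A (insert v (V \<union> shift ` V))" and ?l = Poly_Mapping.lookup
  note W = is_subring_poly_over[of A "insert v (V \<union> shift ` V)"]
  let ?t = "\<lambda>m u. Poly_Mapping.single
        (m - Poly_Mapping.single u 1 + Poly_Mapping.single (fst u, Suc (snd u)) 1)
        (of_nat (?l m u) * ?l F m)"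
  have "separant v F * dvar (shift v) = (\<Sum>m\<in>Poly_Mapping.keys F. ?t m v)"
    by (simp add: separant_def sum_distrib_right dvar_def mult_single shift_def)
  then have "\<Delta> F - separant v F * dvar (shift v)
      = (\<Sum>m\<in>Poly_Mapping.keys F. dterm_deriv d m (?l F m) - ?t m v)"
    by (simp add: dpoly_deriv_def sum_subtractf)
  also have "\<dots> \<in> ?W"
  proof (rule in_subring_sum[OF W])
    fix m assume m: "m \<in> Poly_Mapping.keys F"
    then have mV: "Poly_Mapping.keys m \<subseteq> insert v V" using V by (auto simp: dpoly_vars_def)
    let ?K = "insert v (Poly_Mapping.keys m)"
    have "dterm_deriv d m (?l F m) = Poly_Mapping.single m (d (?l F m)) + (\<Sum>u\<in>?K. ?t m u)"
      by (rule dterm_deriv_superset) auto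
    also have "(\<Sum>u\<in>?K. ?t m u) = ?t m v + (\<Sum>u\<in>?K - {v}. ?t m u)"
      by (rule sum.remove) auto
    finally have "dterm_deriv d m (?l F m) - ?t m v
        = Poly_Mapping.single m (d (?l F m)) + (\<Sum>u\<in>?K - {v}. ?t m u)" by simp
    also have "\<dots> \<in> ?W"
    proof (intro in_subring_add[OF W] in_subring_sum[OF W] scaled_single_in_poly_over single_in_poly_over)
      fix u assume "u \<in> ?K - {v}"
      then have "u \<in> V" using mV by auto
      moreover have "Poly_Mapping.keys (m - Poly_Mapping.single u 1 + Poly_Mapping.single (fst u, Suc (snd u)) 1)
          \<subseteq> insert (shift u) (Poly_Mapping.keys m)"
        by (auto simp: in_keys_iff lookup_add lookup_minus lookup_single when_def shift_def split: if_splits)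
      ultimately show "Poly_Mapping.keys (m - Poly_Mapping.single u 1 + Poly_Mapping.single (fst u, Suc (snd u)) 1)
          \<subseteq> insert v (V \<union> shift ` V)" using mV by blast
    qed (use A m mV in auto)
    finally show "dterm_deriv d m (?l F m) - ?t m v \<in> ?W" .
  qed
  finally show ?thesis .
qed

text \<open>The derivatives of \<open>F\<close>, from the first on, are linear in the highest derivative of \<open>z\<^sub>i\<close> that they
  contain, always with the same coefficient: differentiating the lower terms and the coefficient
  produces nothing of higher order. The bound \<open>b\<close> on the order in the other indeterminates is tracked because the
  number of variables involved matters when contractions to \<open>R\<close> differ.\<close>

lemma iterated_D_leading_term:
  assumes A: "d ` A \<subseteq> A" "\<And>m. m \<in> Poly_Mapping.keys F \<Longrightarrow> Poly_Mapping.lookup F m \<in> A"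
    and V: "dpoly_vars F \<subseteq> J \<times> {..b} \<union> {i} \<times> {..h}"
  shows "(\<Delta> ^^ Suc k) F - separant (i, h) F * dvar (i, h + Suc k)
    \<in> poly_over A (J \<times> {..b + Suc k} \<union> {i} \<times> {..h + k})"
proof (induction k)
  case 0
  let ?V = "J \<times> {..b} \<union> {i} \<times> {..<h}"
  have "dpoly_vars F \<subseteq> insert (i, h) ?V"
    using V by (auto simp: subset_iff nat_less_le)
  then have "\<Delta> F - separant (i, h) F * dvar (shift (i, h)) \<in> poly_over A (insert (i, h) (?V \<union> shift ` ?V))"
    by (intro D_leading_term A)
  moreover have "insert (i, h) (?V \<union> shift ` ?V) \<subseteq> J \<times> {..b + Suc 0} \<union> {i} \<times> {..h + 0}"
    by (auto simp: shift_def)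
  ultimately have "\<Delta> F - separant (i, h) F * dvar (shift (i, h))
      \<in> poly_over A (J \<times> {..b + Suc 0} \<union> {i} \<times> {..h + 0})"
    using poly_over_mono[OF order.refl] by blast
  then show ?case by (simp add: shift_def)
next
  case (Suc k)
  let ?V = "J \<times> {..b + Suc k} \<union> {i} \<times> {..h + k}"
    and ?V' = "J \<times> {..b + Suc (Suc k)} \<union> {i} \<times> {..h + Suc k}" and ?S = "separant (i, h) F"
  note W = is_subring_poly_over[of A ?V']
  define T where "T = (\<Delta> ^^ Suc k) F - ?S * dvar (i, h + Suc k)"
  have V': "?V \<union> shift ` ?V \<subseteq> ?V'" by (auto simp: shift_def)
  have 1: "\<Delta> T \<in> poly_over A ?V'"
    using D_poly_over[OF A(1) Suc.IH] poly_over_mono[OF order.refl V'] unfolding T_def by blast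
  have "?S \<in> poly_over A (J \<times> {..b} \<union> {i} \<times> {..h})" by (rule separant_in_poly_over[OF A(2) V])
  moreover have "J \<times> {..b} \<union> {i} \<times> {..h} \<subseteq> ?V" by auto
  ultimately have "?S \<in> poly_over A ?V" using poly_over_mono[OF order.refl] by blast
  then have 2: "\<Delta> ?S \<in> poly_over A ?V'"
    using D_poly_over[OF A(1)] poly_over_mono[OF order.refl V'] by blast
  have 3: "dvar (i, h + Suc k) \<in> poly_over A ?V'" by (rule dvar_in_poly_over) auto
  have "(\<Delta> ^^ Suc (Suc k)) F = \<Delta> (T + ?S * dvar (i, h + Suc k))" unfolding T_def by simp
  also have "\<dots> = \<Delta> T + \<Delta> ?S * dvar (i, h + Suc k) + ?S * dvar (i, h + Suc (Suc k))"
    by (simp add: D_add D_mult D_dvar shift_def)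
  finally have "(\<Delta> ^^ Suc (Suc k)) F - ?S * dvar (i, h + Suc (Suc k))
      = \<Delta> T + \<Delta> ?S * dvar (i, h + Suc k)" by simp
  then show ?case using 1 2 3 in_subring_add[OF W] in_subring_mult[OF W] by simp
qed

end

section \<open>Differential transcendence degree of a differential prime\<close>

text \<open>A differential prime of the ring of differential polynomials in \<open>z\<^sub>0, \<dots>, z\<^sub>n\<^sub>-\<^sub>1\<close> with residue
  characteristic zero.\<close>

locale diff_prime = derivation d + prime_in_subring "vars_in ({..<n} \<times> UNIV)" P
  for d :: "'a::comm_ring_1 \<Rightarrow> 'a" and n :: nat and P :: "'a dpoly set" +
  assumes D_closed: "F \<in> P \<Longrightarrow> \<Delta> F \<in> P"
    and char_zero: "0 < k \<Longrightarrow> cst (of_nat k) \<notin> P"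

text \<open>\<open>F\<close> is zero as a polynomial over the residue ring \<open>R/p\<close>, where \<open>p\<close> is the contraction of \<open>P\<close>.\<close>

definition trivial_mod :: "'a::comm_ring_1 dpoly set \<Rightarrow> 'a dpoly \<Rightarrow> bool" where
  "trivial_mod P F \<longleftrightarrow> (\<forall>m. cst (Poly_Mapping.lookup F m) \<in> P)"

text \<open>All derivatives of the \<open>z\<^sub>i\<close> with \<open>i\<close> in \<open>I\<close> are algebraically independent modulo \<open>P\<close> over
  \<open>R/p\<close>.\<close>

definition diff_indep :: "'a::comm_ring_1 dpoly set \<Rightarrow> nat set \<Rightarrow> bool" where
  "diff_indep P I \<longleftrightarrow> (\<forall>F\<in>P. dpoly_vars F \<subseteq> I \<times> UNIV \<longrightarrow> trivial_mod P F)"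

definition diff_trdeg :: "nat \<Rightarrow> 'a::comm_ring_1 dpoly set \<Rightarrow> nat" where
  "diff_trdeg n P = Max (card ` {I. I \<subseteq> {..<n} \<and> diff_indep P I})"

lemma finite_diff_indep_sets: "finite {I. I \<subseteq> {..<n} \<and> diff_indep P I}"
  by (rule finite_subset[of _ "Pow {..<n}"]) auto

text \<open>Local nilpotence enters the proof here only: finitely many elements generate a differential subring
  that is finitely generated as a ring.\<close>

lemma finite_derivative_closed_superset:
  assumes nil: "\<And>a. \<exists>k. (d ^^ k) a = (0::'a::comm_ring_1)" and d0: "d 0 = 0" and Gen: "finite Gen"
  obtains A where "finite A" "Gen \<subseteq> A" "d ` A \<subseteq> A"
proof -
  obtain k where k: "\<And>a. (d ^^ k a) a = 0" using nil by metis
  let ?A = "\<Union>a\<in>Gen. (\<lambda>l. (d ^^ l) a) ` {..k a}"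
  show ?thesis
  proof
    show "finite ?A" using Gen by simp
    show "Gen \<subseteq> ?A" by force
    show "d ` ?A \<subseteq> ?A"
    proof
      fix b assume "b \<in> d ` ?A"
      then obtain a l where a: "a \<in> Gen" "l \<le> k a" "b = (d ^^ Suc l) a" by auto
      show "b \<in> ?A"
      proof (cases "l = k a")
        case True
        then have "b = (d ^^ k a) a" using a k d0 by simp
        then show ?thesis using a by blast
      next
        case False
        then have "Suc l \<in> {..k a}" using a by auto
        then show ?thesis using a(1,3) by blast
      qed
    qed
  qed
qed

lemma lookup_sum_dvar_monomials:
  fixes v :: "nat \<Rightarrow> nat \<times> nat"
  assumes v: "inj_on v {..<N}" and \<alpha>: "\<alpha> \<in> {..<N} \<rightarrow>\<^sub>E {..T}"
  shows "Poly_Mapping.lookup (\<Sum>\<beta>\<in>{..<N} \<rightarrow>\<^sub>E {..T}. cst (z \<beta>) * (\<Prod>j<N. dvar (v j) ^ \<beta> j))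
    (\<Sum>j<N. Poly_Mapping.single (v j) (\<alpha> j)) = (z \<alpha> :: 'a::comm_ring_1)"
proof -
  let ?m = "\<lambda>\<beta>. \<Sum>j<N. Poly_Mapping.single (v j) (\<beta> j)" and ?I = "{..<N} \<rightarrow>\<^sub>E {..T}"
  have eq: "cst (z \<beta>) * (\<Prod>j<N. dvar (v j) ^ \<beta> j) = Poly_Mapping.single (?m \<beta>) (z \<beta>)" for \<beta>
    unfolding dvar_power single_sum_one[symmetric] by (simp add: cst_def mult_single)
  have lk: "Poly_Mapping.lookup (?m \<beta>) (v i) = \<beta> i" if "i < N" for \<beta> i
  proof -
    have "Poly_Mapping.lookup (?m \<beta>) (v i) = (\<Sum>j<N. if j = i then \<beta> j else 0)"
      unfolding lookup_sum
      by (rule sum.cong) (use v that in \<open>auto simp: lookup_single when_def inj_on_eq_iff\<close>)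
    also have "\<dots> = \<beta> i" by (subst sum.delta) (use that in auto)
    finally show ?thesis .
  qed
  have inj: "\<beta> = \<alpha>" if "\<beta> \<in> ?I" "?m \<beta> = ?m \<alpha>" for \<beta>
    by (rule PiE_ext[OF that(1) \<alpha>]) (use lk that(2) in \<open>metis lessThan_iff\<close>)
  have "(\<Sum>\<beta>\<in>?I. Poly_Mapping.lookup (Poly_Mapping.single (?m \<beta>) (z \<beta>)) (?m \<alpha>))
      = (\<Sum>\<beta>\<in>?I. if \<beta> = \<alpha> then z \<beta> else 0)"
    by (rule sum.cong) (use inj in \<open>auto simp: lookup_single when_def\<close>)
  also have "\<dots> = z \<alpha>" by (subst sum.delta) (use \<alpha> in \<open>auto intro: finite_PiE\<close>)
  finally show ?thesis unfolding eq lookup_sum .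
qed

context diff_prime
begin

lemma D_power_closed: "F \<in> P \<Longrightarrow> (\<Delta> ^^ k) F \<in> P"
  by (induction k) (auto intro: D_closed)

lemma trivial_in_P:
  assumes "F \<in> vars_in ({..<n} \<times> UNIV)" "trivial_mod P F"
  shows "F \<in> P"
proof -
  have "Poly_Mapping.single m (Poly_Mapping.lookup F m) \<in> P" if "m \<in> Poly_Mapping.keys F" for m
  proof -
    have "Poly_Mapping.single m 1 \<in> vars_in ({..<n} \<times> UNIV)"
      using assms(1) that by (auto simp: vars_in_def dpoly_vars_def)
    then have "Poly_Mapping.single m 1 * cst (Poly_Mapping.lookup F m) \<in> P"
      using assms(2) P_mult by (auto simp: trivial_mod_def)
    then show ?thesis by (simp add: cst_def mult_single)
  qed
  then have "(\<Sum>m\<in>Poly_Mapping.keys F. Poly_Mapping.single m (Poly_Mapping.lookup F m)) \<in> P"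
    by (rule P_sum)
  then show ?thesis by (simp add: dpoly_sum_terms[symmetric])
qed

lemma cst_of_nat_mult_in_P:
  assumes "cst (of_nat k * c) \<in> P" "0 < k"
  shows "cst c \<in> P"
  using assms P_prime[of "cst (of_nat k)" "cst c"] char_zero cst_in_vars by (auto simp: cst_mult)

lemma cst_of_int_in_P:
  assumes "cst (of_int k) \<in> P"
  shows "k = 0"
proof (rule ccontr)
  assume "k \<noteq> 0"
  have "(of_nat (nat \<bar>k\<bar>) :: 'a) = of_int k \<or> (of_nat (nat \<bar>k\<bar>) :: 'a) = 0 - of_int k"
    by (simp add: abs_if)
  then have "cst (of_nat (nat \<bar>k\<bar>) :: 'a) = cst (of_int k) \<or> cst (of_nat (nat \<bar>k\<bar>)) = - cst (of_int k :: 'a)"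
    using cst_diff[of 0 "of_int k :: 'a"] by (metis cst_0 diff_0)
  then have "cst (of_nat (nat \<bar>k\<bar>)) \<in> P" using assms P_uminus by metis
  then show False using char_zero[of "nat \<bar>k\<bar>"] \<open>k \<noteq> 0\<close> by simp
qed

lemma diff_indep_empty: "diff_indep P {}"
  unfolding diff_indep_def
proof (intro ballI impI)
  fix F assume F: "F \<in> P" "dpoly_vars F \<subseteq> {} \<times> UNIV"
  then have "Poly_Mapping.keys m = {}" if "m \<in> Poly_Mapping.keys F" for m
    using that by (auto simp: dpoly_vars_def)
  then have "Poly_Mapping.keys F \<subseteq> {0}" by auto
  then have "F = cst (Poly_Mapping.lookup F 0)"
    by (intro poly_mapping_eqI) (auto simp: lookup_cst in_keys_iff)
  moreover have "Poly_Mapping.lookup F m = 0" if "m \<noteq> 0" for m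
    using \<open>Poly_Mapping.keys F \<subseteq> {0}\<close> that by (auto simp: in_keys_iff)
  ultimately have "cst (Poly_Mapping.lookup F m) \<in> P" for m
    using F(1) P_zero by (cases "m = 0") auto
  then show "trivial_mod P F" by (simp add: trivial_mod_def)
qed

lemma diff_trdeg_attained:
  obtains I where "I \<subseteq> {..<n}" "diff_indep P I" "card I = diff_trdeg n P"
proof -
  let ?C = "card ` {I. I \<subseteq> {..<n} \<and> diff_indep P I}"
  have "Max ?C \<in> ?C" using diff_indep_empty finite_diff_indep_sets by (intro Max_in) auto
  then show ?thesis using that unfolding diff_trdeg_def by (metis (no_types, lifting) imageE mem_Collect_eq)
qed

lemma card_le_diff_trdeg: "I \<subseteq> {..<n} \<Longrightarrow> diff_indep P I \<Longrightarrow> card I \<le> diff_trdeg n P"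
  unfolding diff_trdeg_def using finite_diff_indep_sets by (intro Max_ge) auto

lemma diff_trdeg_le: "diff_trdeg n P \<le> n"
  using diff_trdeg_attained by (metis card_lessThan card_mono finite_lessThan)

text \<open>Take a nontrivial relation of least order in \<open>z\<^sub>i\<close> and then of least degree in the highest derivative
  of \<open>z\<^sub>i\<close>. If its separant were in \<open>P\<close>, then by minimality all coefficients of the separant would
  vanish modulo \<open>P\<close>, hence in characteristic zero also those of all terms containing that
  derivative, and dropping these terms would give a nontrivial relation of smaller order.\<close>

lemma obtain_separant:
  assumes J: "diff_indep P J" "\<not> diff_indep P (insert i J)" "insert i J \<subseteq> {..<n}"
  obtains F h where "F \<in> P" "dpoly_vars F \<subseteq> J \<times> UNIV \<union> {i} \<times> {..h}" "separant (i, h) F \<notin> P"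
proof -
  let ?l = Poly_Mapping.lookup
  define Q where "Q h F \<longleftrightarrow> F \<in> P \<and> dpoly_vars F \<subseteq> J \<times> UNIV \<union> {i} \<times> {..<h} \<and> \<not> trivial_mod P F" for h F
  obtain F0 where F0: "F0 \<in> P" "dpoly_vars F0 \<subseteq> insert i J \<times> UNIV" "\<not> trivial_mod P F0"
    using J(2) by (auto simp: diff_indep_def)
  have "dpoly_vars F0 \<subseteq> {i} \<times> UNIV \<union> J \<times> UNIV" using F0(2) by auto
  then obtain b where "dpoly_vars F0 \<subseteq> {i} \<times> {..b} \<union> J \<times> UNIV"
    by (rule dpoly_vars_bounded_order)
  then have "dpoly_vars F0 \<subseteq> J \<times> UNIV \<union> {i} \<times> {..<Suc b}"
    by (simp add: lessThan_Suc_atMost Un_commute)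
  then have ex: "\<exists>h F. Q h F" using F0 unfolding Q_def by blast
  define h1 where "h1 = (LEAST h. \<exists>F. Q h F)"
  have h1: "\<exists>F. Q h1 F" using LeastI_ex[OF ex] unfolding h1_def .
  have minh: "\<not> Q h F" if "h < h1" for h F using not_less_Least[of h "\<lambda>h. \<exists>F. Q h F"] that
    unfolding h1_def by blast
  have "h1 \<noteq> 0" using h1 J(1) unfolding Q_def diff_indep_def by auto
  then obtain h where h: "h1 = Suc h" by (cases h1) auto
  let ?v = "(i, h)"
  define R where "R g F \<longleftrightarrow> Q h1 F \<and> (\<forall>m\<in>Poly_Mapping.keys F. ?l m ?v \<le> g)" for g F
  have "\<exists>g F. R g F"
  proof -
    obtain F where F: "Q h1 F" using h1 by blast
    have "\<forall>m\<in>Poly_Mapping.keys F. ?l m ?v \<le> Max ((\<lambda>m. ?l m ?v) ` Poly_Mapping.keys F)"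
      by (auto intro!: Max_ge)
    then show ?thesis using F unfolding R_def by blast
  qed
  then have exR: "\<exists>g. \<exists>F. R g F" .
  define g where "g = (LEAST g. \<exists>F. R g F)"
  obtain F where F: "R g F" using LeastI_ex[OF exR] unfolding g_def by blast
  have ming: "\<not> R g' F'" if "g' < g" for g' F' using not_less_Least[of g' "\<lambda>g. \<exists>F. R g F"] that
    unfolding g_def by blast
  have FP: "F \<in> P" and FV: "dpoly_vars F \<subseteq> J \<times> UNIV \<union> {i} \<times> {..h}" and Fnt: "\<not> trivial_mod P F"
    and Fg: "\<And>m. m \<in> Poly_Mapping.keys F \<Longrightarrow> ?l m ?v \<le> g"
    using F unfolding R_def Q_def h by (auto simp: lessThan_Suc_atMost)
  have keysF: "Poly_Mapping.keys m \<subseteq> J \<times> UNIV \<union> {i} \<times> {..h}" if "m \<in> Poly_Mapping.keys F" for m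
    using FV that by (auto simp: dpoly_vars_def)
  have "separant ?v F \<notin> P"
  proof
    let ?S = "separant ?v F"
    assume S: "?S \<in> P"
    have keysS: "m + Poly_Mapping.single ?v 1 \<in> Poly_Mapping.keys F" if "m \<in> Poly_Mapping.keys ?S" for m
      using that by (auto simp: in_keys_iff lookup_separant)
    have "?S \<in> poly_over UNIV (J \<times> UNIV \<union> {i} \<times> {..h})"
      by (rule separant_in_poly_over) (use FV in auto)
    then have SV: "dpoly_vars ?S \<subseteq> J \<times> UNIV \<union> {i} \<times> {..h}"
      using poly_over_subset_vars by (auto simp: vars_in_def)
    have triv: "trivial_mod P ?S"
    proof (cases "Poly_Mapping.keys ?S = {}")
      case True
      then show ?thesis using P_zero by (auto simp: trivial_mod_def in_keys_iff)
    next
      case False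
      have less: "Suc (?l m ?v) \<le> g" if "m \<in> Poly_Mapping.keys ?S" for m
        using Fg[OF keysS[OF that]] by (simp add: lookup_add)
      then have "0 < g" using False by fastforce
      then have "\<not> R (g - 1) ?S" by (intro ming) simp
      moreover have "\<forall>m\<in>Poly_Mapping.keys ?S. ?l m ?v \<le> g - 1" using less by fastforce
      ultimately show ?thesis using S SV unfolding R_def Q_def h by (auto simp: lessThan_Suc_atMost)
    qed
    have high: "cst (?l F m) \<in> P" if "?l m ?v \<noteq> 0" for m
    proof -
      let ?k = "m - Poly_Mapping.single ?v 1"
      have m: "?k + Poly_Mapping.single ?v 1 = m"
        by (rule poly_mapping_eqI) (use that in \<open>auto simp: lookup_add lookup_minus lookup_single when_def\<close>)
      have "cst (of_nat (Suc (?l ?k ?v)) * ?l F m) \<in> P"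
        using triv lookup_separant[of ?v F ?k] unfolding m trivial_mod_def by metis
      then show ?thesis by (rule cst_of_nat_mult_in_P) simp
    qed
    \<comment> \<open>the part of \<open>F\<close> in which the highest derivative does not occur\<close>
    define F1 where "F1 = (\<Sum>m | m \<in> Poly_Mapping.keys F \<and> ?l m ?v = 0. Poly_Mapping.single m (?l F m))"
    have lF1: "?l F1 m = (if ?l m ?v = 0 then ?l F m else 0)" for m
    proof -
      have "?l F1 m = (\<Sum>k | k \<in> Poly_Mapping.keys F \<and> ?l k ?v = 0. if k = m then ?l F k else 0)"
        unfolding F1_def lookup_sum by (rule sum.cong) (auto simp: lookup_single when_def)
      also have "\<dots> = (if ?l m ?v = 0 then ?l F m else 0)"
        by (simp add: sum.delta in_keys_iff)
      finally show ?thesis .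
    qed
    have F1V: "dpoly_vars F1 \<subseteq> J \<times> UNIV \<union> {i} \<times> {..<h} \<union> J \<times> UNIV"
    proof
      fix u assume "u \<in> dpoly_vars F1"
      then obtain m where m: "m \<in> Poly_Mapping.keys F1" "u \<in> Poly_Mapping.keys m" by (auto simp: dpoly_vars_def)
      then have *: "?l m ?v = 0" "m \<in> Poly_Mapping.keys F" by (auto simp: in_keys_iff lF1 split: if_splits)
      have "u \<noteq> ?v" using *(1) m(2) by (auto simp: in_keys_iff)
      moreover have "u \<in> J \<times> UNIV \<union> {i} \<times> {..h}" using m(2) keysF[OF *(2)] by blast
      ultimately show "u \<in> J \<times> UNIV \<union> {i} \<times> {..<h} \<union> J \<times> UNIV" by (cases u) auto
    qed
    have FB: "F \<in> vars_in ({..<n} \<times> UNIV)" using FP P_sub by blast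
    have F1B: "F1 \<in> vars_in ({..<n} \<times> UNIV)" using F1V J(3) by (fastforce simp: vars_in_def)
    have "trivial_mod P (F - F1)"
      using high P_zero by (simp add: trivial_mod_def lookup_minus lF1)
    then have "F - F1 \<in> P" using B_diff[OF FB F1B] trivial_in_P by blast
    then have "F1 \<in> P" using P_cong_diff FP by blast
    moreover have "\<not> Q h F1" by (rule minh) (simp add: h)
    ultimately have "trivial_mod P F1" using F1V unfolding Q_def by blast
    then have "cst (?l F m) \<in> P" for m
      using high[of m] unfolding trivial_mod_def lF1 by (cases "?l m ?v = 0") (auto dest: spec[of _ m])
    then show False using Fnt by (simp add: trivial_mod_def)
  qed
  then show ?thesis using that FP FV by blast
qed

text \<open>By induction on \<open>j\<close>, each derivative of \<open>F\<close> is solved for the highest derivative of \<open>z\<^sub>i\<close>. The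
  factor \<open>u\<close> allows several separants to share their product as a common denominator.\<close>

lemma higher_derivatives_are_fractions:
  assumes A: "d ` A \<subseteq> A" "\<And>m. m \<in> Poly_Mapping.keys F \<Longrightarrow> Poly_Mapping.lookup F m \<in> A"
    and F: "F \<in> P" "dpoly_vars F \<subseteq> J \<times> {..b} \<union> {i} \<times> {..h}" and i: "i < n"
    and W: "is_subring W" "W \<subseteq> vars_in ({..<n} \<times> UNIV)" "cst ` A \<subseteq> W"
    and V: "dvar ` (J \<times> {..b + k}) \<subseteq> W" "dvar ` ({i} \<times> {..h}) \<subseteq> W"
    and u: "u \<in> W" "u * separant (i, h) F \<in> W"
    and j: "j \<le> h + k"
  shows "dvar (i, j) \<in> fractions_over W (u * separant (i, h) F)"
  using j
proof (induction j rule: less_induct)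
  case (less j)
  let ?S = "separant (i, h) F"
  let ?W = "fractions_over W (u * ?S)"
  note sub = sub_fractions[OF W(1,2) u(2)] and sr = is_subring_fractions[OF W(1,2) u(2)]
  show ?case
  proof (cases "j \<le> h")
    case True
    then show ?thesis using V(2) sub by auto
  next
    case False
    then obtain l where l: "j = h + Suc l" by (metis less_imp_Suc_add not_le add_Suc_right)
    define T where "T = (\<Delta> ^^ Suc l) F - ?S * dvar (i, j)"
    have "T \<in> poly_over A (J \<times> {..b + Suc l} \<union> {i} \<times> {..h + l})"
      unfolding T_def l by (rule iterated_D_leading_term[OF A F(2)])
    moreover have "poly_over A (J \<times> {..b + Suc l} \<union> {i} \<times> {..h + l}) \<subseteq> ?W"
    proof (rule poly_over_least[OF sr])
      show "cst ` A \<subseteq> ?W" using W(3) sub by blast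
      have "J \<times> {..b + Suc l} \<subseteq> J \<times> {..b + k}" using less.prems l by auto
      then have "dvar ` (J \<times> {..b + Suc l}) \<subseteq> ?W" using V(1) sub by blast
      moreover have "dvar (i, j') \<in> ?W" if "j' \<le> h + l" for j'
        by (rule less.IH) (use that less.prems l in auto)
      ultimately show "dvar ` (J \<times> {..b + Suc l} \<union> {i} \<times> {..h + l}) \<subseteq> ?W" by auto
    qed
    ultimately have T: "u * T \<in> ?W" using u(1) sub in_subring_mult[OF sr] by blast
    have "u * (\<Delta> ^^ Suc l) F \<in> P" using D_power_closed[OF F(1)] W(2) u(1) P_mult by blast
    moreover have "u * (\<Delta> ^^ Suc l) F = (u * ?S) * dvar (i, j) + u * T"
      unfolding T_def by (simp add: algebra_simps)
    ultimately have "(u * ?S) * dvar (i, j) + u * T \<in> P" by simp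
    then show ?thesis
      by (rule fractions_solve_linear[OF W(1,2) u(2) _ _ T]) (use i in \<open>auto intro: dvar_in_vars\<close>)
  qed
qed

end

text \<open>A minimal subset \<open>K\<close> of \<open>I\<close> that is dependent modulo \<open>P'\<close> has the form \<open>J \<union> {i}\<close> with \<open>J\<close>
  independent, and so yields a relation with separant outside \<open>P'\<close>. With \<open>A\<close> a finite set of
  coefficients stable under the derivation, the \<open>(|J| + 1)(s + 1)\<close> derivatives of order at most \<open>s\<close>
  of the indeterminates in \<open>K\<close> are fractions over \<open>\<int>\<close> in at most
  \<open>|A| + |J|(b + s + 1) + h + 1\<close> generators, which is a smaller number once
  \<open>s \<ge> |A| + |J| b + h + 1\<close>. The resulting relation has integer coefficients, so it stays nontrivial
  modulo \<open>P\<close>.\<close>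

theorem diff_indep_generization:
  assumes nil: "\<And>a. \<exists>k. (d ^^ k) a = 0"
    and P: "diff_prime d n P" and P': "diff_prime d n P'" "P' \<subseteq> P"
    and I: "I \<subseteq> {..<n}" "diff_indep P I"
  shows "diff_indep P' I"
proof (rule ccontr)
  assume "\<not> diff_indep P' I"
  interpret P: diff_prime d n P by fact
  interpret P': diff_prime d n P' by fact
  have "\<exists>K. K \<subseteq> I \<and> \<not> diff_indep P' K" using \<open>\<not> diff_indep P' I\<close> by blast
  then obtain K where K: "K \<subseteq> I" "\<not> diff_indep P' K"
    and min: "\<And>L. L \<subseteq> I \<Longrightarrow> \<not> diff_indep P' L \<Longrightarrow> card K \<le> card L"
    using ex_has_least_nat[of "\<lambda>K. K \<subseteq> I \<and> \<not> diff_indep P' K" _ card] by metis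
  have finK: "finite K" using K(1) I(1) by (meson finite_lessThan finite_subset)
  obtain i where i: "i \<in> K" using K(2) P'.diff_indep_empty by fastforce
  define J where "J = K - {i}"
  have KJ: "K = insert i J" "finite J" "i \<notin> J" using i finK by (auto simp: J_def)
  have "card J < card K" using KJ by simp
  then have J: "diff_indep P' J" using min[of J] K(1) KJ(1) by fastforce
  obtain F h where F: "F \<in> P'" "dpoly_vars F \<subseteq> J \<times> UNIV \<union> {i} \<times> {..h}" "separant (i, h) F \<notin> P'"
    using P'.obtain_separant[of J i] J K KJ(1) I(1) by blast
  obtain A where A: "finite A" "Poly_Mapping.lookup F ` Poly_Mapping.keys F \<subseteq> A" "d ` A \<subseteq> A"
    using finite_derivative_closed_superset[of d, OF nil P.d_zero] by (metis finite_imageI finite_keys)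
  obtain b where Fb: "dpoly_vars F \<subseteq> J \<times> {..b} \<union> {i} \<times> {..h}"
    using dpoly_vars_bounded_order[OF F(2)] .
  \<comment> \<open>the least order for which the count of generators below is smaller than that of derivatives\<close>
  define s where "s = card A + card J * b + h + 1"
  define V where "V = J \<times> {..b + s} \<union> {i} \<times> {..h}"
  define Gen :: "'a dpoly set" where "Gen = cst ` A \<union> dvar ` V"
  define B :: "'a dpoly set" where "B = vars_in ({..<n} \<times> UNIV)"
  have K_n: "K \<subseteq> {..<n}" using K(1) I(1) by blast
  have finGen: "finite Gen" using A(1) KJ(2) by (simp add: Gen_def V_def)
  have "card Gen \<le> card (cst ` A :: 'a dpoly set) + card (dvar ` V :: 'a dpoly set)"
    unfolding Gen_def by (rule card_Un_le)
  also have "\<dots> \<le> card A + card V"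
    using A(1) KJ(2) by (intro add_mono card_image_le) (auto simp: V_def)
  also have "card V \<le> card J * (b + s + 1) + (h + 1)"
    unfolding V_def using card_Un_le[of "J \<times> {..b + s}" "{i} \<times> {..h}"] by (simp add: card_cartesian_product)
  finally have "card Gen \<le> card A + (card J * (b + s + 1) + (h + 1))" by simp
  also have "\<dots> < (card J + 1) * (s + 1)" by (simp add: s_def algebra_simps)
  also have "\<dots> = card (K \<times> {..s})" using KJ by (simp add: card_cartesian_product)
  finally have less: "card Gen < card (K \<times> {..s})" .
  obtain x where x: "bij_betw x {..<card Gen} Gen"
    using ex_bij_betw_nat_finite[OF finGen] by (auto simp: atLeast0LessThan)
  obtain v where v: "bij_betw v {..<card (K \<times> {..s})} (K \<times> {..s})"
    using ex_bij_betw_nat_finite[of "K \<times> {..s}"] finK by (auto simp: atLeast0LessThan)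
  let ?N = "card (K \<times> {..s})" and ?D = "range of_int :: 'a dpoly set"
  have xGen: "x ` {..<card Gen} = Gen" using x by (simp add: bij_betw_def)
  have D: "is_subring ?D" "?D \<subseteq> B"
    using is_subring_range_of_int cst_in_vars[of "of_int _"] unfolding B_def cst_of_int by auto
  have GenB: "Gen \<subseteq> B"
    using K_n KJ(1) by (auto simp: Gen_def B_def V_def intro!: cst_in_vars dvar_in_vars)
  let ?W = "subring_gen (?D \<union> x ` {..<card Gen})"
  have W: "is_subring ?W" "?W \<subseteq> B" "Gen \<subseteq> ?W"
    using is_subring_subring_gen subring_gen_least[OF P.subring_B] D(2) GenB
    unfolding xGen B_def by (auto intro: subring_gen.gen)
  have AV: "poly_over A V \<subseteq> ?W"
    by (rule poly_over_least[OF W(1)]) (use W(3) in \<open>auto simp: Gen_def\<close>)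
  have "separant (i, h) F \<in> poly_over A (J \<times> {..b} \<union> {i} \<times> {..h})"
    by (rule separant_in_poly_over) (use A(2) Fb in auto)
  also have "\<dots> \<subseteq> poly_over A V" by (rule poly_over_mono) (auto simp: V_def)
  finally have S: "separant (i, h) F \<in> ?W" using AV by blast
  have "P'.alg_dependent ?D ?N (\<lambda>j. dvar (v j))"
  proof (rule P'.too_many_fractions_dependent[OF D(1) _ _ S F(3) _ less])
    show "?D \<subseteq> vars_in ({..<n} \<times> UNIV)" "x ` {..<card Gen} \<subseteq> vars_in ({..<n} \<times> UNIV)"
      using D(2) GenB xGen unfolding B_def by auto
    fix j assume "j < ?N"
    then have "v j \<in> K \<times> {..s}" using v by (auto simp: bij_betw_def)
    then obtain i' l where vj: "v j = (i', l)" "i' \<in> K" "l \<le> s" by auto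
    have dV: "dvar ` V \<subseteq> ?W" using W(3) by (auto simp: Gen_def)
    show "dvar (v j) \<in> P'.fractions_over ?W (separant (i, h) F)"
    proof (cases "i' = i")
      case True
      have "dvar (i, l) \<in> P'.fractions_over ?W (1 * separant (i, h) F)"
      proof (rule P'.higher_derivatives_are_fractions[OF A(3) _ F(1) Fb _ W(1)])
        show "?W \<subseteq> vars_in ({..<n} \<times> UNIV)" using W(2) unfolding B_def .
        show "dvar ` (J \<times> {..b + s}) \<subseteq> ?W" "dvar ` ({i} \<times> {..h}) \<subseteq> ?W"
          using dV unfolding V_def by blast+
        show "cst ` A \<subseteq> ?W" using W(3) unfolding Gen_def by blast
        show "1 \<in> ?W" by (rule in_subring_one[OF W(1)])
        show "1 * separant (i, h) F \<in> ?W" using S by simp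
      qed (use A(2) K_n i vj in auto)
      then show ?thesis using vj True by simp
    next
      case False
      then have "v j \<in> V" using vj KJ(1) by (auto simp: V_def)
      then show ?thesis
        using dV P'.sub_fractions[OF W(1) W(2)[unfolded B_def] S] by blast
    qed
  qed
  then obtain T c where c: "\<forall>\<alpha>\<in>{..<?N} \<rightarrow>\<^sub>E {..T}. c \<alpha> \<in> ?D" "\<exists>\<alpha>\<in>{..<?N} \<rightarrow>\<^sub>E {..T}. c \<alpha> \<notin> P'"
      "(\<Sum>\<alpha>\<in>{..<?N} \<rightarrow>\<^sub>E {..T}. c \<alpha> * (\<Prod>j<?N. dvar (v j) ^ \<alpha> j)) \<in> P'"
    unfolding P'.alg_dependent_def by blast
  have vI: "v j \<in> I \<times> UNIV" if "j \<in> {..<?N}" for j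
    using bij_betw_apply[OF v that] K(1) by (auto simp: mem_Times_iff)
  let ?I = "{..<?N} \<rightarrow>\<^sub>E {..T}"
  have "\<forall>\<alpha>\<in>?I. \<exists>k. c \<alpha> = cst (of_int k)" using c(1) by (auto simp: cst_of_int)
  then obtain z where z: "\<And>\<alpha>. \<alpha> \<in> ?I \<Longrightarrow> c \<alpha> = cst (of_int (z \<alpha>))" by metis
  obtain \<alpha> where \<alpha>: "\<alpha> \<in> ?I" "c \<alpha> \<notin> P'" using c(2) by blast
  define G :: "'a dpoly" where "G = (\<Sum>\<alpha>\<in>?I. cst (of_int (z \<alpha>)) * (\<Prod>j<?N. dvar (v j) ^ \<alpha> j))"
  have "G = (\<Sum>\<alpha>\<in>?I. c \<alpha> * (\<Prod>j<?N. dvar (v j) ^ \<alpha> j))"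
    unfolding G_def by (rule sum.cong) (auto simp: z)
  then have "G \<in> P" using c(3) P'(2) by auto
  moreover have "G \<in> vars_in (I \<times> UNIV)"
    unfolding G_def
    by (intro in_subring_sum[OF is_subring_vars_in] in_subring_mult[OF is_subring_vars_in] in_subring_prod[OF is_subring_vars_in]
        in_subring_power[OF is_subring_vars_in] cst_in_vars dvar_in_vars vI)
  ultimately have "trivial_mod P G" using I(2) by (simp add: diff_indep_def vars_in_def)
  moreover have "Poly_Mapping.lookup G (\<Sum>j<?N. Poly_Mapping.single (v j) (\<alpha> j)) = of_int (z \<alpha>)"
    unfolding G_def
    by (rule lookup_sum_dvar_monomials[OF bij_betw_imp_inj_on[OF v] \<alpha>(1), of "\<lambda>\<beta>. of_int (z \<beta>)"])
  ultimately have "cst (of_int (z \<alpha>)) \<in> P" unfolding trivial_mod_def by metis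
  then have "z \<alpha> = 0" by (rule P.cst_of_int_in_P)
  then show False using \<alpha> z P'.P_zero by simp
qed

lemma diff_trdeg_mono:
  assumes "\<And>a. \<exists>k. (d ^^ k) a = 0" "diff_prime d n P" "diff_prime d n P'" "P' \<subseteq> P"
  shows "diff_trdeg n P \<le> diff_trdeg n P'"
proof -
  obtain I where "I \<subseteq> {..<n}" "diff_indep P I" "card I = diff_trdeg n P"
    by (rule diff_prime.diff_trdeg_attained[OF assms(2)])
  then show ?thesis
    using diff_indep_generization[OF assms] diff_prime.card_le_diff_trdeg[OF assms(3)] by metis
qed

lemma diff_prime_Inter:
  assumes c: "\<And>j. diff_prime d n (c j)" and desc: "\<And>j. c (Suc j) \<subseteq> c j"
  shows "diff_prime d n (\<Inter>j. c j)"
proof -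
  interpret c: diff_prime d n "c j" for j by (rule c)
  have mono: "c j \<subseteq> c i" if "i \<le> j" for i j using lift_Suc_antimono_le[of c, OF desc that] .
  show ?thesis
  proof
    show "is_subring (vars_in ({..<n} \<times> UNIV) :: 'a dpoly set)" by (rule is_subring_vars_in)
    fix F G :: "'a dpoly"
    assume FG: "F \<in> vars_in ({..<n} \<times> UNIV)" "G \<in> vars_in ({..<n} \<times> UNIV)" "F * G \<in> (\<Inter>j. c j)"
    show "F \<in> (\<Inter>j. c j) \<or> G \<in> (\<Inter>j. c j)"
    proof (rule ccontr)
      assume "\<not> ?thesis"
      then obtain i j where "F \<notin> c i" "G \<notin> c j" by blast
      then have "F \<notin> c (max i j)" "G \<notin> c (max i j)" using mono[of i "max i j"] mono[of j "max i j"] by auto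
      then show False using FG c.P_prime by blast
    qed
  next
    show "(\<Inter>j. c j) \<subseteq> vars_in ({..<n} \<times> UNIV)" using c.P_sub by blast
    show "0 < k \<Longrightarrow> cst (of_nat k) \<notin> (\<Inter>j. c j)" for k using c.char_zero by blast
    show "1 \<notin> (\<Inter>j. c j)" using c.P_one by blast
  qed (simp_all add: c.P_zero c.P_add c.P_mult c.D_closed)
qed

text \<open>The intersection \<open>Q\<close> of the chain replaces \<open>P'\<close>, whose contraction may be smaller than that of the
  chain: relations modulo \<open>Q\<close> have coefficients that are nontrivial modulo the contraction shared by
  all terms of the chain.\<close>

theorem diff_trdeg_infinite_chain:
  assumes nil: "\<And>a. \<exists>k. (d ^^ k) a = 0"
    and c: "\<And>j. diff_prime d n (c j)" "\<And>j. c (Suc j) \<subset> c j"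
    and contr: "\<And>j. {a. cst a \<in> c j} = {a. cst a \<in> c 0}"
    and P': "diff_prime d n P'" "\<And>j. P' \<subseteq> c j"
  shows "diff_trdeg n (c 0) < diff_trdeg n P'"
proof -
  define Q where "Q = (\<Inter>j. c j)"
  interpret c: diff_prime d n "c j" for j by (rule c)
  have Q: "diff_prime d n Q" unfolding Q_def using c by (intro diff_prime_Inter) auto
  interpret Q: diff_prime d n Q by (rule Q)
  have Qc: "Q \<subseteq> c j" for j by (auto simp: Q_def)
  have "diff_trdeg n (c 0) < diff_trdeg n Q"
  proof (rule ccontr)
    assume less: "\<not> diff_trdeg n (c 0) < diff_trdeg n Q"
    obtain I where I: "I \<subseteq> {..<n}" "diff_indep (c 0) I" "card I = diff_trdeg n (c 0)"
      by (rule c.diff_trdeg_attained)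
    have finI: "finite I" using I(1) finite_subset by blast
    have IQ: "diff_indep Q I" by (rule diff_indep_generization[OF nil c(1) Q Qc I(1,2)])
    have dep: "\<not> diff_indep Q (insert i I)" if "i \<in> {..<n} - I" for i
      using Q.card_le_diff_trdeg[of "insert i I"] that I less finI by auto
    have "\<exists>F h. F \<in> Q \<and> dpoly_vars F \<subseteq> I \<times> UNIV \<union> {i} \<times> {..h} \<and> separant (i, h) F \<notin> Q"
      if "i \<in> {..<n} - I" for i
    proof -
      have "insert i I \<subseteq> {..<n}" using that I(1) by auto
      then show ?thesis by (rule Q.obtain_separant[OF IQ dep[OF that]]) (intro exI conjI)
    qed
    then obtain F h where F: "\<And>i. i \<in> {..<n} - I \<Longrightarrow> F i \<in> Q"
        "\<And>i. i \<in> {..<n} - I \<Longrightarrow> dpoly_vars (F i) \<subseteq> I \<times> UNIV \<union> {i} \<times> {..h i}"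
        "\<And>i. i \<in> {..<n} - I \<Longrightarrow> separant (i, h i) (F i) \<notin> Q"
      by metis
    define B :: "'a dpoly set" where "B = vars_in ({..<n} \<times> UNIV)"
    define D :: "'a dpoly set" where "D = vars_in (I \<times> UNIV)"
    define Gen :: "'a dpoly set" where "Gen = dvar ` (\<Union>i\<in>{..<n} - I. {i} \<times> {..h i})"
    have finGen: "finite Gen" unfolding Gen_def by simp
    obtain x where "bij_betw x {..<card Gen} Gen"
      using ex_bij_betw_nat_finite[OF finGen] by (auto simp: atLeast0LessThan)
    then have xGen: "x ` {..<card Gen} = Gen" by (simp add: bij_betw_def)
    let ?W = "subring_gen (D \<union> x ` {..<card Gen})"
    have D: "is_subring D" "D \<subseteq> B"
      unfolding D_def B_def using is_subring_vars_in vars_in_mono[of "I \<times> UNIV" "{..<n} \<times> UNIV"] I(1)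
      by (blast, blast)
    have GenB: "Gen \<subseteq> B" by (auto simp: Gen_def B_def intro!: dvar_in_vars)
    have W: "is_subring ?W" "?W \<subseteq> B" "D \<subseteq> ?W" "Gen \<subseteq> ?W"
      using is_subring_subring_gen subring_gen_least[OF Q.subring_B] D(2) GenB
      unfolding xGen B_def by (auto intro: subring_gen.gen)
    have cstW: "cst a \<in> ?W" for a
      by (rule subsetD[OF W(3)]) (simp add: D_def cst_in_vars)
    have IW: "dvar ` (I \<times> UNIV) \<subseteq> ?W"
      by (rule order.trans[OF _ W(3)]) (auto simp: D_def intro: dvar_in_vars)
    have GW: "dvar ` ({i} \<times> {..h i}) \<subseteq> ?W" if "i \<in> {..<n} - I" for i
      by (rule order.trans[OF _ W(4)]) (use that in \<open>auto simp: Gen_def\<close>)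
    let ?S = "\<lambda>i. separant (i, h i) (F i)"
    have SW: "?S i \<in> ?W" if i: "i \<in> {..<n} - I" for i
    proof -
      have "?S i \<in> poly_over UNIV (I \<times> UNIV \<union> {i} \<times> {..h i})"
        by (rule separant_in_poly_over) (use F(2)[OF i] in auto)
      also have "\<dots> \<subseteq> ?W"
        by (rule poly_over_least[OF W(1)]) (use cstW IW GW[OF i] in auto)
      finally show ?thesis .
    qed
    define s where "s = (\<Prod>i\<in>{..<n} - I. ?S i)"
    have sW: "s \<in> ?W" unfolding s_def using SW by (intro in_subring_prod[OF W(1)])
    have sQ: "s \<notin> Q"
    proof -
      have "s \<in> B - Q" unfolding s_def B_def
        using SW W(2) F(3) by (intro Q.P_prod) (auto simp: B_def)
      then show ?thesis by blast
    qed
    let ?Fr = "Q.fractions_over ?W s"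
    have B_eq: "B = poly_over UNIV ({..<n} \<times> UNIV)" by (simp add: B_def vars_in_eq_poly_over)
    have frac: "B \<subseteq> ?Fr"
      unfolding B_eq
    proof (rule poly_over_least)
      note sub = Q.sub_fractions[OF W(1) W(2)[unfolded B_def] sW]
      show "is_subring ?Fr" by (rule Q.is_subring_fractions[OF W(1) W(2)[unfolded B_def] sW])
      show "cst ` UNIV \<subseteq> ?Fr" by (intro image_subsetI subsetD[OF sub] cstW)
      show "dvar ` ({..<n} \<times> UNIV) \<subseteq> ?Fr"
      proof (rule image_subsetI)
        fix v :: "nat \<times> nat" assume "v \<in> {..<n} \<times> UNIV"
        then obtain i j where i: "i \<in> {..<n}" and v: "v = (i, j)" by (cases v) auto
        show "dvar v \<in> ?Fr"
        proof (cases "i \<in> I")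
          case True
          then show ?thesis unfolding v by (intro subsetD[OF sub] subsetD[OF IW]) auto
        next
          case False
          then have i': "i \<in> {..<n} - I" using i by blast
          define u where "u = (\<Prod>k\<in>{..<n} - I - {i}. ?S k)"
          have s: "s = u * ?S i" unfolding s_def u_def
            using prod.remove[of "{..<n} - I" i ?S] i' by (simp add: mult.commute)
          have uW: "u \<in> ?W" unfolding u_def using SW by (intro in_subring_prod[OF W(1)]) auto
          obtain b where Fb: "dpoly_vars (F i) \<subseteq> I \<times> {..b} \<union> {i} \<times> {..h i}"
            using dpoly_vars_bounded_order[OF F(2)[OF i']] .
          show ?thesis unfolding v s
          proof (rule Q.higher_derivatives_are_fractions[where A = UNIV and k = j, OF _ _ F(1)[OF i'] Fb _ W(1)])
            show "?W \<subseteq> vars_in ({..<n} \<times> UNIV)" using W(2) unfolding B_def .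
            show "dvar ` (I \<times> {..b + j}) \<subseteq> ?W" using IW by blast
            show "u * ?S i \<in> ?W" using sW s by simp
          qed (use i cstW GW[OF i'] uW in auto)
        qed
      qed
    qed
    have "\<exists>f. f \<in> c j \<and> f \<notin> c (Suc j)" for j using c(2)[of j] by blast
    then obtain y where y: "\<And>j. y j \<in> c j" "\<And>j. y j \<notin> c (Suc j)" by metis
    let ?N = "Suc (card Gen)"
    have "Q.alg_dependent D ?N y"
    proof (rule Q.too_many_fractions_dependent[OF D(1) _ _ sW sQ])
      show "D \<subseteq> vars_in ({..<n} \<times> UNIV)" "x ` {..<card Gen} \<subseteq> vars_in ({..<n} \<times> UNIV)"
        using D(2) GenB xGen unfolding B_def by auto
      show "y j \<in> ?Fr" for j using y(1) c.P_sub frac unfolding B_def by blast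
    qed simp
    then obtain T e where e: "\<forall>\<alpha>\<in>{..<?N} \<rightarrow>\<^sub>E {..T}. e \<alpha> \<in> D" "\<exists>\<alpha>\<in>{..<?N} \<rightarrow>\<^sub>E {..T}. e \<alpha> \<notin> Q"
      "(\<Sum>\<alpha>\<in>{..<?N} \<rightarrow>\<^sub>E {..T}. e \<alpha> * (\<Prod>j<?N. y j ^ \<alpha> j)) \<in> Q"
      unfolding Q.alg_dependent_def by blast
    have c0: "c j \<subseteq> c 0" for j using lift_Suc_antimono_le[of c 0 j] c(2) by blast
    have DQ: "D \<inter> c j \<subseteq> Q" for j
    proof
      fix f assume f: "f \<in> D \<inter> c j"
      then have "trivial_mod (c 0) f" using c0 I(2) by (auto simp: diff_indep_def D_def vars_in_def)
      then have "trivial_mod (c i) f" for i using contr[of i] unfolding trivial_mod_def by blast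
      then show "f \<in> Q" using f D(2) c.trivial_in_P unfolding Q_def B_def by blast
    qed
    have "\<exists>\<alpha>\<in>{..<?N} \<rightarrow>\<^sub>E {..T}. e \<alpha> \<notin> c ?N" using e(1,2) DQ[of ?N] by blast
    then have "c.alg_dependent ?N D ?N y"
      unfolding c.alg_dependent_def using e(1,3) Qc[of ?N] by blast
    moreover have "\<not> c.alg_dependent ?N D ?N y"
    proof (rule descending_primes_independent)
      show "prime_in_subring (vars_in ({..<n} \<times> UNIV)) (c j)" for j by (rule c.prime_in_subring_axioms)
      show "D \<inter> c j \<subseteq> c (Suc j)" for j using DQ Qc by blast
    qed (use c(2) D(2) y in \<open>auto simp: B_def\<close>)
    ultimately show False by blast
  qed
  also have "\<dots> \<le> diff_trdeg n P'"
    using diff_trdeg_mono[OF nil Q P'(1)] P'(2) by (auto simp: Q_def)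
  finally show ?thesis .
qed

section \<open>Differential primes with prescribed contraction\<close>

lemma primeideal_iff_prime_in_subring:
  fixes R (structure)
  assumes B: "is_subring B" and "cring R"
    and R: "carrier R = B" "\<And>x y. x \<otimes> y = x * y" "\<And>x y. x \<oplus> y = x + y" "\<one> = 1" "\<zero> = 0"
  shows "primeideal P R \<longleftrightarrow> prime_in_subring B P"
proof
  interpret R: cring R by fact
  assume "primeideal P R"
  then interpret P: primeideal P R .
  show "prime_in_subring B P"
  proof
    show "P \<subseteq> B" using P.a_subset by (simp add: R)
    show "0 \<in> P" using P.zero_closed by (simp add: R)
    show "x + y \<in> P" if "x \<in> P" "y \<in> P" for x y using P.a_closed[OF that] by (simp add: R)
    show "x * y \<in> P" if "x \<in> B" "y \<in> P" for x y using P.I_l_closed[of y x] that by (simp add: R)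
    show "1 \<notin> P" using P.one_imp_carrier P.I_notcarr R(4) by auto
    show "x \<in> P \<or> y \<in> P" if "x \<in> B" "y \<in> B" "x * y \<in> P" for x y
      using P.I_prime[of x y] that by (simp add: R)
  qed (fact B)
next
  interpret R: cring R by fact
  assume "prime_in_subring B P"
  then interpret P: prime_in_subring B P .
  have m: "\<ominus> x = - x" if "x \<in> B" for x
    using R.minus_equality[of "- x" x] that P.B_uminus by (simp add: R)
  have "ideal P R"
  proof (rule idealI[OF R.ring_axioms])
    show "subgroup P (add_monoid R)"
      by (rule R.add.subgroupI)
        (use P.P_sub P.P_zero P.P_add P.P_uminus m in \<open>auto simp: R a_inv_def[symmetric]\<close>)
    show "x \<otimes> a \<in> P" "a \<otimes> x \<in> P" if "a \<in> P" "x \<in> carrier R" for a x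
      using P.P_mult[of x a] that by (simp_all add: R mult.commute)
  qed
  then show "primeideal P R"
  proof (rule primeidealI[OF _ \<open>cring R\<close>])
    show "carrier R \<noteq> P" using P.P_one P.B_one by (auto simp: R)
    show "a \<in> P \<or> b \<in> P" if "a \<in> carrier R" "b \<in> carrier R" "a \<otimes> b \<in> P" for a b
      using P.P_prime that by (simp add: R)
  qed
qed

lemma is_subring_UNIV: "is_subring UNIV"
  by (simp add: is_subring_def)

lemma diff_spec_type_ring:
  "p \<in> diff_spec (ring_of_type_algebra :: 'a::comm_ring_1 ring) d \<longleftrightarrow>
    prime_in_subring UNIV p \<and> d ` p \<subseteq> p"
  unfolding diff_spec_def
  by (subst primeideal_iff_prime_in_subring[OF is_subring_UNIV cring_from_type_algebra])
    (simp_all add: ring_of_type_algebra_def)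

lemma diff_spec_dpoly_ring:
  "P \<in> diff_spec (dpoly_ring n) (dpoly_deriv d) \<longleftrightarrow>
    prime_in_subring (vars_in ({..<n} \<times> UNIV)) P \<and> dpoly_deriv d ` P \<subseteq> P"
  unfolding diff_spec_def
  by (subst primeideal_iff_prime_in_subring[OF is_subring_vars_in cring_dpoly_ring])
    (simp_all add: vars_in_def)

lemma standard_ring_char_zero:
  assumes st: "standard_ring (ring_of_type_algebra :: 'a::comm_ring_1 ring) d"
    and p: "p \<in> diff_spec (ring_of_type_algebra :: 'a ring) d" and k: "0 < k"
  shows "of_nat k \<notin> p"
proof -
  let ?R = "ring_of_type_algebra :: 'a ring"
  interpret p: primeideal p ?R using p by (simp add: diff_spec_def)
  have R: "\<zero>\<^bsub>?R\<^esub> = 0" "\<one>\<^bsub>?R\<^esub> = 1" "x \<oplus>\<^bsub>?R\<^esub> y = x + y" for x y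
    by (simp_all add: ring_of_type_algebra_def)
  have "add_pow ?R k \<one>\<^bsub>?R\<^esub> = of_nat k" for k :: nat
  proof (induction k)
    case 0
    show ?case using p.add.nat_pow_0 R(1) by simp
  next
    case (Suc k)
    then show ?case using p.add.nat_pow_Suc[of k "\<one>\<^bsub>?R\<^esub>"] by (simp add: R add.commute)
  qed
  moreover have "has_char_zero (residue_field ?R p)" using st p by (simp add: standard_ring_def)
  ultimately show ?thesis using k p.residue_field_char_zero_iff by metis
qed

lemma prime_in_subring_Int:
  assumes "prime_in_subring UNIV P" "is_subring B"
  shows "prime_in_subring B (B \<inter> P)"
proof -
  interpret prime_in_subring UNIV P by fact
  show ?thesis
    by unfold_locales
      (use assms(2) P_zero P_add P_mult P_one P_prime in \<open>auto intro: in_subring_zero in_subring_add in_subring_mult\<close>)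
qed

text \<open>The kernel of the map to polynomials over \<open>R/p\<close> that sends the variables in \<open>V\<close> to zero. With \<open>V\<close>
  the set of all variables it is \<open>p + [z]\<close>, and with \<open>V\<close> empty it is the extension of \<open>p\<close>.\<close>

definition kernel_mod :: "'a::comm_ring_1 set \<Rightarrow> (nat \<times> nat) set \<Rightarrow> 'a dpoly set" where
  "kernel_mod p V = {F. \<forall>m. Poly_Mapping.keys m \<inter> V = {} \<longrightarrow> Poly_Mapping.lookup F m \<in> p}"

lemma keys_plus_nat: "Poly_Mapping.keys (m + k :: 'v \<Rightarrow>\<^sub>0 nat) = Poly_Mapping.keys m \<union> Poly_Mapping.keys k"
  by (auto simp: in_keys_iff lookup_add)

context
  fixes p :: "'a::comm_ring_1 set"
  assumes p: "prime_in_subring UNIV p"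
begin

interpretation p: prime_in_subring UNIV p by (rule p)

lemma kernel_mod_add: "F \<in> kernel_mod p V \<Longrightarrow> G \<in> kernel_mod p V \<Longrightarrow> F + G \<in> kernel_mod p V"
  by (simp add: kernel_mod_def lookup_add p.P_add)

lemma kernel_mod_sum: "(\<And>i. i \<in> A \<Longrightarrow> f i \<in> kernel_mod p V) \<Longrightarrow> (\<Sum>i\<in>A. f i) \<in> kernel_mod p V"
  by (simp add: kernel_mod_def lookup_sum p.P_sum)

lemma kernel_mod_single:
  "Poly_Mapping.single m c \<in> kernel_mod p V \<longleftrightarrow> Poly_Mapping.keys m \<inter> V \<noteq> {} \<or> c \<in> p"
  using p.P_zero by (auto simp: kernel_mod_def lookup_single when_def)

lemma kernel_mod_mult:
  assumes "G \<in> kernel_mod p V"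
  shows "F * G \<in> kernel_mod p V"
proof -
  have "F * G = (\<Sum>m\<in>Poly_Mapping.keys F. \<Sum>k\<in>Poly_Mapping.keys G.
      Poly_Mapping.single (m + k) (Poly_Mapping.lookup F m * Poly_Mapping.lookup G k))"
    by (subst (1) dpoly_sum_terms[of F], subst (1) dpoly_sum_terms[of G])
      (simp add: sum_product mult_single)
  also have "\<dots> \<in> kernel_mod p V"
  proof (intro kernel_mod_sum)
    fix m k
    show "Poly_Mapping.single (m + k) (Poly_Mapping.lookup F m * Poly_Mapping.lookup G k) \<in> kernel_mod p V"
      unfolding kernel_mod_single keys_plus_nat
      using assms p.P_mult by (auto simp: kernel_mod_def)
  qed
  finally show ?thesis .
qed

text \<open>The largest monomial whose coefficient survives in the quotient, for the lexicographic order on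
  exponents. That order is compatible with multiplication, and it is the reason why products of
  surviving terms survive.\<close>

lemma kernel_mod_leading_term:
  assumes "F \<notin> kernel_mod p V"
  obtains m c L K where "F = Poly_Mapping.single m c + L + K" "K \<in> kernel_mod p V"
    "\<And>k. k \<in> Poly_Mapping.keys L \<Longrightarrow> k < m" "c \<notin> p" "Poly_Mapping.keys m \<inter> V = {}"
proof -
  let ?l = "Poly_Mapping.lookup F" and ?k = "Poly_Mapping.keys F"
  define A where "A = {m \<in> ?k. Poly_Mapping.keys m \<inter> V = {} \<and> ?l m \<notin> p}"
  have finA: "finite A" by (simp add: A_def)
  have "A \<noteq> {}" using assms p.P_zero by (fastforce simp: A_def kernel_mod_def in_keys_iff)
  define m where "m = Max A"
  have m: "m \<in> A" unfolding m_def using finA \<open>A \<noteq> {}\<close> by (rule Max_in)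
  let ?t = "\<lambda>m. Poly_Mapping.single m (?l m)"
  show ?thesis
  proof
    have "F = (\<Sum>m\<in>?k. ?t m)" by (rule dpoly_sum_terms)
    also have "\<dots> = (\<Sum>m\<in>A. ?t m) + (\<Sum>m\<in>?k - A. ?t m)"
      by (subst add.commute, rule sum.subset_diff) (auto simp: A_def)
    also have "(\<Sum>m\<in>A. ?t m) = ?t m + (\<Sum>k\<in>A - {m}. ?t k)"
      by (rule sum.remove[OF finA m])
    finally show "F = ?t m + (\<Sum>k\<in>A - {m}. ?t k) + (\<Sum>m\<in>?k - A. ?t m)" .
    show "(\<Sum>m\<in>?k - A. ?t m) \<in> kernel_mod p V"
      by (rule kernel_mod_sum) (auto simp: kernel_mod_single A_def)
    show "k < m" if "k \<in> Poly_Mapping.keys (\<Sum>k\<in>A - {m}. ?t k)" for k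
    proof -
      have "k \<in> A - {m}" using that keys_sum[of ?t "A - {m}"] by (auto split: if_splits)
      moreover then have "k \<le> m" unfolding m_def using finA by (intro Max_ge) auto
      ultimately show ?thesis by auto
    qed
    show "?l m \<notin> p" "Poly_Mapping.keys m \<inter> V = {}" using m by (auto simp: A_def)
  qed
qed

lemma prime_kernel_mod: "prime_in_subring UNIV (kernel_mod p V)"
proof
  show "0 \<in> kernel_mod p V" using p.P_zero by (simp add: kernel_mod_def)
  show "1 \<notin> kernel_mod p V" using p.P_one by (auto simp: kernel_mod_def lookup_one intro!: exI[of _ 0])
  fix F G assume FG: "F * G \<in> kernel_mod p V"
  show "F \<in> kernel_mod p V \<or> G \<in> kernel_mod p V"
  proof (rule ccontr)
    assume "\<not> ?thesis"
    then have "F \<notin> kernel_mod p V" "G \<notin> kernel_mod p V" by auto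
    obtain m c L K where F: "F = Poly_Mapping.single m c + L + K" "K \<in> kernel_mod p V"
      "\<And>k. k \<in> Poly_Mapping.keys L \<Longrightarrow> k < m" "c \<notin> p" "Poly_Mapping.keys m \<inter> V = {}"
      using kernel_mod_leading_term[OF \<open>F \<notin> _\<close>] by metis
    obtain m' c' L' K' where G: "G = Poly_Mapping.single m' c' + L' + K'" "K' \<in> kernel_mod p V"
      "\<And>k. k \<in> Poly_Mapping.keys L' \<Longrightarrow> k < m'" "c' \<notin> p" "Poly_Mapping.keys m' \<inter> V = {}"
      using kernel_mod_leading_term[OF \<open>G \<notin> _\<close>] by metis
    let ?s = "Poly_Mapping.single m c" and ?s' = "Poly_Mapping.single m' c'"
    have "(?s + L) * (?s' + L') = F * G + ((- 1) * F) * K' + ((- 1) * (?s' + L')) * K"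
      by (simp add: F(1) G(1) algebra_simps)
    also have "\<dots> \<in> kernel_mod p V" 
      by (rule kernel_mod_add[OF kernel_mod_add[OF FG kernel_mod_mult[OF G(2)]] kernel_mod_mult[OF F(2)]])
    finally have prod: "(?s + L) * (?s' + L') \<in> kernel_mod p V" .
    have "Poly_Mapping.keys (m + m') \<inter> V = {}" using F(5) G(5) unfolding keys_plus_nat by blast
    then have "Poly_Mapping.lookup ((?s + L) * (?s' + L')) (m + m') \<in> p"
      using prod by (simp add: kernel_mod_def)
    also have "(?s + L) * (?s' + L') = Poly_Mapping.single (m + m') (c * c') + ?s * L' + L * (?s' + L')"
      by (simp add: algebra_simps mult_single)
    also have "Poly_Mapping.lookup \<dots> (m + m') = c * c'"
    proof -
      have "m + m' \<notin> Poly_Mapping.keys (?s * L')"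
      proof
        assume "m + m' \<in> Poly_Mapping.keys (?s * L')"
        then obtain b where "m + m' = m + b" "b \<in> Poly_Mapping.keys L'"
          using keys_mult[of ?s L'] by (auto split: if_splits)
        then show False using G(3)[of b] by simp
      qed
      moreover have "m + m' \<notin> Poly_Mapping.keys (L * (?s' + L'))"
      proof
        assume "m + m' \<in> Poly_Mapping.keys (L * (?s' + L'))"
        then obtain a b where ab: "m + m' = a + b" "a \<in> Poly_Mapping.keys L" "b \<in> Poly_Mapping.keys (?s' + L')"
          using keys_mult[of L "?s' + L'"] by blast
        then have "a < m" using F(3) by blast
        moreover have "b \<le> m'"
          using ab(3) Poly_Mapping.keys_add[of ?s' L'] G(3)[of b] by (auto split: if_splits)
        ultimately have "a + b < m + m'" by (rule add_less_le_mono)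
        then show False using ab(1) by simp
      qed
      ultimately show ?thesis by (simp add: lookup_add in_keys_iff)
    qed
    finally show False using p.P_prime F(4) G(4) by blast
  qed
qed (simp_all add: is_subring_UNIV kernel_mod_add kernel_mod_mult)

lemma kernel_mod_cst: "cst a \<in> kernel_mod p V \<longleftrightarrow> a \<in> p"
  by (simp add: cst_def kernel_mod_single)

lemma kernel_mod_dvar: "dvar v \<in> kernel_mod p V \<longleftrightarrow> v \<in> V"
  using p.P_one by (simp add: dvar_def kernel_mod_single)

lemma kernel_mod_deriv:
  assumes d: "d ` p \<subseteq> p" and V: "shift ` V \<subseteq> V" and F: "F \<in> kernel_mod p V"
  shows "dpoly_deriv d F \<in> kernel_mod p V"
  unfolding dpoly_deriv_def dterm_deriv_def
proof (intro kernel_mod_sum kernel_mod_add)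
  fix m
  let ?c = "Poly_Mapping.lookup F m"
  have c: "Poly_Mapping.keys m \<inter> V \<noteq> {} \<or> ?c \<in> p" using F by (auto simp: kernel_mod_def)
  then show "Poly_Mapping.single m (d ?c) \<in> kernel_mod p V" using d by (auto simp: kernel_mod_single)
  fix v assume v: "v \<in> Poly_Mapping.keys m"
  show "Poly_Mapping.single (m - Poly_Mapping.single v 1 + Poly_Mapping.single (fst v, Suc (snd v)) 1)
      (of_nat (Poly_Mapping.lookup m v) * ?c) \<in> kernel_mod p V"
  proof (cases "?c \<in> p")
    case True
    then show ?thesis using p.P_mult by (simp add: kernel_mod_single)
  next
    case False
    then obtain w where w: "w \<in> Poly_Mapping.keys m" "w \<in> V" using c by blast
    have "(if w = v then shift v else w) \<in>
        Poly_Mapping.keys (m - Poly_Mapping.single v 1 + Poly_Mapping.single (fst v, Suc (snd v)) 1)"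
      using w(1) by (auto simp: keys_plus_nat shift_def in_keys_iff lookup_minus lookup_single when_def)
    moreover have "(if w = v then shift v else w) \<in> V" using w(2) V by auto
    ultimately show ?thesis by (auto simp: kernel_mod_single)
  qed
qed

end

lemma kernel_mod_mono: "p \<subseteq> p' \<Longrightarrow> V \<subseteq> V' \<Longrightarrow> kernel_mod p V \<subseteq> kernel_mod p' V'"
  by (auto simp: kernel_mod_def) blast

section \<open>Gap measure and transcendence degree\<close>

text \<open>Unfolding the recursive clause introduces a quantifier over chains, which automation is better
  spared.\<close>

declare gap_ge.simps(2) [simp del]

lemma gap_ge_imp_neq: "gap_ge S k p p' \<Longrightarrow> 0 < k \<Longrightarrow> p \<noteq> p'"
  by (cases k) (auto simp: gap_ge.simps(2))

text \<open>Replacing the first term of a chain by a larger element keeps all the gaps.\<close>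

lemma gap_ge_widen:
  assumes "gap_ge S k q q'" "q \<subseteq> p" "p \<in> S" "p' \<subseteq> q'"
  shows "gap_ge S k p p'"
  using assms
proof (induction k arbitrary: q q' p p')
  case (Suc k)
  from Suc.prems(1) obtain c where c: "descending S q q' c" "\<And>i. gap_ge S k (c i) (c (Suc i))"
    by (auto simp: gap_ge.simps(2))
  have cs: "c 0 = q" "\<And>i. c i \<in> S" "\<And>i. c (Suc i) \<subset> c i" "\<And>i. q' \<subseteq> c i"
    using c(1) by (auto simp: descending_def)
  let ?c = "c(0 := p)"
  have "descending S p p' ?c"
    using cs Suc.prems(2,3,4) cs(3)[of 0] cs(4)[of 0] unfolding descending_def
    by (auto simp: gr0_conv_Suc) (metis Suc.prems(4) cs(4) subset_iff)+
  moreover have "gap_ge S k (?c i) (?c (Suc i))" for i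
  proof (cases i)
    case 0
    have "gap_ge S k p (c (Suc 0))"
      by (rule Suc.IH[OF c(2)[of 0]]) (use cs Suc.prems in auto)
    then show ?thesis using 0 by simp
  qed (use c in simp)
  moreover have "p \<noteq> p'"
    using calculation(1) unfolding descending_def by (metis psubsetE subset_antisym)
  ultimately show ?case by (auto simp: gap_ge.simps(2))
qed simp

lemma gap_ge_Suc_I:
  assumes "\<And>i. c i \<in> S" "\<And>i. c (Suc i) \<subset> c i" "\<And>i. p' \<subseteq> c i"
    and "\<And>i. gap_ge S k (c i) (c (Suc i))"
  shows "gap_ge S (Suc k) (c 0) p'"
proof -
  have "c 0 \<noteq> p'" using assms(2)[of 0] assms(3)[of "Suc 0"] by blast
  moreover have "descending S (c 0) p' c" using assms by (auto simp: descending_def)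
  ultimately show ?thesis using assms(4) by (auto simp: gap_ge.simps(2))
qed

lemma decseq_sets_subsequence:
  fixes f :: "nat \<Rightarrow> 'a set"
  assumes dec: "\<And>i. f (Suc i) \<subseteq> f i" and inf: "infinite {i. f (Suc i) \<noteq> f i}"
  obtains r :: "nat \<Rightarrow> nat" where "\<And>i. f (r (Suc i)) \<subset> f (r i)"
proof
  fix i
  let ?D = "{i. f (Suc i) \<noteq> f i}"
  have m: "i \<le> j \<Longrightarrow> f j \<subseteq> f i" for i j using lift_Suc_antimono_le[of f, OF dec] by blast
  have "enumerate ?D i \<in> ?D" using inf by (rule enumerate_in_set)
  then have "f (Suc (enumerate ?D i)) \<subset> f (enumerate ?D i)" using dec by blast
  moreover have "Suc (enumerate ?D i) \<le> enumerate ?D (Suc i)"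
    using inf by (simp add: Suc_leI enumerate_mono)
  ultimately show "f (enumerate ?D (Suc i)) \<subset> f (enumerate ?D i)"
    using m by blast
qed

lemma mono_bounded_nat_eventually_const:
  fixes f :: "nat \<Rightarrow> nat"
  assumes "\<And>i. f i \<le> f (Suc i)" "\<And>i. f i \<le> n"
  obtains N where "\<And>i. N \<le> i \<Longrightarrow> f i = f N"
proof -
  have "finite (range f)" using assms(2) by (meson atMost_iff finite_atMost finite_subset image_subsetI)
  then have "Max (range f) \<in> range f" by (intro Max_in) auto
  then obtain N where N: "f N = Max (range f)" by (metis imageE)
  have "f i = f N" if "N \<le> i" for i
  proof (rule antisym)
    show "f i \<le> f N" unfolding N using \<open>finite (range f)\<close> by (intro Max_ge) auto
    show "f N \<le> f i" by (rule lift_Suc_mono_le[of f, OF assms(1) that])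
  qed
  then show ?thesis using that by blast
qed

text \<open>Differential type and dimension depend on the ordered set of differential primes only.\<close>

definition spec_type :: "'a set set \<Rightarrow> enat" where
  "spec_type S = Sup {gap_measure S p p' | p p'. p \<in> S \<and> p' \<in> S \<and> p' \<subseteq> p}"

definition spec_dim :: "'a set set \<Rightarrow> enat" where
  "spec_dim S = Sup {enat k | k. \<exists>c :: nat \<Rightarrow> 'a set. (\<forall>i\<le>k. c i \<in> S) \<and>
     (\<forall>i<k. c (Suc i) \<subset> c i \<and> gap_measure S (c i) (c (Suc i)) = spec_type S)}"

text \<open>Chains as in the definition of the dimension. When \<open>t\<close> is the type, gap measure \<open>t\<close> amounts to
  gap measure at least \<open>t\<close>.\<close>

definition gap_chain :: "'a set set \<Rightarrow> nat \<Rightarrow> nat \<Rightarrow> (nat \<Rightarrow> 'a set) \<Rightarrow> bool" where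
  "gap_chain S t k c \<longleftrightarrow> (\<forall>i\<le>k. c i \<in> S) \<and>
     (\<forall>i<k. c (Suc i) \<subset> c i \<and> gap_ge S t (c i) (c (Suc i)))"

lemma enat_le_Sup_iff: "enat (Suc k) \<le> Sup A \<longleftrightarrow> (\<exists>x\<in>A. enat (Suc k) \<le> x)"
proof
  assume "enat (Suc k) \<le> Sup A"
  then have "enat k < Sup A" by (metis Suc_ile_eq)
  then show "\<exists>x\<in>A. enat (Suc k) \<le> x" unfolding less_Sup_iff by (auto simp: Suc_ile_eq)
qed (auto intro: Sup_upper2)

lemma enat_le_spec_type_iff:
  "enat (Suc k) \<le> spec_type S \<longleftrightarrow>
    (\<exists>p p'. p \<in> S \<and> p' \<in> S \<and> p' \<subseteq> p \<and> gap_ge S (Suc k) p p')"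
proof -
  have "enat (Suc k) \<le> spec_type S \<longleftrightarrow> (\<exists>p p'. p \<in> S \<and> p' \<in> S \<and> p' \<subseteq> p \<and> enat (Suc k) \<le> gap_fun S p p')"
    unfolding spec_type_def enat_le_Sup_iff gap_measure_eq_gap_fun by blast
  then show ?thesis using gap_fun_ge_iff by metis
qed

lemma spec_type_eqI:
  assumes "t = 0 \<or> (\<exists>p p'. p \<in> S \<and> p' \<in> S \<and> p' \<subseteq> p \<and> gap_ge S t p p')"
    and "\<And>p p'. p \<in> S \<Longrightarrow> p' \<in> S \<Longrightarrow> p' \<subseteq> p \<Longrightarrow> \<not> gap_ge S (Suc t) p p'"
  shows "spec_type S = enat t"
proof (rule antisym)
  have "\<not> enat (Suc t) \<le> spec_type S" unfolding enat_le_spec_type_iff using assms(2) by blast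
  then show "spec_type S \<le> enat t" by (simp add: Suc_ile_eq not_less)
  show "enat t \<le> spec_type S"
  proof (cases t)
    case (Suc k)
    then show ?thesis using assms(1) unfolding Suc enat_le_spec_type_iff by blast
  qed (simp add: zero_enat_def[symmetric])
qed

lemma gap_measure_eq_spec_type_iff:
  assumes t: "spec_type S = enat t" and p: "p \<in> S" "p' \<in> S" "p' \<subseteq> p"
  shows "gap_measure S p p' = spec_type S \<longleftrightarrow> gap_ge S t p p'"
proof -
  have "gap_measure S p p' \<le> spec_type S"
    unfolding spec_type_def by (rule Sup_upper) (use p in blast)
  then have "gap_measure S p p' = spec_type S \<longleftrightarrow> enat t \<le> gap_measure S p p'"
    using t by auto
  also have "\<dots> \<longleftrightarrow> gap_ge S t p p'"
    unfolding gap_measure_eq_gap_fun by (rule gap_fun_ge_iff[OF p])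
  finally show ?thesis .
qed

lemma spec_dim_eq:
  assumes t: "spec_type S = enat t"
  shows "spec_dim S = Sup {enat k | k. \<exists>c. gap_chain S t k c}"
proof -
  have "((\<forall>i\<le>k. c i \<in> S) \<and>
     (\<forall>i<k. c (Suc i) \<subset> c i \<and> gap_measure S (c i) (c (Suc i)) = spec_type S))
     \<longleftrightarrow> gap_chain S t k c" for k c
  proof -
    have "gap_measure S (c i) (c (Suc i)) = spec_type S \<longleftrightarrow> gap_ge S t (c i) (c (Suc i))"
      if "\<forall>i\<le>k. c i \<in> S" "i < k" "c (Suc i) \<subset> c i" for i
      by (rule gap_measure_eq_spec_type_iff[OF t]) (use that in auto)
    then show ?thesis unfolding gap_chain_def by blast
  qed
  then show ?thesis unfolding spec_dim_def by simp
qed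

text \<open>The properties of contraction \<open>\<kappa>\<close> from \<open>S\<close> to \<open>T\<close> that determine type and dimension of \<open>S\<close>. The
  section \<open>\<tau> 0\<close> stands for \<open>p \<mapsto> p + [z]\<close>, and \<open>\<tau> i\<close> for the same ideal with the first \<open>i\<close>
  indeterminates left free; \<open>\<delta>\<close> is the differential transcendence degree over the contraction.\<close>

locale spectral_fibration =
  fixes S :: "'b set set" and T :: "'a set set" and \<kappa> :: "'b set \<Rightarrow> 'a set"
    and \<tau> :: "nat \<Rightarrow> 'a set \<Rightarrow> 'b set" and \<delta> :: "'b set \<Rightarrow> nat" and n :: nat
  assumes \<kappa>_in: "P \<in> S \<Longrightarrow> \<kappa> P \<in> T"
    and \<kappa>_mono: "P \<in> S \<Longrightarrow> P' \<in> S \<Longrightarrow> P' \<subseteq> P \<Longrightarrow> \<kappa> P' \<subseteq> \<kappa> P"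
    and \<tau>_in: "p \<in> T \<Longrightarrow> i \<le> n \<Longrightarrow> \<tau> i p \<in> S"
    and \<tau>_strict: "p \<in> T \<Longrightarrow> p' \<in> T \<Longrightarrow> p' \<subset> p \<Longrightarrow> \<tau> 0 p' \<subset> \<tau> 0 p"
    and \<tau>_gap: "p \<in> T \<Longrightarrow> i < n \<Longrightarrow> \<tau> (Suc i) p \<subset> \<tau> i p \<and> gap_ge S 1 (\<tau> i p) (\<tau> (Suc i) p)"
    and \<delta>_le: "P \<in> S \<Longrightarrow> \<delta> P \<le> n"
    and \<delta>_mono: "P \<in> S \<Longrightarrow> P' \<in> S \<Longrightarrow> P' \<subseteq> P \<Longrightarrow> \<delta> P \<le> \<delta> P'"
    and \<delta>_strict: "(\<And>i. c i \<in> S) \<Longrightarrow> (\<And>i. c (Suc i) \<subset> c i) \<Longrightarrow> (\<And>i. \<kappa> (c i) = \<kappa> (c 0)) \<Longrightarrow>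
      P' \<in> S \<Longrightarrow> (\<And>i. P' \<subseteq> c i) \<Longrightarrow> \<delta> (c 0) < \<delta> P'"
    and n_pos: "0 < n" and T_nonempty: "T \<noteq> {}"
begin

text \<open>By induction on \<open>k\<close>. For \<open>k = 0\<close>, either the contracted chain drops infinitely often, or it is
  eventually constant and \<open>\<delta>\<close> increases. For larger \<open>k\<close>, the exception can occur at finitely many
  steps of an infinite chain only, as \<open>\<delta>\<close> is monotone and bounded; a tail of the chain contracts
  with all its gaps, and its first term can be replaced by the contraction of \<open>P\<close>.\<close>

lemma gap_contract:
  assumes "gap_ge S (Suc k) P P'" "P \<in> S" "P' \<in> S"
  shows "gap_ge T (Suc k) (\<kappa> P) (\<kappa> P') \<or> k = 0 \<and> \<delta> P < \<delta> P'"
  using assms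
proof (induction k arbitrary: P P')
  case 0
  then obtain c where "descending S P P' c" by (auto simp: gap_ge.simps(2))
  then have c: "c 0 = P" "\<And>i. c i \<in> S" "\<And>i. c (Suc i) \<subset> c i" "\<And>i. P' \<subseteq> c i"
    by (auto simp: descending_def)
  have dec: "\<kappa> (c (Suc i)) \<subseteq> \<kappa> (c i)" for i using \<kappa>_mono c(2,3) by blast
  have le: "\<kappa> (c i) \<subseteq> \<kappa> P" for i
    using lift_Suc_antimono_le[of "\<lambda>i. \<kappa> (c i)" 0 i, OF dec] c(1) by simp
  show ?case
  proof (cases "finite {i. \<kappa> (c (Suc i)) \<noteq> \<kappa> (c i)}")
    case True
    then obtain N where N: "\<And>i. \<kappa> (c (Suc i)) \<noteq> \<kappa> (c i) \<Longrightarrow> i < N"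
      by (metis (mono_tags, lifting) finite_nat_set_iff_bounded mem_Collect_eq)
    have "\<kappa> (c (i + N)) = \<kappa> (c (0 + N))" for i
      by (induction i) (use N in auto)
    then have "\<delta> (c (0 + N)) < \<delta> P'"
      using \<delta>_strict[of "\<lambda>i. c (i + N)" P'] c(2-4) 0 by simp
    moreover have "c N \<subseteq> P" using lift_Suc_antimono_le[of c 0 N] c by auto
    then have "\<delta> P \<le> \<delta> (c N)" using \<delta>_mono 0 c(2) by blast
    ultimately show ?thesis by simp
  next
    case False
    obtain r where r: "\<And>i. \<kappa> (c (r (Suc i))) \<subset> \<kappa> (c (r i))"
      using decseq_sets_subsequence[of "\<lambda>i. \<kappa> (c i)", OF dec False] by blast
    have "gap_ge T (Suc 0) (\<kappa> (c (r 0))) (\<kappa> P')"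
      by (rule gap_ge_Suc_I[of "\<lambda>i. \<kappa> (c (r i))"]) (use r \<kappa>_in \<kappa>_mono c 0 in auto)
    then have "gap_ge T (Suc 0) (\<kappa> P) (\<kappa> P')"
      by (rule gap_ge_widen) (use le \<kappa>_in 0 in auto)
    then show ?thesis by simp
  qed
next
  case (Suc k)
  from Suc.prems(1) obtain c where "descending S P P' c"
    and g: "\<And>i. gap_ge S (Suc k) (c i) (c (Suc i))"
    unfolding gap_ge.simps(2)[of S "Suc k"] by blast
  then have c: "c 0 = P" "\<And>i. c i \<in> S" "\<And>i. c (Suc i) \<subset> c i" "\<And>i. P' \<subseteq> c i"
    by (auto simp: descending_def)
  have dec: "\<kappa> (c (Suc i)) \<subseteq> \<kappa> (c i)" for i using \<kappa>_mono c(2,3) by blast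
  have le: "\<kappa> (c i) \<subseteq> \<kappa> P" for i
    using lift_Suc_antimono_le[of "\<lambda>i. \<kappa> (c i)" 0 i, OF dec] c(1) by simp
  obtain N where N: "\<And>i. N \<le> i \<Longrightarrow> \<delta> (c i) = \<delta> (c N)"
    using mono_bounded_nat_eventually_const[of "\<lambda>i. \<delta> (c i)" n] \<delta>_mono \<delta>_le c(2,3) by blast
  have g': "gap_ge T (Suc k) (\<kappa> (c (i + N))) (\<kappa> (c (Suc (i + N))))" for i
    using Suc.IH[OF g[of "i + N"] c(2) c(2)] N[of "i + N"] N[of "Suc (i + N)"] by auto
  have "gap_ge T (Suc (Suc k)) (\<kappa> (c (0 + N))) (\<kappa> P')"
  proof (rule gap_ge_Suc_I[of "\<lambda>i. \<kappa> (c (i + N))"])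
    show "\<kappa> (c (Suc i + N)) \<subset> \<kappa> (c (i + N))" for i using dec[of "i + N"] gap_ge_imp_neq[OF g'[of i]] by auto
  qed (use \<kappa>_in \<kappa>_mono c Suc g' in auto)
  then have "gap_ge T (Suc (Suc k)) (\<kappa> P) (\<kappa> P')"
    by (rule gap_ge_widen) (use le \<kappa>_in Suc in auto)
  then show ?case by blast
qed

lemma gap_lift:
  assumes "gap_ge T k p p'" "p \<in> T" "p' \<in> T"
  shows "gap_ge S k (\<tau> 0 p) (\<tau> 0 p')"
  using assms
proof (induction k arbitrary: p p')
  case (Suc k)
  from Suc.prems(1) obtain c where "descending T p p' c"
    and g: "\<And>i. gap_ge T k (c i) (c (Suc i))"
    unfolding gap_ge.simps(2)[of T k] by blast
  then have c: "c 0 = p" "\<And>i. c i \<in> T" "\<And>i. c (Suc i) \<subset> c i" "\<And>i. p' \<subseteq> c i"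
    by (auto simp: descending_def)
  have "\<tau> 0 q' \<subseteq> \<tau> 0 q" if "q' \<subseteq> q" "q \<in> T" "q' \<in> T" for q q'
    using that \<tau>_strict by (cases "q' = q") auto
  then show ?case
    using gap_ge_Suc_I[of "\<lambda>i. \<tau> 0 (c i)" S "\<tau> 0 p'" k] c g Suc \<tau>_in \<tau>_strict by simp
qed simp

lemma type_total:
  assumes t: "spec_type T = enat t"
  shows "spec_type S = enat (max t 1)"
proof (rule spec_type_eqI)
  have T: "\<not> gap_ge T (Suc k) p p'" if "p \<in> T" "p' \<in> T" "p' \<subseteq> p" "t \<le> k" for p p' k
    using enat_le_spec_type_iff[of k T] that t
    by (metis Suc_n_not_le_n enat_ord_simps(1) order.trans)
  fix P P' assume P: "P \<in> S" "P' \<in> S" "P' \<subseteq> P"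
  have "\<not> gap_ge T (Suc (max t 1)) (\<kappa> P) (\<kappa> P')" by (rule T) (use P \<kappa>_in \<kappa>_mono in auto)
  then show "\<not> gap_ge S (Suc (max t 1)) P P'"
    using gap_contract[of "max t 1" P P'] P by auto
next
  obtain p where p: "p \<in> T" using T_nonempty by blast
  have one: "\<exists>P P'. P \<in> S \<and> P' \<in> S \<and> P' \<subseteq> P \<and> gap_ge S 1 P P'"
    using \<tau>_gap[OF p n_pos] \<tau>_in[OF p, of 0] \<tau>_in[OF p, of "Suc 0"] n_pos
    by (intro exI[of _ "\<tau> 0 p"] exI[of _ "\<tau> (Suc 0) p"]) auto
  show "max t 1 = 0 \<or> (\<exists>P P'. P \<in> S \<and> P' \<in> S \<and> P' \<subseteq> P \<and> gap_ge S (max t 1) P P')"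
  proof (cases t)
    case (Suc k)
    then obtain q q' where q: "q \<in> T" "q' \<in> T" "q' \<subseteq> q" "gap_ge T t q q'"
      using enat_le_spec_type_iff[of k T] t by auto
    have "\<tau> 0 q' \<subseteq> \<tau> 0 q" using q \<tau>_strict by (cases "q' = q") auto
    then show ?thesis using q gap_lift \<tau>_in[of _ 0] Suc by (metis le_add1 max.absorb1 plus_1_eq_Suc zero_le)
  qed (use one in simp)
qed

text \<open>The lifted chain continues by freeing the \<open>n\<close> indeterminates over its last term.\<close>

lemma gap_chain_lift:
  assumes c: "gap_chain T 1 a c"
  obtains e where "gap_chain S 1 (a + n) e"
proof
  let ?e = "\<lambda>i. if i \<le> a then \<tau> 0 (c i) else \<tau> (i - a) (c a)"
  have c': "\<And>i. i \<le> a \<Longrightarrow> c i \<in> T" "\<And>i. i < a \<Longrightarrow> c (Suc i) \<subset> c i"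
    "\<And>i. i < a \<Longrightarrow> gap_ge T 1 (c i) (c (Suc i))" using c by (auto simp: gap_chain_def)
  show "gap_chain S 1 (a + n) ?e"
    unfolding gap_chain_def
  proof (intro conjI allI impI)
    fix i assume "i \<le> a + n"
    then show "?e i \<in> S" using c'(1) \<tau>_in by auto
  next
    fix i assume i: "i < a + n"
    have "?e (Suc i) \<subset> ?e i \<and> gap_ge S 1 (?e i) (?e (Suc i))"
    proof (cases "i < a")
      case True
      then show ?thesis using c' gap_lift[of 1 "c i" "c (Suc i)"] \<tau>_strict
        by simp
    next
      case False
      have e: "?e i = \<tau> (i - a) (c a)" "?e (Suc i) = \<tau> (Suc (i - a)) (c a)"
        using False by (auto simp: Suc_diff_le not_less)
      have "i - a < n" using i False by auto
      then show ?thesis unfolding e using \<tau>_gap[OF c'(1)[of a]] by blast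
    qed
    then show "?e (Suc i) \<subset> ?e i" "gap_ge S 1 (?e i) (?e (Suc i))" by blast+
  qed
qed

text \<open>Every step either contracts to a gap, which prolongs the chain \<open>e\<close>, or increases \<open>\<delta>\<close>. Steps of the
  second kind may still lower the contraction, so the end of \<open>e\<close> is only required to contain it.\<close>

lemma gap_chain_contract:
  assumes "gap_chain S 1 k c"
  shows "\<exists>a e. gap_chain T 1 a e \<and> \<kappa> (c k) \<subseteq> e a \<and> k + \<delta> (c 0) \<le> a + \<delta> (c k)"
  using assms
proof (induction k)
  case 0
  then show ?case using \<kappa>_in by (intro exI[of _ 0] exI[of _ "\<lambda>_. \<kappa> (c 0)"]) (auto simp: gap_chain_def)
next
  case (Suc k)
  have c: "c k \<in> S" "c (Suc k) \<in> S" "c (Suc k) \<subset> c k" "gap_ge S (Suc 0) (c k) (c (Suc k))"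
    using Suc.prems by (auto simp: gap_chain_def)
  have "gap_chain S 1 k c" using Suc.prems by (auto simp: gap_chain_def)
  then obtain a e where e: "gap_chain T 1 a e" "\<kappa> (c k) \<subseteq> e a" "k + \<delta> (c 0) \<le> a + \<delta> (c k)"
    using Suc.IH by blast
  have ea: "e a \<in> T" using e(1) by (auto simp: gap_chain_def)
  have \<kappa>: "\<kappa> (c (Suc k)) \<subseteq> \<kappa> (c k)" using c \<kappa>_mono by blast
  have \<delta>: "\<delta> (c k) \<le> \<delta> (c (Suc k))" using c \<delta>_mono by blast
  from gap_contract[OF c(4,1,2)] show ?case
  proof (elim disjE conjE)
    assume "\<delta> (c k) < \<delta> (c (Suc k))"
    then show ?thesis using e \<kappa> by (intro exI[of _ a] exI[of _ e]) auto
  next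
    assume g: "gap_ge T (Suc 0) (\<kappa> (c k)) (\<kappa> (c (Suc k)))"
    then have g': "gap_ge T 1 (e a) (\<kappa> (c (Suc k)))"
      using gap_ge_widen[OF g e(2) ea order.refl] by simp
    have sub: "\<kappa> (c (Suc k)) \<subset> e a" using gap_ge_imp_neq[OF g] \<kappa> e(2) by auto
    define e' where "e' = e(Suc a := \<kappa> (c (Suc k)))"
    have "gap_chain T 1 (Suc a) e'"
      using e(1) g' sub \<kappa>_in[OF c(2)] unfolding gap_chain_def e'_def
      by (auto simp: less_Suc_eq le_Suc_eq)
    moreover have "e' (Suc a) = \<kappa> (c (Suc k))" by (simp add: e'_def)
    ultimately show ?thesis using e(3) \<delta>
      by (intro exI[of _ "Suc a"] exI[of _ e']) auto
  qed
qed

lemma gap_chain_bound: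
  assumes "gap_chain S 1 k c"
  obtains a e where "gap_chain T 1 a e" "k \<le> a + n"
proof -
  obtain a e where e: "gap_chain T 1 a e" "k + \<delta> (c 0) \<le> a + \<delta> (c k)"
    using gap_chain_contract[OF assms] by blast
  have "\<delta> (c k) \<le> n" using assms \<delta>_le by (auto simp: gap_chain_def)
  then show ?thesis using that[OF e(1)] e(2) by simp
qed

lemma dim_total_type_0:
  assumes t: "spec_type T = 0"
  shows "spec_dim S = enat n"
proof -
  have S: "spec_type S = enat 1" using type_total[of 0] t by (simp add: zero_enat_def)
  have no: "a = 0" if "gap_chain T 1 a e" for a e
  proof (rule ccontr)
    assume "a \<noteq> 0"
    then have "\<exists>p p'. p \<in> T \<and> p' \<in> T \<and> p' \<subseteq> p \<and> gap_ge T (Suc 0) p p'"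
      using that unfolding gap_chain_def
      by (intro exI[of _ "e 0"] exI[of _ "e (Suc 0)"]) auto
    then have "enat (Suc 0) \<le> spec_type T" using enat_le_spec_type_iff by blast
    then show False using t by (simp add: zero_enat_def)
  qed
  show ?thesis
    unfolding spec_dim_eq[OF S]
  proof (rule antisym)
    show "Sup {enat k |k. \<exists>c. gap_chain S 1 k c} \<le> enat n"
    proof (rule Sup_least, safe)
      fix k c assume "gap_chain S 1 k c"
      then obtain a e where "gap_chain T 1 a e" "k \<le> a + n" by (rule gap_chain_bound)
      then show "enat k \<le> enat n" using no by fastforce
    qed
    obtain p where "p \<in> T" using T_nonempty by blast
    then have "gap_chain T 1 0 (\<lambda>_. p)" by (auto simp: gap_chain_def)
    then obtain e where "gap_chain S 1 (0 + n) e" by (rule gap_chain_lift)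
    then show "enat n \<le> Sup {enat k |k. \<exists>c. gap_chain S 1 k c}" by (intro Sup_upper) auto
  qed
qed

lemma dim_total_type_1:
  assumes t: "spec_type T = 1"
  shows "spec_dim S = enat n + spec_dim T"
proof -
  have S: "spec_type S = enat 1" using type_total[of 1] t by (simp add: one_enat_def)
  have T: "spec_type T = enat 1" using t by (simp add: one_enat_def)
  show ?thesis
  proof (rule antisym)
    show "spec_dim S \<le> enat n + spec_dim T"
      unfolding spec_dim_eq[OF S]
    proof (rule Sup_least, safe)
      fix k c assume "gap_chain S 1 k c"
      then obtain a e where e: "gap_chain T 1 a e" "k \<le> a + n" by (rule gap_chain_bound)
      then have "enat a \<le> spec_dim T" unfolding spec_dim_eq[OF T] by (intro Sup_upper) auto
      then have "enat n + enat a \<le> enat n + spec_dim T" by (rule add_left_mono)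
      moreover have "enat k \<le> enat n + enat a" using e(2) by simp
      ultimately show "enat k \<le> enat n + spec_dim T" by (rule order.trans[rotated])
    qed
    let ?A = "{enat k |k. \<exists>c. gap_chain T 1 k c}"
    obtain p where "p \<in> T" using T_nonempty by blast
    then have ne: "?A \<noteq> {}" by (auto simp: gap_chain_def intro!: exI[of _ 0] exI[of _ "\<lambda>_. p"])
    have up: "enat n + x \<le> spec_dim S" if x: "x \<in> ?A" for x
    proof -
      from x obtain a c where a: "x = enat a" "gap_chain T 1 a c" by blast
      obtain e where "gap_chain S 1 (a + n) e" using gap_chain_lift[OF a(2)] .
      then have "enat (a + n) \<le> spec_dim S" unfolding spec_dim_eq[OF S] by (intro Sup_upper) auto
      then show ?thesis using a by (simp add: add.commute)
    qed
    show "enat n + spec_dim T \<le> spec_dim S"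
    proof (cases "spec_dim S")
      case (enat s)
      have "Sup ?A \<le> enat (s - n)"
      proof (rule Sup_least)
        fix x assume "x \<in> ?A"
        then show "x \<le> enat (s - n)" using up enat by (cases x) fastforce+
      qed
      moreover have "n \<le> s" using up enat ne by (metis (no_types, lifting) all_not_in_conv
            enat_ord_simps(1) le_iff_add order.trans)
      ultimately have "enat n + Sup ?A \<le> enat n + enat (s - n)" by (intro add_left_mono)
      then show ?thesis using enat \<open>n \<le> s\<close> by (simp add: spec_dim_eq[OF T])
    qed simp
  qed
qed

text \<open>For \<open>t > 1\<close> the exceptional case of \<open>gap_contract\<close> does not arise, so chains can be contracted
  step by step.\<close>

lemma dim_total_type_gt_1:
  assumes t: "spec_type T = enat t" "1 < t"
  shows "spec_dim S = spec_dim T"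
proof -
  have S: "spec_type S = enat t" using type_total[of t] t by (simp add: max_def)
  obtain k where k: "t = Suc k" "k \<noteq> 0" using t(2) by (cases t) auto
  have "gap_chain S t a (\<lambda>i. \<tau> 0 (c i))" if "gap_chain T t a c" for a c
    using that \<tau>_in \<tau>_strict gap_lift unfolding gap_chain_def by simp
  moreover have "gap_chain T t a (\<lambda>i. \<kappa> (c i))" if c: "gap_chain S t a c" for a c
    unfolding gap_chain_def
  proof (intro conjI allI impI)
    fix i assume i: "i < a"
    have c': "c i \<in> S" "c (Suc i) \<in> S" "c (Suc i) \<subset> c i" "gap_ge S (Suc k) (c i) (c (Suc i))"
      using c i k unfolding gap_chain_def by auto
    show g: "gap_ge T t (\<kappa> (c i)) (\<kappa> (c (Suc i)))"
      using gap_contract[OF c'(4,1,2)] k by blast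
    show "\<kappa> (c (Suc i)) \<subset> \<kappa> (c i)" using gap_ge_imp_neq[OF g] k \<kappa>_mono c' by auto
  qed (use c \<kappa>_in in \<open>auto simp: gap_chain_def\<close>)
  ultimately have "(\<exists>c. gap_chain S t a c) \<longleftrightarrow> (\<exists>c. gap_chain T t a c)" for a by blast
  then show ?thesis unfolding spec_dim_eq[OF S] spec_dim_eq[OF t(1)] by simp
qed

end

section \<open>Rings of differential polynomials\<close>

text \<open>The gap between \<open>\<tau> i\<close> and \<open>\<tau> (i + 1)\<close> comes from freeing the indeterminate \<open>z\<^sub>i\<close>
  gradually: killing only its derivatives of order at least \<open>l\<close>, for \<open>l = 0, 1, 2, \<dots>\<close>, gives an
  infinite strictly descending chain.\<close>

theorem spectral_fibration_dpoly_ring: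
  fixes d :: "'a::comm_ring_1 \<Rightarrow> 'a"
  assumes R: "ordinary_differential_ring (ring_of_type_algebra :: 'a ring) d"
    and ne: "diff_spec (ring_of_type_algebra :: 'a ring) d \<noteq> {}"
    and st: "standard_ring (ring_of_type_algebra :: 'a ring) d"
    and nil: "locally_nilpotent (ring_of_type_algebra :: 'a ring) d"
    and n: "0 < n"
  shows "spectral_fibration (diff_spec (dpoly_ring n) (dpoly_deriv d))
    (diff_spec (ring_of_type_algebra :: 'a ring) d) (\<lambda>P. {a. cst a \<in> P})
    (\<lambda>i p. vars_in ({..<n} \<times> UNIV) \<inter> kernel_mod p {v. i \<le> fst v}) (diff_trdeg n) n"
proof -
  let ?R = "ring_of_type_algebra :: 'a ring"
  let ?S = "diff_spec (dpoly_ring n) (dpoly_deriv d)" and ?T = "diff_spec ?R d"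
  let ?B = "vars_in ({..<n} \<times> UNIV) :: 'a dpoly set"
  interpret R: ordinary_differential_ring ?R d by fact
  interpret derivation d
    using R.deriv_add R.deriv_mult by unfold_locales (simp_all add: ring_of_type_algebra_def)
  have nil': "\<exists>k. (d ^^ k) a = 0" for a
    using nil by (simp add: locally_nilpotent_def ring_of_type_algebra_def)
  have contr: "{a. cst a \<in> P} \<in> ?T" if P: "P \<in> ?S" for P
  proof -
    interpret P: prime_in_subring ?B P using P by (simp add: diff_spec_dpoly_ring)
    have "prime_in_subring UNIV {a. cst a \<in> P}"
    proof
      show "x * y \<in> {a. cst a \<in> P}" if "y \<in> {a. cst a \<in> P}" for x y
        using P.P_mult[OF cst_in_vars] that by (simp add: cst_mult)
      show "x \<in> {a. cst a \<in> P} \<or> y \<in> {a. cst a \<in> P}" if "x * y \<in> {a. cst a \<in> P}" for x y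
        using P.P_prime[OF cst_in_vars cst_in_vars] that by (simp add: cst_mult)
    qed (simp_all add: is_subring_UNIV P.P_zero P.P_one P.P_add cst_add)
    moreover have "d ` {a. cst a \<in> P} \<subseteq> {a. cst a \<in> P}"
      using P D_cst by (fastforce simp: diff_spec_dpoly_ring)
    ultimately show ?thesis by (simp add: diff_spec_type_ring)
  qed
  have dp: "diff_prime d n P" if P: "P \<in> ?S" for P
  proof -
    interpret P: prime_in_subring ?B P using P by (simp add: diff_spec_dpoly_ring)
    show ?thesis
    proof
      show "\<Delta> F \<in> P" if "F \<in> P" for F using that P by (auto simp: diff_spec_dpoly_ring)
      show "cst (of_nat k) \<notin> P" if "0 < k" for k
        using standard_ring_char_zero[OF st contr[OF P] that] by simp
    qed
  qed
  have ker: "?B \<inter> kernel_mod p V \<in> ?S" if p: "p \<in> ?T" and V: "shift ` V \<subseteq> V" for p V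
  proof -
    have p': "prime_in_subring UNIV p" "d ` p \<subseteq> p" using p by (simp_all add: diff_spec_type_ring)
    have "\<Delta> F \<in> ?B" if "F \<in> ?B" for F
      using dpoly_vars_deriv that by (auto simp: vars_in_def)
    then show ?thesis
      using prime_in_subring_Int[OF prime_kernel_mod[OF p'(1)] is_subring_vars_in]
        kernel_mod_deriv[OF p' V] by (auto simp: diff_spec_dpoly_ring)
  qed
  have shift_ge: "shift ` {v. i \<le> fst v} \<subseteq> {v. i \<le> fst v}" for i by (auto simp: shift_def)
  show ?thesis
  proof
    fix p i assume p: "p \<in> ?T" and i: "i < n"
    have p': "prime_in_subring UNIV p" using p by (simp add: diff_spec_type_ring)
    let ?V = "\<lambda>l. {v :: nat \<times> nat. Suc i \<le> fst v} \<union> {i} \<times> {l..}"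
    let ?c = "\<lambda>l. ?B \<inter> kernel_mod p (?V l)"
    let ?top = "?B \<inter> kernel_mod p {v. i \<le> fst v}"
      and ?bot = "?B \<inter> kernel_mod p {v. Suc i \<le> fst v}"
    have V0: "?V 0 = {v. i \<le> fst v}" by auto
    have strict: "?c (Suc l) \<subset> ?c l" for l
    proof -
      have "?c (Suc l) \<subseteq> ?c l" 
        by (intro Int_mono kernel_mod_mono order.refl) auto
      moreover have "dvar (i, l) \<in> ?c l" "dvar (i, l) \<notin> ?c (Suc l)"
        using i by (auto simp: kernel_mod_dvar[OF p'] intro: dvar_in_vars)
      ultimately show ?thesis by blast
    qed
    have bot: "?bot \<subseteq> ?c l" for l 
      by (intro Int_mono kernel_mod_mono order.refl) auto
    have "gap_ge ?S (Suc 0) (?c 0) ?bot"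
    proof (rule gap_ge_Suc_I[of ?c])
      show "?c l \<in> ?S" for l by (rule ker[OF p]) (auto simp: shift_def)
    qed (use strict bot in auto)
    moreover have "?bot \<subset> ?c 0" using bot strict by blast
    ultimately show "?bot \<subset> ?top \<and> gap_ge ?S 1 ?top ?bot" unfolding V0 by simp
  next
    fix p p' assume p: "p \<in> ?T" "p' \<in> ?T" "p' \<subset> p"
    have pp: "prime_in_subring UNIV p" "prime_in_subring UNIV p'" using p by (simp_all add: diff_spec_type_ring)
    obtain a where a: "a \<in> p" "a \<notin> p'" using p(3) by blast
    let ?K = "\<lambda>p. ?B \<inter> kernel_mod p {v. 0 \<le> fst v}"
    have "?K p' \<subseteq> ?K p" 
      by (intro Int_mono kernel_mod_mono order.refl) (use p(3) in blast)
    moreover have "cst a \<in> ?K p" "cst a \<notin> ?K p'"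
      using a cst_in_vars by (auto simp: kernel_mod_cst[OF pp(1)] kernel_mod_cst[OF pp(2)])
    ultimately show "?K p' \<subset> ?K p" by blast
  next
    fix P assume "P \<in> ?S"
    then show "diff_trdeg n P \<le> n" using dp diff_prime.diff_trdeg_le by blast
  next
    fix P P' assume "P \<in> ?S" "P' \<in> ?S" "P' \<subseteq> P"
    then show "diff_trdeg n P \<le> diff_trdeg n P'" using diff_trdeg_mono[OF nil'] dp by blast
  next
    fix c P'
    assume c: "\<And>i. c i \<in> ?S" "\<And>i. c (Suc i) \<subset> c i" "\<And>i. {a. cst a \<in> c i} = {a. cst a \<in> c 0}"
      and P': "P' \<in> ?S" "\<And>i. P' \<subseteq> c i"
    show "diff_trdeg n (c 0) < diff_trdeg n P'"
      by (rule diff_trdeg_infinite_chain[OF nil' dp[OF c(1)] c(2,3) dp[OF P'(1)] P'(2)])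
  qed (use contr ker shift_ge n ne in auto)
qed

lemma diff_type_eq_spec_type: "diff_type R d = spec_type (diff_spec R d)"
  by (simp add: diff_type_def spec_type_def)

lemma diff_dim_eq_spec_dim: "diff_dim R d = spec_dim (diff_spec R d)"
  by (simp add: diff_dim_def spec_dim_def diff_type_eq_spec_type)

theorem corollary46:
  fixes d :: "'a::comm_ring_1 \<Rightarrow> 'a"
  assumes "ordinary_differential_ring (ring_of_type_algebra :: 'a ring) d"
    and "diff_spec (ring_of_type_algebra :: 'a ring) d \<noteq> {}"
    and "standard_ring (ring_of_type_algebra :: 'a ring) d"
    and "diff_type (ring_of_type_algebra :: 'a ring) d < \<infinity>"
    and "locally_nilpotent (ring_of_type_algebra :: 'a ring) d"
    and "diff_type (ring_of_type_algebra :: 'a ring) d = 0 \<or>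
         diff_dim (ring_of_type_algebra :: 'a ring) d < \<infinity>"
  shows "ordinary_J_ring d"
proof -
  let ?R = "ring_of_type_algebra :: 'a ring"
  obtain t where t: "diff_type ?R d = enat t" using assms(4) by (cases "diff_type ?R d") auto
  have dim: "t \<noteq> 0 \<Longrightarrow> diff_dim ?R d < \<infinity>" using assms(6) t by (simp add: zero_enat_def)
  have "diff_type (dpoly_ring n) (dpoly_deriv d) = max (enat t) 1 \<and>
       (t = 0 \<longrightarrow> diff_dim (dpoly_ring n) (dpoly_deriv d) = enat n) \<and>
       (t = 1 \<longrightarrow> diff_dim (dpoly_ring n) (dpoly_deriv d) = enat n + diff_dim ?R d) \<and>
       (1 < t \<longrightarrow> diff_dim (dpoly_ring n) (dpoly_deriv d) = diff_dim ?R d)" if n: "0 < n" for n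
  proof -
    interpret spectral_fibration "diff_spec (dpoly_ring n) (dpoly_deriv d)" "diff_spec ?R d"
      "\<lambda>P. {a. cst a \<in> P}" "\<lambda>i p. vars_in ({..<n} \<times> UNIV) \<inter> kernel_mod p {v. i \<le> fst v}"
      "diff_trdeg n" n
      by (rule spectral_fibration_dpoly_ring[OF assms(1,2,3,5) n])
    have T: "spec_type (diff_spec ?R d) = enat t" using t by (simp add: diff_type_eq_spec_type)
    show ?thesis
      unfolding diff_type_eq_spec_type diff_dim_eq_spec_dim
      using type_total[OF T] dim_total_type_0 dim_total_type_1 dim_total_type_gt_1[OF T] T
      by (auto simp: one_enat_def zero_enat_def)
  qed
  moreover have "enat t < 1 \<longleftrightarrow> t = 0" "enat t = 1 \<longleftrightarrow> t = 1" "1 < enat t \<longleftrightarrow> 1 < t"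
    by (auto simp: one_enat_def)
  ultimately show ?thesis
    using assms(1) dim unfolding ordinary_J_ring_def Let_def t by auto
qed

end
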